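(* Let $\mathcal{A}=(A_n)$ be a symmetric van Hove averaging sequence in $\mathbb{R}^d$, let $\mu$ be a translation-bounded Radon measure on $\mathbb{R}^d$ that has null FB spectrum with respect to $\mathcal{A}$, and let $\varLambda$ be a regular model set in $\mathbb{R}^d$. Then the Eberlein convolution $\mu\circledast\delta_{\varLambda}$ exists along $\mathcal{A}$ and $\mu\circledast\delta_{\varLambda}=0$.
   Context: A Radon measure $\mu$ on $\mathbb{R}^d$ is translation-bounded if $\sup_t|\mu|(t+K)<\infty$ for some compact $K$ with nonempty interior. An averaging sequence is a sequence $(A_n)$ of compact sets with $A_n\subset A_{n+1}^{\circ}$ and $\bigcup_nA_n=\mathbb{R}^d$; symmetric means $A_n=-A_n$; van Hove means $\lim_n\mathrm{vol}(\partial^KA_n)/\mathrm{vol}(A_n)=0$ for every compact $K$, where $\partial^K C=((C+K)\setminus C^{\circ})\cup((\overline{\mathbb{R}^d\setminus C}-K)\cap C)$. $\mu$ has null FB spectrum w.r.t. $\mathcal{A}$ if for all $k\in\mathbb{R}^d$, $\lim_n\frac{1}{\mathrm{vol}(A_n)}\int_{A_n}e^{-2\pi i kt}\,\mathrm{d}\mu(t)=0$ (limit existing). For translation-bounded $\mu,\nu$, the Eberlein convolution along $\mathcal{A}$ is the vague limit $\mu\circledast\nu=\lim_n\frac{\mu|_{A_n}*\nu|_{A_n}}{\mathrm{vol}(A_n)}$, said to exist when the limit exists; $\mu|_{A}$ is the restriction. $\delta_S=\sum_{x\in S}\delta_x$ is the Dirac comb of $S$. A cut and project scheme $(\mathbb{R}^d,H,\mathcal{L})$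 consists of a compactly generated locally compact Abelian group $H$ and a lattice (co-compact discrete subgroup) $\mathcal{L}\subset\mathbb{R}^d\times H$ such that the canonical projection $\pi$ to $\mathbb{R}^d$ is injective on $\mathcal{L}$ and the projection of $\mathcal{L}$ to $H$ is dense; with $L=\pi(\mathcal{L})$ the star map $x\mapsto x^\star$ sends $\pi(y)$ to the $H$-component of $y\in\mathcal{L}$. A regular model set is $\varLambda=\{x\in L: x^\star\in W\}$ with $W\subseteq H$ compact, $W=\overline{W^{\circ}}\neq\varnothing$, and $\partial W$ of Haar measure zero. *)

theory Defs
  imports "HOL-Analysis.Analysis"
begin

text \<open>A complex Radon measure mu on a Euclidean space is represented by its
  total variation measure nu = |mu| (a positive, locally finite Borel measure,
  hence Radon on R^d) together with a Borel density h with |h| = 1, so that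
  d mu = h d nu (polar decomposition).  Every complex Radon measure on R^d
  has such a representation.\<close>

definition radon_cmeasure :: "'a::euclidean_space measure \<Rightarrow> ('a \<Rightarrow> complex) \<Rightarrow> bool" where
  "radon_cmeasure \<nu> h \<longleftrightarrow>
     sets \<nu> = sets borel \<and>
     (\<forall>K. compact K \<longrightarrow> emeasure \<nu> K < \<infinity>) \<and>
     h \<in> borel_measurable borel \<and> (\<forall>x. norm (h x) = 1)"

definition cm_set_integral ::
  "'a::euclidean_space measure \<Rightarrow> ('a \<Rightarrow> complex) \<Rightarrow> 'a set \<Rightarrow> ('a \<Rightarrow> complex) \<Rightarrow> complex" where
  "cm_set_integral \<nu> h A f = (LINT x:A|\<nu>. f x * h x)"

definition translation_bounded :: "'a::euclidean_space measure \<Rightarrow> bool" where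
  "translation_bounded \<nu> \<longleftrightarrow>
     (\<exists>K. compact K \<and> interior K \<noteq> {} \<and>
          (SUP t. emeasure \<nu> ((\<lambda>x. t + x) ` K)) < \<infinity>)"

definition vol :: "'a::euclidean_space set \<Rightarrow> real" where
  "vol A = measure lebesgue A"

definition averaging_sequence :: "(nat \<Rightarrow> 'a::euclidean_space set) \<Rightarrow> bool" where
  "averaging_sequence A \<longleftrightarrow>
     (\<forall>n. compact (A n)) \<and> (\<forall>n. A n \<subseteq> interior (A (Suc n))) \<and> (\<Union>n. A n) = UNIV"

definition symmetric_sequence :: "(nat \<Rightarrow> 'a::euclidean_space set) \<Rightarrow> bool" where
  "symmetric_sequence A \<longleftrightarrow> (\<forall>n. uminus ` A n = A n)"

definition K_boundary :: "'a::euclidean_space set \<Rightarrow> 'a set \<Rightarrow> 'a set" where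
  "K_boundary K C =
     ({c + k | c k. c \<in> C \<and> k \<in> K} - interior C) \<union>
     ({y - k | y k. y \<in> closure (UNIV - C) \<and> k \<in> K} \<inter> C)"

definition van_Hove :: "(nat \<Rightarrow> 'a::euclidean_space set) \<Rightarrow> bool" where
  "van_Hove A \<longleftrightarrow>
     (\<forall>K. compact K \<longrightarrow> (\<lambda>n. vol (K_boundary K (A n)) / vol (A n)) \<longlonglongrightarrow> 0)"

definition null_FB_spectrum ::
  "(nat \<Rightarrow> 'a::euclidean_space set) \<Rightarrow> 'a measure \<Rightarrow> ('a \<Rightarrow> complex) \<Rightarrow> bool" where
  "null_FB_spectrum A \<nu> h \<longleftrightarrow>
     (\<forall>k::'a. (\<lambda>n. complex_of_real (1 / vol (A n)) *
                cm_set_integral \<nu> h (A n) (\<lambda>t. exp (- 2 * pi * \<i> * complex_of_real (k \<bullet> t))))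
              \<longlonglongrightarrow> 0)"

definition Cc :: "('a::euclidean_space \<Rightarrow> complex) set" where
  "Cc = {\<phi>. continuous_on UNIV \<phi> \<and> compact (closure {x. \<phi> x \<noteq> 0})}"

text \<open>(mu|_A * delta_S|_A)(phi) = sum over y in S cap A of
  integral over A of phi(x+y) d mu(x).\<close>
definition restr_conv_dirac ::
  "'a::euclidean_space measure \<Rightarrow> ('a \<Rightarrow> complex) \<Rightarrow> 'a set \<Rightarrow> 'a set \<Rightarrow> ('a \<Rightarrow> complex) \<Rightarrow> complex" where
  "restr_conv_dirac \<nu> h S A \<phi> = (\<Sum>y\<in>S \<inter> A. cm_set_integral \<nu> h A (\<lambda>x. \<phi> (x + y)))"

text \<open>The Eberlein convolution mu (*) delta_S along A exists and equals the
  zero measure: vague convergence of the normalised restricted convolutions to 0.\<close>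
definition eberlein_conv_dirac_is_zero ::
  "(nat \<Rightarrow> 'a::euclidean_space set) \<Rightarrow> 'a measure \<Rightarrow> ('a \<Rightarrow> complex) \<Rightarrow> 'a set \<Rightarrow> bool" where
  "eberlein_conv_dirac_is_zero A \<nu> h S \<longleftrightarrow>
     (\<forall>\<phi>\<in>Cc. (\<lambda>n. restr_conv_dirac \<nu> h S (A n) \<phi> / complex_of_real (vol (A n))) \<longlonglongrightarrow> 0)"

definition locally_compact_group :: "'h::{topological_ab_group_add, t2_space} itself \<Rightarrow> bool" where
  "locally_compact_group _ \<longleftrightarrow> (\<forall>x::'h. \<exists>U K. open U \<and> compact K \<and> x \<in> U \<and> U \<subseteq> K)"

inductive_set gen_subgroup :: "'h::ab_group_add set \<Rightarrow> 'h set" for C where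
  gen_zero: "0 \<in> gen_subgroup C"
| gen_base: "c \<in> C \<Longrightarrow> c \<in> gen_subgroup C"
| gen_minus: "x \<in> gen_subgroup C \<Longrightarrow> - x \<in> gen_subgroup C"
| gen_plus: "x \<in> gen_subgroup C \<Longrightarrow> y \<in> gen_subgroup C \<Longrightarrow> x + y \<in> gen_subgroup C"

definition compactly_generated :: "'h::{topological_ab_group_add, t2_space} itself \<Rightarrow> bool" where
  "compactly_generated _ \<longleftrightarrow> (\<exists>C::'h set. compact C \<and> gen_subgroup C = UNIV)"

definition haar_measure :: "'h::{topological_ab_group_add, t2_space} measure \<Rightarrow> bool" where
  "haar_measure m \<longleftrightarrow>
     sets m = sets borel \<and>
     emeasure m (space m) \<noteq> 0 \<and>
     (\<forall>K. compact K \<longrightarrow> emeasure m K < \<infinity>) \<and>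
     (\<forall>S\<in>sets borel. \<forall>x. emeasure m ((\<lambda>y. x + y) ` S) = emeasure m S) \<and>
     (\<forall>S\<in>sets borel. emeasure m S = (INF U\<in>{U. open U \<and> S \<subseteq> U}. emeasure m U)) \<and>
     (\<forall>U. open U \<longrightarrow> emeasure m U = (SUP K\<in>{K. compact K \<and> K \<subseteq> U}. emeasure m K))"

definition is_lattice :: "('a::euclidean_space \<times> 'h::{topological_ab_group_add, t2_space}) set \<Rightarrow> bool" where
  "is_lattice \<L> \<longleftrightarrow>
     0 \<in> \<L> \<and> (\<forall>x\<in>\<L>. \<forall>y\<in>\<L>. x - y \<in> \<L>) \<and>
     (\<forall>y\<in>\<L>. \<exists>U. open U \<and> U \<inter> \<L> = {y}) \<and>
     (\<exists>K. compact K \<and> {l + k | l k. l \<in> \<L> \<and> k \<in> K} = UNIV)"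

definition cut_and_project_scheme ::
  "('a::euclidean_space \<times> 'h::{topological_ab_group_add, t2_space}) set \<Rightarrow> bool" where
  "cut_and_project_scheme \<L> \<longleftrightarrow>
     locally_compact_group TYPE('h) \<and> compactly_generated TYPE('h) \<and>
     is_lattice \<L> \<and> inj_on fst \<L> \<and> closure (snd ` \<L>) = UNIV"

definition star_map :: "('a::euclidean_space \<times> 'h) set \<Rightarrow> 'a \<Rightarrow> 'h" where
  "star_map \<L> x = snd (THE y. y \<in> \<L> \<and> fst y = x)"

definition model_set :: "('a::euclidean_space \<times> 'h) set \<Rightarrow> 'h set \<Rightarrow> 'a set" where
  "model_set \<L> W = {x \<in> fst ` \<L>. star_map \<L> x \<in> W}"

definition regular_model_set ::
  "'h::{topological_ab_group_add, t2_space} measure \<Rightarrow> 'a::euclidean_space set \<Rightarrow> bool" where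
  "regular_model_set m \<Lambda> \<longleftrightarrow>
     (\<exists>\<L> W. cut_and_project_scheme (\<L> :: ('a \<times> 'h) set) \<and>
        compact W \<and> W = closure (interior W) \<and> W \<noteq> {} \<and>
        emeasure m (frontier W) = 0 \<and> \<Lambda> = model_set \<L> W)"

end

theory Submission
  imports Defs
begin

text \<open>
  Up to a boundary term, controlled by the symmetry and the van Hove property of \<open>A\<close>, the
  quantity to estimate is the average of \<open>g x = (\<Sum>l. \<phi> (x + l) * 1\<^sub>W(l\<^sup>\<star>))\<close> against \<open>\<mu>\<close>.
  Replacing the indicator \<open>1\<^sub>W\<close> by a continuous \<open>\<omega>\<close> which differs from it only near \<open>\<partial>W\<close> changes
  the average by at most the upper density of the lattice points falling near \<open>\<partial>W\<close>, which is small
  because \<open>\<partial>W\<close> is a Haar null set.  After the replacement, \<open>g\<close> is Bohr almost periodic, and it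
  remains to see that a limit \<open>\<Phi>\<close> of the averaging functionals, which kills all characters, kills
  all almost periodic functions.

  This is done one coordinate direction \<open>b\<close> at a time.  The sequence \<open>f j = \<Phi> (g (\<cdot> + j b))\<close> is almost
  periodic, and its ergodic averages twisted by \<open>z\<close> are the values of \<open>\<Phi>\<close> at a function that is
  \<open>z\<close>-quasi-periodic in direction \<open>b\<close>.  If all of them vanish, then Parseval's identity on a cyclic
  group forces \<open>f = 0\<close>.  Functions quasi-periodic in all directions are, up to a character, periodic,
  hence uniform limits of trigonometric polynomials.
\<close>

section \<open>Almost periodic sequences\<close>

text \<open>The obstacle is that \<open>\<Phi>\<close> is not translation invariant: it integrates
  against a fixed measure, so ergodic averages act on \<open>g\<close> only, and the value of
  \<open>\<Phi>\<close> at an averaged function does not determine \<open>\<Phi> g\<close>. Hence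
  the values at all integer translates along a direction are kept as a sequence \<open>f\<close>,
  and one needs that an almost periodic sequence whose twisted means all vanish is zero. An energy
  argument in the spirit of Wiener gives this: almost periods make up a positive proportion of all
  shifts, and at each of them the autocorrelation of a nonzero \<open>f\<close> is large, whereas
  small exponential sums make the autocorrelation small in mean square. The averages kill characters
  only asymptotically. A limit functional kills them exactly, and this exact property is what the
  induction over directions carries along. Each averaging creates a multiplier in one direction
  only, so basis vectors are used up one by one; at the end the period lattice is the integer
  lattice spanned by \<open>Basis\<close>, and Stone-Weierstrass on the torus applies.\<close>

lemma cis_orthogonality:
  assumes "a < M" "b < M"
  shows "(\<Sum>k<M. cis (2 * pi * (real k * real a) / M) * cnj (cis (2 * pi * (real k * real b) / M)))
         = (if a = b then of_nat M else 0)"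
proof -
  define z where "z = cis (2 * pi * (real a - real b) / M)"
  have M: "M > 0" using assms by auto
  have eq: "cis (2 * pi * (real k * real a) / M) * cnj (cis (2 * pi * (real k * real b) / M)) = z ^ k" for k
    unfolding z_def Complex.DeMoivre cis_cnj cis_mult
    by (rule arg_cong[where f=cis]) (simp add: algebra_simps diff_divide_distrib)
  have sum_eq: "(\<Sum>k<M. cis (2 * pi * (real k * real a) / M) * cnj (cis (2 * pi * (real k * real b) / M)))
      = (\<Sum>k<M. z ^ k)"
    by (rule sum.cong[OF refl], rule eq)
  show ?thesis
  proof (cases "a = b")
    case True
    then have "z = 1" unfolding z_def by simp
    then show ?thesis unfolding sum_eq using True by simp
  next
    case False
    have "z \<noteq> 1"
    proof
      assume "z = 1"
      then have "cos (2 * pi * (real a - real b) / M) = 1"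
        unfolding z_def by (simp add: complex_eq_iff)
      then obtain n :: int where "2 * pi * (real a - real b) / M = n * 2 * pi"
        by (subst (asm) cos_one_2pi_int) auto
      then have "(2 * pi) * (real a - real b) = (2 * pi) * (n * M)" using M by (simp add: field_simps)
      then have "real a - real b = n * M" by (subst (asm) mult_cancel_left) simp
      then have "int a - int b = n * int M" by (metis of_int_diff of_int_eq_iff of_int_mult of_int_of_nat_eq)
      then have "int M dvd int a - int b" by simp
      then have "int a - int b = 0"
        using assms dvd_imp_le_int[of "int a - int b" "int M"] by fastforce
      then show False using False by simp
    qed
    moreover have "z ^ M = 1"
    proof -
      have "z ^ M = cis (2 * pi * real_of_int (int a - int b))"
        unfolding z_def Complex.DeMoivre by (rule arg_cong[where f=cis]) (use M in simp)
      then show ?thesis by (metis cis_multiple_2pi Ints_of_int)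
    qed
    ultimately show ?thesis unfolding sum_eq using False by (simp add: geometric_sum)
  qed
qed

text \<open>Orthogonality leaves only the diagonal of the expanded square; the transform is not
  normalised, hence the factor \<open>M\<close>.\<close>

lemma dft_Parseval:
  fixes u :: "nat \<Rightarrow> complex"
  shows "(\<Sum>s<M. (cmod (\<Sum>k<M. u k * cis (2 * pi * (real s * real k) / M)))\<^sup>2) = M * (\<Sum>k<M. (cmod (u k))\<^sup>2)"
proof -
  let ?w = "\<lambda>s k::nat. cis (2 * pi * (real s * real k) / M)"
  have "complex_of_real (\<Sum>s<M. (cmod (\<Sum>k<M. u k * ?w s k))\<^sup>2)
      = (\<Sum>s<M. (\<Sum>k<M. u k * ?w s k) * cnj (\<Sum>l<M. u l * ?w s l))"
    by (simp only: of_real_sum complex_norm_square)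
  also have "\<dots> = (\<Sum>s<M. \<Sum>k<M. \<Sum>l<M. u k * cnj (u l) * (?w s k * cnj (?w s l)))"
    by (simp only: cnj_sum sum_product complex_cnj_mult mult.assoc mult.left_commute)
  also have "\<dots> = (\<Sum>k<M. \<Sum>s<M. \<Sum>l<M. u k * cnj (u l) * (?w s k * cnj (?w s l)))"
    by (rule sum.swap)
  also have "\<dots> = (\<Sum>k<M. \<Sum>l<M. \<Sum>s<M. u k * cnj (u l) * (?w s k * cnj (?w s l)))"
    by (rule sum.cong[OF refl], rule sum.swap)
  also have "\<dots> = (\<Sum>k<M. \<Sum>l<M. u k * cnj (u l) * (if k = l then of_nat M else 0))"
    by (rule sum.cong[OF refl], rule sum.cong[OF refl])
       (simp only: sum_distrib_left[symmetric] cis_orthogonality lessThan_iff)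
  also have "\<dots> = (\<Sum>k<M. u k * cnj (u k) * of_nat M)"
    by (simp add: if_distrib sum.delta cong: if_cong)
  also have "\<dots> = complex_of_real (M * (\<Sum>k<M. (cmod (u k))\<^sup>2))"
    by (simp only: of_real_mult of_real_sum complex_norm_square sum_distrib_left of_real_of_nat_eq mult.commute)
  finally show ?thesis by (simp only: of_real_eq_iff)
qed

text \<open>On a cyclic group the correlation is, up to a factor, the transform of a product of two
  transforms. One of them is at most \<open>B\<close> pointwise, so Parseval leaves only the energy
  of the other, which the bound \<open>C\<close> controls.\<close>

lemma correlation_bound:
  fixes f :: "int \<Rightarrow> complex"
  assumes C: "\<And>j. cmod (f j) \<le> C"
    and B: "\<And>z. cmod z = 1 \<Longrightarrow> cmod (\<Sum>j<N. f (int j) * z ^ j) \<le> B"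
  shows "(\<Sum>s<N. (cmod (\<Sum>j<N. cnj (f (int j)) * f (int s + int j)))\<^sup>2) \<le> B\<^sup>2 * (2 * real N * C\<^sup>2)"
proof (cases "N = 0")
  case False
  \<comment> \<open>Length \<open>2 * N\<close> prevents wrap-around: \<open>s + j\<close> stays
    below it for \<open>s, j < N\<close>, so cyclic and ordinary correlation agree. \<open>U\<close>
    transforms \<open>f\<close> cut off at \<open>N\<close>, \<open>V\<close> transforms
    \<open>f\<close> on the full range.\<close>
  let ?M = "2 * N"
  let ?w = "\<lambda>s k::nat. cis (2 * pi * (real s * real k) / real (2 * N))"
  define U where "U k = (\<Sum>j<N. f (int j) * ?w k j)" for k
  define V where "V k = (\<Sum>i<?M. f (int i) * ?w k i)" for k
  define c where "c s = (\<Sum>j<N. cnj (f (int j)) * f (int s + int j))" for s :: nat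
  have Ub: "cmod (U k) \<le> B" for k
  proof -
    have "?w k j = cis (2 * pi * real k / real (2 * N)) ^ j" for j
      unfolding Complex.DeMoivre by (rule arg_cong[where f=cis]) simp
    then show ?thesis unfolding U_def using B[of "cis (2 * pi * real k / real (2 * N))"] by simp
  qed
  have V2: "(\<Sum>k<?M. (cmod (V k))\<^sup>2) \<le> ?M * (?M * C\<^sup>2)"
  proof -
    have "(\<Sum>k<?M. (cmod (V k))\<^sup>2) = ?M * (\<Sum>i<?M. (cmod (f (int i)))\<^sup>2)"
      unfolding V_def by (rule dft_Parseval)
    also have "\<dots> \<le> ?M * (\<Sum>i<?M. C\<^sup>2)"
      by (intro mult_left_mono sum_mono power_mono C) auto
    finally show ?thesis by simp
  qed
  have corr: "(\<Sum>k<?M. cnj (V k) * U k * ?w s k) = ?M * cnj (c s)" if s: "s < N" for s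
  proof -
    have "(\<Sum>k<?M. cnj (V k) * U k * ?w s k)
       = (\<Sum>k<?M. \<Sum>i<?M. \<Sum>j<N. cnj (f (int i)) * f (int j) * (?w k (s + j) * cnj (?w k i)))"
      unfolding U_def V_def
    proof (rule sum.cong[OF refl])
      fix k
      have ws: "?w k (s + j) = ?w k j * ?w s k" for j
        by (simp add: cis_mult algebra_simps add_divide_distrib)
      show "cnj (\<Sum>i<?M. f (int i) * ?w k i) * (\<Sum>j<N. f (int j) * ?w k j) * ?w s k
        = (\<Sum>i<?M. \<Sum>j<N. cnj (f (int i)) * f (int j) * (?w k (s + j) * cnj (?w k i)))"
        unfolding ws cnj_sum complex_cnj_mult
        unfolding sum_product
        unfolding sum_distrib_right
        by (intro sum.cong refl) (simp only: mult_ac)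
    qed
    also have "\<dots> = (\<Sum>i<?M. \<Sum>k<?M. \<Sum>j<N. cnj (f (int i)) * f (int j) * (?w k (s + j) * cnj (?w k i)))"
      by (rule sum.swap)
    also have "\<dots> = (\<Sum>i<?M. \<Sum>j<N. \<Sum>k<?M. cnj (f (int i)) * f (int j) * (?w k (s + j) * cnj (?w k i)))"
      by (rule sum.cong[OF refl], rule sum.swap)
    also have "\<dots> = (\<Sum>i<?M. \<Sum>j<N. cnj (f (int i)) * f (int j) * (if s + j = i then of_nat ?M else 0))"
    proof (rule sum.cong[OF refl], rule sum.cong[OF refl])
      fix i j assume "i \<in> {..<?M}" "j \<in> {..<N}"
      then have "s + j < ?M" "i < ?M" using s by auto
      from cis_orthogonality[OF this]
      show "(\<Sum>k<?M. cnj (f (int i)) * f (int j) * (?w k (s + j) * cnj (?w k i))) =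
           cnj (f (int i)) * f (int j) * (if s + j = i then of_nat ?M else 0)"
        by (simp only: sum_distrib_left[symmetric])
    qed
    also have "\<dots> = (\<Sum>j<N. \<Sum>i<?M. cnj (f (int i)) * f (int j) * (if s + j = i then of_nat ?M else 0))"
      by (rule sum.swap)
    also have "\<dots> = (\<Sum>j<N. of_nat ?M * (f (int j) * cnj (f (int s + int j))))"
    proof (rule sum.cong[OF refl])
      fix j assume "j \<in> {..<N}"
      then have "s + j < ?M" using s by auto
      then show "(\<Sum>i<?M. cnj (f (int i)) * f (int j) * (if s + j = i then of_nat ?M else 0))
          = of_nat ?M * (f (int j) * cnj (f (int s + int j)))"
        by (simp add: if_distrib sum.delta mult_ac cong: if_cong)
    qed
    also have "\<dots> = ?M * cnj (c s)"
      by (simp add: c_def sum_distrib_left)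
    finally show ?thesis .
  qed
  have "(real ?M)\<^sup>2 * (\<Sum>s<N. (cmod (c s))\<^sup>2) = (\<Sum>s<N. (cmod (\<Sum>k<?M. cnj (V k) * U k * ?w s k))\<^sup>2)"
    unfolding sum_distrib_left
  proof (rule sum.cong[OF refl])
    fix s assume "s \<in> {..<N}"
    then show "(real ?M)\<^sup>2 * (cmod (c s))\<^sup>2 = (cmod (\<Sum>k<?M. cnj (V k) * U k * ?w s k))\<^sup>2"
      using corr[of s] by (simp only: lessThan_iff norm_mult power_mult_distrib norm_of_nat complex_mod_cnj)
  qed
  also have "\<dots> \<le> (\<Sum>s<?M. (cmod (\<Sum>k<?M. cnj (V k) * U k * ?w s k))\<^sup>2)"
    by (rule sum_mono2) auto
  also have "\<dots> = ?M * (\<Sum>k<?M. (cmod (cnj (V k) * U k))\<^sup>2)"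
    by (rule dft_Parseval)
  also have "\<dots> \<le> ?M * (\<Sum>k<?M. B\<^sup>2 * (cmod (V k))\<^sup>2)"
    by (intro mult_left_mono sum_mono)
       (auto simp: norm_mult power_mult_distrib mult.commute intro!: mult_right_mono power_mono Ub)
  also have "\<dots> = ?M * (B\<^sup>2 * (\<Sum>k<?M. (cmod (V k))\<^sup>2))"
    by (simp add: sum_distrib_left)
  also have "\<dots> \<le> ?M * (B\<^sup>2 * (?M * (?M * C\<^sup>2)))"
    by (intro mult_left_mono V2) auto
  finally have "(real ?M)\<^sup>2 * (\<Sum>s<N. (cmod (c s))\<^sup>2) \<le> (real ?M)\<^sup>2 * (B\<^sup>2 * (?M * C\<^sup>2))"
    by (simp add: power2_eq_square algebra_simps)
  then have "(\<Sum>s<N. (cmod (c s))\<^sup>2) \<le> B\<^sup>2 * (?M * C\<^sup>2)"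
    using False by (simp add: algebra_simps)
  then show ?thesis by (simp add: c_def)
qed simp

text \<open>Pigeonhole: sort the shifts below \<open>N\<close> by their nearest net element; some
  class has at least \<open>N / card S\<close> members, and differences within a class are almost
  periods. The proportion \<open>1 / card S\<close> does not depend on \<open>N\<close>, which is
  what allows \<open>N\<close> to be chosen last.\<close>

lemma almost_periods_dense:
  fixes f :: "int \<Rightarrow> complex"
  assumes S: "finite S" "\<And>s. \<exists>s'\<in>S. \<forall>j. cmod (f (s + j) - f (s' + j)) \<le> \<delta>" and "N > 0"
  obtains D where "D \<subseteq> {..<N}" "N \<le> card S * card D" "\<And>d j. d \<in> D \<Longrightarrow> cmod (f (int d + j) - f j) \<le> 2 * \<delta>"
proof -
  obtain r where r: "\<And>s. r s \<in> S" "\<And>s j. cmod (f (s + j) - f (r s + j)) \<le> \<delta>"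
    using S(2) by metis
  define Cl where "Cl t = {s\<in>{..<N}. r (int s) = t}" for t
  have "N = card (\<Union>t\<in>S. Cl t)"
  proof -
    have "(\<Union>t\<in>S. Cl t) = {..<N}" using r(1) by (auto simp: Cl_def)
    then show ?thesis by simp
  qed
  also have "\<dots> \<le> (\<Sum>t\<in>S. card (Cl t))" by (rule card_UN_le[OF S(1)])
  finally have N: "N \<le> (\<Sum>t\<in>S. card (Cl t))" .
  have "S \<noteq> {}" using r(1) by auto
  have "\<exists>t\<in>S. N \<le> card S * card (Cl t)"
  proof (rule ccontr)
    assume "\<not> ?thesis"
    then have "(\<Sum>t\<in>S. card S * card (Cl t)) < (\<Sum>t\<in>S. N)"
      using S(1) \<open>S \<noteq> {}\<close> by (intro sum_strict_mono) auto
    then have "card S * (\<Sum>t\<in>S. card (Cl t)) < card S * N" by (simp add: sum_distrib_left)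
    then show False using N by simp
  qed
  then obtain t where t: "N \<le> card S * card (Cl t)" by blast
  have fin: "finite (Cl t)" by (simp add: Cl_def)
  have ne: "Cl t \<noteq> {}" using t \<open>N > 0\<close> by (metis card.empty mult_0_right not_less)
  \<comment> \<open>Measuring from the least member keeps all differences nonnegative and below
    \<open>N\<close>.\<close>
  define s0 where "s0 = Min (Cl t)"
  have s0: "s0 \<in> Cl t" "\<And>s. s \<in> Cl t \<Longrightarrow> s0 \<le> s" using fin ne by (auto simp: s0_def)
  show ?thesis
  proof (rule that[of "(\<lambda>s. s - s0) ` Cl t"])
    show "(\<lambda>s. s - s0) ` Cl t \<subseteq> {..<N}" by (auto simp: Cl_def)
    have "inj_on (\<lambda>s. s - s0) (Cl t)" using s0(2) by (auto simp: inj_on_def) (metis eq_diff_iff)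
    then show "N \<le> card S * card ((\<lambda>s. s - s0) ` Cl t)" using t by (simp add: card_image)
    fix d j assume "d \<in> (\<lambda>s. s - s0) ` Cl t"
    then obtain s where s: "s \<in> Cl t" "d = s - s0" by auto
    have d: "int d = int s - int s0" using s s0(2) by auto
    have eq: "r (int s) = t" "r (int s0) = t" using s s0 by (auto simp: Cl_def)
    have "cmod (f (int s + (j - int s0)) - f (t + (j - int s0))) \<le> \<delta>"
      "cmod (f (int s0 + (j - int s0)) - f (t + (j - int s0))) \<le> \<delta>"
      using r(2)[of "int s" "j - int s0"] r(2)[of "int s0" "j - int s0"] by (simp_all add: eq)
    then have "cmod (f (int s + (j - int s0)) - f (int s0 + (j - int s0))) \<le> \<delta> + \<delta>"
      by (smt (verit, best) norm_triangle_ineq4 add_diff_cancel_right' diff_diff_eq2 diff_add_cancel)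
    then show "cmod (f (int d + j) - f j) \<le> 2 * \<delta>"
      unfolding d by (simp add: algebra_simps)
  qed
qed

lemma sum_lessThan_add:
  fixes g :: "nat \<Rightarrow> 'b::comm_monoid_add"
  shows "(\<Sum>j<m + n. g j) = (\<Sum>j<m. g j) + (\<Sum>j<n. g (m + j))"
  by (induction n) (simp_all add: add.assoc)

text \<open>The hypothesis gives a block length depending on \<open>z\<close>. The bound is stable
  under small changes of \<open>z\<close>, so finitely many lengths serve the compact circle, and it
  passes to multiples of a length, so their product serves every \<open>z\<close>.\<close>

lemma uniform_exponential_sum_bound:
  fixes f :: "int \<Rightarrow> complex"
  assumes C: "\<And>j. cmod (f j) \<le> C"
    and avg: "\<And>z e. cmod z = 1 \<Longrightarrow> e > 0 \<Longrightarrow>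
            \<exists>N>0. \<forall>x. cmod (\<Sum>j<N. f (x + int j) * z ^ j) \<le> e * real N"
    and e: "e > 0"
  obtains N where "N > 0" "\<And>z. cmod z = 1 \<Longrightarrow> cmod (\<Sum>j<N. f (int j) * z ^ j) \<le> e * real N"
proof -
  define G where "G N w = {z. \<forall>x. cmod (\<Sum>j<N. f (x + int j) * z ^ j) \<le> w * real N}" for N w
  have "\<exists>N>0. \<exists>U. open U \<and> z \<in> U \<and> U \<inter> sphere 0 1 \<subseteq> G N e" if z: "z \<in> sphere 0 1" for z
  proof -
    from avg[of z "e/2"] z e obtain N where N: "N > 0" "z \<in> G N (e/2)"
      by (auto simp: G_def)
    \<comment> \<open>Only the bound \<open>C\<close> on \<open>f\<close> enters \<open>D\<close>,
      so it controls the change from \<open>z\<close> to \<open>w\<close> at every starting point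
      simultaneously.\<close>
    define D where "D w = (\<Sum>j<N. C * cmod (w ^ j - z ^ j))" for w
    have "continuous_on UNIV D" unfolding D_def by (intro continuous_intros)
    then have "open {w. D w < e / 2 * real N}"
      by (intro open_Collect_less continuous_intros) auto
    moreover have "z \<in> {w. D w < e / 2 * real N}" using N e by (simp add: D_def)
    moreover have "w \<in> G N e" if w: "D w < e / 2 * real N" for w
      unfolding G_def
    proof (intro CollectI allI)
      fix x
      have "(\<Sum>j<N. f (x + int j) * w ^ j) = (\<Sum>j<N. f (x + int j) * z ^ j) + (\<Sum>j<N. f (x + int j) * (w ^ j - z ^ j))"
        by (simp add: sum.distrib[symmetric] algebra_simps)
      then have "cmod (\<Sum>j<N. f (x + int j) * w ^ j) \<le> cmod (\<Sum>j<N. f (x + int j) * z ^ j) + cmod (\<Sum>j<N. f (x + int j) * (w ^ j - z ^ j))"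
        by (simp add: norm_triangle_ineq)
      also have "cmod (\<Sum>j<N. f (x + int j) * (w ^ j - z ^ j)) \<le> D w"
        unfolding D_def by (rule sum_norm_le) (auto simp: norm_mult intro: mult_right_mono C)
      also have "cmod (\<Sum>j<N. f (x + int j) * z ^ j) \<le> e / 2 * real N" using N by (simp add: G_def)
      finally show "cmod (\<Sum>j<N. f (x + int j) * w ^ j) \<le> e * real N" using w by simp
    qed
    ultimately show ?thesis using N by blast
  qed
  then obtain n U where nU: "\<And>z. z \<in> sphere 0 1 \<Longrightarrow> n z > 0 \<and> open (U z) \<and> z \<in> U z \<and> U z \<inter> sphere 0 1 \<subseteq> G (n z) e"
    by metis
  have "compact (sphere (0::complex) 1)" by simp
  moreover have "\<And>z. z \<in> sphere 0 1 \<Longrightarrow> open (U z)" using nU by blast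
  moreover have "sphere 0 1 \<subseteq> (\<Union>z\<in>sphere 0 1. U z)" using nU by blast
  ultimately obtain T where T: "T \<subseteq> sphere 0 1" "finite T" "sphere 0 1 \<subseteq> (\<Union>z\<in>T. U z)"
    by (rule compactE_image)
  define P where "P = (\<Prod>z\<in>T. n z)"
  have "P > 0" unfolding P_def using T nU by (intro prod_pos) blast
  \<comment> \<open>A long sum is a concatenation of blocks of length \<open>N\<close> with
    different starting points; this is why \<open>G\<close> quantifies over
    \<open>x\<close>.\<close>
  have mult: "w \<in> G (N * k) e" if w: "w \<in> G N e" "cmod w = 1" for w N k
    unfolding G_def
  proof (intro CollectI allI, induction k)
    case (Suc k)
    have "(\<Sum>j<N * Suc k. f (x + int j) * w ^ j)
        = (\<Sum>j<N * k. f (x + int j) * w ^ j) + (\<Sum>j<N. f (x + int (j + N * k)) * w ^ (j + N * k))"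
      using sum_lessThan_add[of "\<lambda>j. f (x + int j) * w ^ j" "N * k" N] by (simp add: add.commute)
    also have "(\<Sum>j<N. f (x + int (j + N * k)) * w ^ (j + N * k)) = w ^ (N * k) * (\<Sum>j<N. f ((x + int (N * k)) + int j) * w ^ j)"
      by (simp add: sum_distrib_left power_add mult_ac add_ac)
    finally have "cmod (\<Sum>j<N * Suc k. f (x + int j) * w ^ j) \<le> cmod (\<Sum>j<N * k. f (x + int j) * w ^ j)
         + cmod (w ^ (N * k) * (\<Sum>j<N. f ((x + int (N * k)) + int j) * w ^ j))"
      by (simp only: norm_triangle_ineq)
    also have "cmod (w ^ (N * k) * (\<Sum>j<N. f ((x + int (N * k)) + int j) * w ^ j)) \<le> e * real N"
      using w unfolding G_def by (simp only: norm_mult norm_power power_one mult_1_left mem_Collect_eq)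
    also have "cmod (\<Sum>j<N * k. f (x + int j) * w ^ j) \<le> e * real (N * k)" by (rule Suc.IH)
    finally show ?case by (simp add: algebra_simps)
  qed simp
  show ?thesis
  proof (rule that[OF \<open>P > 0\<close>])
    fix z :: complex assume z: "cmod z = 1"
    then obtain t where t: "t \<in> T" "z \<in> U t" using T by (force simp: sphere_def)
    then have "z \<in> G (n t) e" using nU T z by (fastforce simp: sphere_def)
    moreover have "P = n t * (\<Prod>z\<in>T - {t}. n z)" unfolding P_def using t T by (simp add: prod.remove)
    ultimately have "z \<in> G P e" using mult z by simp
    then show "cmod (\<Sum>j<P. f (int j) * z ^ j) \<le> e * real P" unfolding G_def by (auto dest: spec[of _ 0])
  qed
qed

text \<open>If \<open>f 0\<close> were nonzero, almost periods would give \<open>f\<close> positive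
  mean energy, and finer almost periods would give correlations of size comparable to
  \<open>N\<close> on a positive proportion of shifts. Their squares would then sum to order
  \<open>N^3\<close> with a fixed constant, against \<open>correlation_bound\<close>.\<close>

lemma almost_periodic_sequence_zero:
  fixes f :: "int \<Rightarrow> complex"
  assumes C: "\<And>j. cmod (f j) \<le> C"
    and net: "\<And>\<delta>. \<delta> > 0 \<Longrightarrow> \<exists>S. finite S \<and> (\<forall>s. \<exists>s'\<in>S. \<forall>j. cmod (f (s + j) - f (s' + j)) \<le> \<delta>)"
    and avg: "\<And>z e. cmod z = 1 \<Longrightarrow> e > 0 \<Longrightarrow>
            \<exists>N>0. \<forall>x. cmod (\<Sum>j<N. f (x + int j) * z ^ j) \<le> e * real N"
  shows "f 0 = 0"
proof (rule ccontr)
  assume "f 0 \<noteq> 0"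
  define \<eta> where "\<eta> = cmod (f 0)"
  have \<eta>: "\<eta> > 0" using \<open>f 0 \<noteq> 0\<close> by (simp add: \<eta>_def)
  have C0: "C > 0" using C[of 0] \<eta> unfolding \<eta>_def by linarith
  obtain S1 where S1: "finite S1" "\<And>s. \<exists>s'\<in>S1. \<forall>j. cmod (f (s + j) - f (s' + j)) \<le> \<eta> / 4"
    using net[of "\<eta> / 4"] \<eta> by auto
  define m1 where "m1 = real (card S1)"
  have "S1 \<noteq> {}" using S1(2)[of 0] by auto
  then have m1: "m1 > 0" using S1(1) by (simp add: m1_def card_gt_0_iff)
  \<comment> \<open>A proportion \<open>1 / m1\<close> of indices has modulus at least
    \<open>\<eta> / 2\<close>, so \<open>\<kappa>\<close> is a lower bound for the mean of the
    squared modulus, for every \<open>N\<close>.\<close>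
  define \<kappa> where "\<kappa> = (\<eta> / 2)\<^sup>2 / m1"
  have \<kappa>: "\<kappa> > 0" using \<eta> m1 by (simp add: \<kappa>_def)
  \<comment> \<open>Moving by a \<open>2 * \<delta>\<close> almost period changes the correlation by
    at most \<open>2 * \<delta> * C * N\<close>, that is half of the lower bound
    \<open>\<kappa> * N\<close>.\<close>
  define \<delta> where "\<delta> = \<kappa> / (4 * C)"
  have \<delta>: "\<delta> > 0" using \<kappa> C0 by (simp add: \<delta>_def)
  obtain S2 where S2: "finite S2" "\<And>s. \<exists>s'\<in>S2. \<forall>j. cmod (f (s + j) - f (s' + j)) \<le> \<delta>"
    using net[OF \<delta>] by auto
  define m2 where "m2 = real (card S2)"
  have "S2 \<noteq> {}" using S2(2)[of 0] by auto
  then have m2: "m2 > 0" using S2(1) by (simp add: m2_def card_gt_0_iff)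
  \<comment> \<open>Tuned so that \<open>correlation_bound\<close> yields
    \<open>\<kappa>^2 * N^3 / (8 * m2)\<close>, half of the lower bound
    \<open>\<kappa>^2 * N^3 / (4 * m2)\<close> coming from the almost periods.\<close>
  define e where "e = sqrt (\<kappa>\<^sup>2 / (16 * m2 * C\<^sup>2))"
  have e: "e > 0" using \<kappa> m2 C0 by (simp add: e_def)
  have e2: "e\<^sup>2 = \<kappa>\<^sup>2 / (16 * m2 * C\<^sup>2)" using m2 by (simp add: e_def)
  obtain N where N: "N > 0" "\<And>z. cmod z = 1 \<Longrightarrow> cmod (\<Sum>j<N. f (int j) * z ^ j) \<le> e * real N"
    using uniform_exponential_sum_bound[OF C avg e] by blast
  obtain D1 where D1: "D1 \<subseteq> {..<N}" "N \<le> card S1 * card D1" "\<And>d j. d \<in> D1 \<Longrightarrow> cmod (f (int d + j) - f j) \<le> 2 * (\<eta> / 4)"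
    using almost_periods_dense[OF S1 N(1)] by blast
  obtain D2 where D2: "D2 \<subseteq> {..<N}" "N \<le> card S2 * card D2" "\<And>d j. d \<in> D2 \<Longrightarrow> cmod (f (int d + j) - f j) \<le> 2 * \<delta>"
    using almost_periods_dense[OF S2 N(1)] by blast
  have "real N \<le> real (card S1 * card D1)" using D1(2) by (simp only: of_nat_le_iff)
  then have c1: "real N / m1 \<le> card D1" using m1 by (simp add: m1_def field_simps)
  have "real N \<le> real (card S2 * card D2)" using D2(2) by (simp only: of_nat_le_iff)
  then have c2: "real N / m2 \<le> card D2" using m2 by (simp add: m2_def field_simps)
  define Q where "Q = (\<Sum>j<N. (cmod (f (int j)))\<^sup>2)"
  have Q: "\<kappa> * N \<le> Q"
  proof -
    have "\<kappa> * N = (real N / m1) * (\<eta> / 2)\<^sup>2" by (simp add: \<kappa>_def)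
    also have "\<dots> \<le> card D1 * (\<eta> / 2)\<^sup>2" by (rule mult_right_mono[OF c1]) simp
    also have "\<dots> = (\<Sum>d\<in>D1. (\<eta> / 2)\<^sup>2)" by simp
    also have "\<dots> \<le> (\<Sum>d\<in>D1. (cmod (f (int d)))\<^sup>2)"
    proof (intro sum_mono power_mono)
      fix d assume "d \<in> D1"
      from D1(3)[OF this, of 0] have "cmod (f (int d) - f 0) \<le> \<eta> / 2" by simp
      then show "\<eta> / 2 \<le> cmod (f (int d))"
        using norm_triangle_ineq3[of "f (int d)" "f 0"] by (simp add: \<eta>_def)
    qed (use \<eta> in auto)
    also have "\<dots> \<le> Q" unfolding Q_def by (rule sum_mono2) (use D1 in auto)
    finally show ?thesis .
  qed
  let ?c = "\<lambda>s. \<Sum>j<N. cnj (f (int j)) * f (int s + int j)"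
  have "(N / m2) * (\<kappa> / 2 * N)\<^sup>2 \<le> card D2 * (\<kappa> / 2 * N)\<^sup>2" by (rule mult_right_mono[OF c2]) simp
  also have "\<dots> = (\<Sum>d\<in>D2. (\<kappa> / 2 * N)\<^sup>2)" by simp
  also have "\<dots> \<le> (\<Sum>d\<in>D2. (cmod (?c d))\<^sup>2)"
  proof (intro sum_mono power_mono)
    fix d assume d: "d \<in> D2"
    have "complex_of_real Q = (\<Sum>j<N. cnj (f (int j)) * f (int j))"
      unfolding Q_def of_real_sum complex_norm_square by (simp add: mult.commute)
    then have "?c d - complex_of_real Q = (\<Sum>j<N. cnj (f (int j)) * (f (int d + int j) - f (int j)))"
      by (simp add: sum_subtractf algebra_simps)
    also have "cmod \<dots> \<le> (\<Sum>j<N. C * (2 * \<delta>))"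
      by (rule sum_norm_le) (auto simp: norm_mult intro!: mult_mono C D2(3) d less_imp_le[OF C0])
    also have "\<dots> = \<kappa> / 2 * N" using C0 by (simp add: \<delta>_def)
    finally have "cmod (?c d - complex_of_real Q) \<le> \<kappa> / 2 * N" .
    moreover have "cmod (complex_of_real Q) \<le> cmod (?c d) + cmod (?c d - complex_of_real Q)"
      by (metis norm_minus_commute norm_triangle_sub)
    moreover have "Q \<le> cmod (complex_of_real Q)" by simp
    ultimately show "\<kappa> / 2 * N \<le> cmod (?c d)" using Q by linarith
  qed (use \<kappa> in auto)
  also have "\<dots> \<le> (\<Sum>d<N. (cmod (?c d))\<^sup>2)" by (rule sum_mono2) (use D2 in auto)
  also have "\<dots> \<le> (e * real N)\<^sup>2 * (2 * real N * C\<^sup>2)"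
    by (rule correlation_bound[OF C N(2)])
  also have "\<dots> = \<kappa>\<^sup>2 * N\<^sup>2 * N / (8 * m2)"
    unfolding power_mult_distrib e2 using C0 m2 by (simp add: field_simps)
  finally have "\<kappa>\<^sup>2 * N\<^sup>2 * N / (4 * m2) \<le> \<kappa>\<^sup>2 * N\<^sup>2 * N / (8 * m2)"
    using m2 by (simp add: power_mult_distrib power_divide field_simps)
  then show False using \<kappa> N(1) m2 by (simp add: field_simps)
qed

section \<open>Ergodic averages of almost periodic functions\<close>

definition avg_op :: "('b::real_vector \<Rightarrow> 'b) \<Rightarrow> nat \<Rightarrow> 'b \<Rightarrow> 'b" where
  "avg_op U N x = (\<Sum>j<N. (U ^^ j) x) /\<^sub>R real N"

context
  fixes U :: "'b::{real_normed_vector,complete_space} \<Rightarrow> 'b"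
  assumes lin: "bounded_linear U" and contr: "\<And>x. norm (U x) \<le> norm x"
begin

lemma funpow_linear: "linear (U ^^ n)"
proof (induction n)
  case (Suc n)
  then show ?case using linear_compose[OF Suc bounded_linear.linear[OF lin]] by (simp add: o_def)
qed (simp add: id_def linear_iff)

lemma funpow_contraction: "norm ((U ^^ n) x) \<le> norm x"
  by (induction n) (auto intro: order_trans[OF contr])

lemma avg_op_diff: "avg_op U N (x - y) = avg_op U N x - avg_op U N y"
  by (simp add: avg_op_def linear_diff[OF funpow_linear] sum_subtractf scaleR_diff_right)

lemma avg_op_contraction: "norm (avg_op U N x) \<le> norm x"
proof (cases "N = 0")
  case False
  have "norm (\<Sum>j<N. (U ^^ j) x) \<le> real (card {..<N}) * norm x"
    by (rule sum_norm_bound) (rule funpow_contraction)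
  then show ?thesis using False by (simp add: avg_op_def field_simps)
qed (simp add: avg_op_def)

lemma funpow_avg_op: "(U ^^ i) (avg_op U N x) = avg_op U N ((U ^^ i) x)"
  unfolding avg_op_def
  by (simp add: linear_cmul[OF funpow_linear] linear_sum[OF funpow_linear] funpow_add[THEN fun_cong, unfolded o_def, symmetric] add.commute)

lemma avg_op_commute: "avg_op U N (avg_op U M x) = avg_op U M (avg_op U N x)"
proof -
  have "avg_op U N (avg_op U M x) = (\<Sum>j<N. avg_op U M ((U ^^ j) x)) /\<^sub>R real N"
    unfolding avg_op_def[of U N "avg_op U M x"] funpow_avg_op ..
  also have "\<dots> = avg_op U M (avg_op U N x)"
    unfolding avg_op_def
    by (simp add: linear_cmul[OF funpow_linear] linear_sum[OF funpow_linear] scaleR_sum_right[symmetric]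
        funpow_add[THEN fun_cong, unfolded o_def, symmetric] sum.swap[of _ "{..<N}"] add.commute mult.commute)
  finally show ?thesis .
qed

text \<open>One application of \<open>U\<close> telescopes: only the two end terms survive, each of
  norm at most \<open>norm x\<close>.\<close>

lemma avg_op_shift: "norm (avg_op U N ((U ^^ i) x) - avg_op U N x) \<le> 2 * real i * norm x / real N"
proof (induction i)
  case (Suc i)
  let ?y = "(U ^^ i) x"
  have "(\<Sum>j<N. (U ^^ j) (U ?y)) - (\<Sum>j<N. (U ^^ j) ?y) = (U ^^ N) ?y - ?y"
    by (induction N) (simp_all add: funpow_swap1 algebra_simps)
  then have eq: "avg_op U N (U ?y) - avg_op U N ?y = ((U ^^ N) ?y - ?y) /\<^sub>R real N"
    by (simp add: avg_op_def scaleR_diff_right[symmetric])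
  have "norm ((U ^^ N) ?y - ?y) \<le> norm x + norm x"
    by (intro norm_triangle_le_diff add_mono funpow_contraction order_trans[OF funpow_contraction])
  then have "norm (avg_op U N (U ?y) - avg_op U N ?y) \<le> 2 * norm x / real N"
    unfolding eq by (simp add: divide_inverse mult.commute mult_left_mono)
  with Suc have "norm (avg_op U N (U ?y) - avg_op U N x) \<le> 2 * norm x / real N + 2 * real i * norm x / real N"
    by (smt (verit, best) norm_triangle_ineq diff_add_cancel add_diff_eq)
  also have "\<dots> = 2 * real (Suc i) * norm x / real N" by (simp add: add_divide_distrib algebra_simps)
  finally show ?case by simp
qed simp

text \<open>Total boundedness of the orbit makes averages started at any orbit point uniformly close
  to those started at \<open>g\<close>. Averaging an average therefore changes little, and since
  averages commute, two of them are close to each other through their composition; so the sequence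
  is Cauchy.\<close>

lemma mean_ergodic:
  assumes net: "\<And>e. e > 0 \<Longrightarrow> \<exists>F. finite F \<and> (\<forall>j. \<exists>y\<in>F. norm ((U ^^ j) g - y) \<le> e)"
  obtains h where "(\<lambda>N. avg_op U N g) \<longlonglongrightarrow> h" "U h = h"
proof -
  have close: "\<exists>N0>0. \<forall>N\<ge>N0. \<forall>j. norm (avg_op U N ((U ^^ j) g) - avg_op U N g) \<le> e" if "e > 0" for e
  proof -
    from net[of "e/4"] that obtain F where F: "finite F" "\<And>j. \<exists>y\<in>F. norm ((U ^^ j) g - y) \<le> e/4" by auto
    \<comment> \<open>Every net point near the orbit is represented by one orbit index. The finitely
      many indices are bounded by \<open>L\<close>, so a single \<open>N0\<close> makes the cost of
      all the corresponding shifts at most \<open>e / 2\<close>.\<close>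
    define r where "r y = (SOME i. norm ((U ^^ i) g - y) \<le> e/4)" for y
    define L where "L = Max (r ` F)"
    define N0 where "N0 = nat \<lceil>4 * real L * norm g / e\<rceil> + 1"
    have "norm (avg_op U N ((U ^^ j) g) - avg_op U N g) \<le> e" if N: "N \<ge> N0" for N j
    proof -
      obtain y where y: "y \<in> F" "norm ((U ^^ j) g - y) \<le> e/4" using F(2) by blast
      define i where "i = r y"
      have i: "norm ((U ^^ i) g - y) \<le> e/4" unfolding i_def r_def by (rule someI[of _ j], rule y(2))
      have iL: "i \<le> L" unfolding i_def L_def using F(1) y(1) by simp
      have "norm ((U ^^ j) g - (U ^^ i) g) \<le> e/2"
        using norm_triangle_ineq4[of "(U ^^ j) g - y" "(U ^^ i) g - y"] y(2) i by simp
      then have 1: "norm (avg_op U N ((U ^^ j) g) - avg_op U N ((U ^^ i) g)) \<le> e/2"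
        using avg_op_contraction order_trans unfolding avg_op_diff[symmetric] by blast
      have Npos: "real N > 0" using N by (simp add: N0_def)
      have "4 * real L * norm g / e \<le> real N" using N unfolding N0_def by linarith
      then have "2 * real L * norm g / real N \<le> e/2" using \<open>e > 0\<close> Npos by (simp add: field_simps)
      moreover have "2 * real i * norm g / real N \<le> 2 * real L * norm g / real N"
        using iL by (intro divide_right_mono mult_right_mono) auto
      ultimately have 2: "norm (avg_op U N ((U ^^ i) g) - avg_op U N g) \<le> e/2"
        using avg_op_shift[of N i g] by linarith
      show ?thesis using norm_triangle_le[OF add_mono[OF 1 2]] by simp
    qed
    then show ?thesis by (intro exI[of _ N0]) (auto simp: N0_def)
  qed
  \<comment> \<open>\<open>avg_op U M\<close> of an average is a mean of averages started along the
    orbit, each within \<open>e\<close> of the one started at \<open>g\<close>.\<close>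
  have two: "norm (avg_op U M (avg_op U N g) - avg_op U N g) \<le> e"
    if "\<forall>j. norm (avg_op U N ((U ^^ j) g) - avg_op U N g) \<le> e" "M > 0" for M N e
  proof -
    have "avg_op U M (avg_op U N g) - avg_op U N g = (\<Sum>j<M. avg_op U N ((U ^^ j) g) - avg_op U N g) /\<^sub>R real M"
      unfolding avg_op_def[of U M "avg_op U N g"] funpow_avg_op
      using \<open>M > 0\<close> by (simp add: sum_subtractf scaleR_diff_right sum_constant_scaleR)
    also have "norm \<dots> \<le> (real (card {..<M}) * e) / real M"
      using that(1) sum_norm_bound[of "{..<M}" "\<lambda>j. avg_op U N ((U ^^ j) g) - avg_op U N g" e]
      by (simp add: divide_inverse mult.commute mult_left_mono)
    finally show ?thesis using \<open>M > 0\<close> by simp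
  qed
  have "Cauchy (\<lambda>N. avg_op U N g)"
  proof (rule CauchyI)
    fix e :: real assume "e > 0"
    with close[of "e/3"] obtain N0 where N0: "N0 > 0" "\<And>N. N \<ge> N0 \<Longrightarrow> \<forall>j. norm (avg_op U N ((U ^^ j) g) - avg_op U N g) \<le> e/3"
      by auto
    have "norm (avg_op U m g - avg_op U n g) < e" if "m \<ge> N0" "n \<ge> N0" for m n
    proof -
      have "norm (avg_op U m (avg_op U n g) - avg_op U n g) \<le> e/3" using N0 that by (intro two) auto
      moreover have "norm (avg_op U m (avg_op U n g) - avg_op U m g) \<le> e/3"
        unfolding avg_op_commute[of m n] using N0 that by (intro two) auto
      ultimately show ?thesis
        using norm_triangle_ineq4[of "avg_op U m (avg_op U n g) - avg_op U n g" "avg_op U m (avg_op U n g) - avg_op U m g"] \<open>e > 0\<close>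
        by simp
    qed
    then show "\<exists>M. \<forall>m\<ge>M. \<forall>n\<ge>M. norm (avg_op U m g - avg_op U n g) < e" by blast
  qed
  then obtain h where h: "(\<lambda>N. avg_op U N g) \<longlonglongrightarrow> h" using Cauchy_convergent_iff convergent_def by blast
  have "(\<lambda>N. U (avg_op U N g) - avg_op U N g) \<longlonglongrightarrow> U h - h"
    by (intro tendsto_intros bounded_linear.tendsto[OF lin] h)
  moreover have "(\<lambda>N. U (avg_op U N g) - avg_op U N g) \<longlonglongrightarrow> 0"
  proof (rule Lim_null_comparison)
    show "\<forall>\<^sub>F N in sequentially. norm (U (avg_op U N g) - avg_op U N g) \<le> 2 * norm g / real N"
      using avg_op_shift[of _ 1 g] funpow_avg_op[of 1] by (intro always_eventually) simp
    show "(\<lambda>N. 2 * norm g / real N) \<longlonglongrightarrow> 0" by (rule lim_const_over_n)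
  qed
  ultimately have "U h - h = 0" using LIMSEQ_unique by blast
  then show ?thesis using that[OF h] by simp
qed

end

text \<open>Merging the multiplier with the translation keeps the family closed under composition.
  With \<open>t = 0\<close> it is multiplication by a complex scalar, and it is used in this role to
  express complex homogeneity and quasi-periodicity.\<close>

definition shift :: "complex \<Rightarrow> 'a::real_normed_vector \<Rightarrow> ('a \<Rightarrow>\<^sub>C complex) \<Rightarrow> ('a \<Rightarrow>\<^sub>C complex)" where
  "shift c t g = Bcontfun (\<lambda>x. c * g (x + t))"

lemma apply_shift [simp]: "apply_bcontfun (shift c t g) x = c * g (x + t)"
proof -
  have "(\<lambda>x. c * g (x + t)) \<in> bcontfun"
  proof (rule bcontfun_normI)
    show "continuous_on UNIV (\<lambda>x. c * g (x + t))"
      by (intro continuous_intros continuous_on_compose2[OF continuous_on_apply_bcontfun[of UNIV g]]) auto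
    show "cmod (c * g (x + t)) \<le> cmod c * norm g" for x
      by (simp add: norm_mult mult_left_mono norm_bounded)
  qed
  then show ?thesis by (simp add: shift_def Bcontfun_inverse)
qed

lemma norm_shift_le: "norm (shift c t g) \<le> cmod c * norm g"
  by (rule norm_bound) (simp add: norm_mult mult_left_mono norm_bounded)

lemma shift_shift: "shift c t (shift d s g) = shift (c * d) (t + s) g"
  by (rule bcontfun_eqI) (simp add: add.assoc)

lemma shift_one_zero [simp]: "shift 1 0 g = g"
  by (rule bcontfun_eqI) simp

lemma bounded_linear_shift: "bounded_linear (shift c t)"
  by (rule bounded_linear_intro[where K="cmod c"])
     (auto intro!: bcontfun_eqI simp: algebra_simps order_trans[OF norm_shift_le])

lemmas shift_diff = linear_diff[OF bounded_linear.linear[OF bounded_linear_shift]]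

lemma funpow_shift: "(shift c t ^^ n) g = shift (c ^ n) (of_nat n *\<^sub>R t) g"
  by (induction n) (simp_all add: shift_shift algebra_simps)

lemma shift_avg_op: "shift c t (avg_op (shift z b) N g) = avg_op (shift z b) N (shift c t g)"
  unfolding avg_op_def funpow_shift
  by (simp add: linear_cmul[OF bounded_linear.linear[OF bounded_linear_shift]]
     linear_sum[OF bounded_linear.linear[OF bounded_linear_shift]] shift_shift add.commute mult.commute)

text \<open>Bohr almost periodicity in Bochner's form: the translates are totally bounded in the
  uniform norm, with a net taken from the translates themselves.\<close>

definition almost_periodic :: "('a::real_normed_vector \<Rightarrow>\<^sub>C complex) \<Rightarrow> bool" where
  "almost_periodic g \<longleftrightarrow>
     (\<forall>e>0. \<exists>S. finite S \<and> (\<forall>s. \<exists>s'\<in>S. norm (shift 1 s g - shift 1 s' g) \<le> e))"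

lemma almost_periodic_mono:
  assumes "almost_periodic g" "\<And>s s'. norm (shift 1 s h - shift 1 s' h) \<le> norm (shift 1 s g - shift 1 s' g)"
  shows "almost_periodic h"
  using assms unfolding almost_periodic_def by (meson order_trans)

lemma almost_periodic_shift:
  assumes "almost_periodic g" shows "almost_periodic (shift 1 t g)"
proof (rule almost_periodic_mono[OF assms])
  fix s s'
  have "shift 1 s (shift 1 t g) - shift 1 s' (shift 1 t g) = shift 1 t (shift 1 s g - shift 1 s' g)"
    by (simp add: shift_diff shift_shift add.commute)
  then show "norm (shift 1 s (shift 1 t g) - shift 1 s' (shift 1 t g)) \<le> norm (shift 1 s g - shift 1 s' g)"
    using norm_shift_le[of 1 t "shift 1 s g - shift 1 s' g"] by simp
qed

text \<open>The twisted orbit is totally bounded because a net of the circle times a net of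
  translates approximates it. The limit \<open>h\<close> is an eigenfunction in direction
  \<open>b\<close>: \<open>z * h (x + b) = h x\<close>.\<close>

lemma almost_periodic_ergodic:
  assumes g: "almost_periodic g" and z: "cmod z = 1"
  obtains h where "(\<lambda>N. avg_op (shift z b) N g) \<longlonglongrightarrow> h" "shift z b h = h" "almost_periodic h"
proof -
  have contr: "norm (shift z b x) \<le> norm x" for x using norm_shift_le[of z b x] z by simp
  have "\<exists>F. finite F \<and> (\<forall>j. \<exists>y\<in>F. norm ((shift z b ^^ j) g - y) \<le> e)" if "e > 0" for e
  proof -
    obtain S where S: "finite S" "\<And>s. \<exists>s'\<in>S. norm (shift 1 s g - shift 1 s' g) \<le> e/2"
      using g \<open>e > 0\<close> unfolding almost_periodic_def by (meson half_gt_zero)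
    \<comment> \<open>The summand 1 keeps \<open>d\<close> meaningful for \<open>g = 0\<close>,
      while still \<open>d * norm g \<le> e / 2\<close>.\<close>
    define d where "d = e / (2 * (norm g + 1))"
    have "d > 0" using \<open>e > 0\<close> by (simp add: d_def add_nonneg_pos)
    obtain Z where Z: "finite Z" "sphere (0::complex) 1 \<subseteq> (\<Union>w\<in>Z. ball w d)"
      using compactE_image[of "sphere (0::complex) 1" "sphere 0 1" "\<lambda>w. ball w d"] \<open>d > 0\<close>
      by (metis UN_I centre_in_ball compact_sphere open_ball subsetI)
    show ?thesis
    proof (intro exI[of _ "(\<lambda>(w,s). shift w s g) ` (Z \<times> S)"] conjI allI)
      fix j
      obtain w where w: "w \<in> Z" "cmod (z ^ j - w) \<le> d"
      proof -
        have "z ^ j \<in> sphere 0 1" using z by (simp add: norm_power)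
        then obtain w where "w \<in> Z" "z ^ j \<in> ball w d" using Z by blast
        then show ?thesis using that by (auto simp: dist_norm norm_minus_commute less_imp_le)
      qed
      obtain s where s: "s \<in> S" "norm (shift 1 (real j *\<^sub>R b) g - shift 1 s g) \<le> e/2" using S by blast
      have eq: "shift (z ^ j) (real j *\<^sub>R b) g - shift w s g
         = shift (z ^ j) 0 (shift 1 (real j *\<^sub>R b) g - shift 1 s g) + shift (z ^ j - w) s g"
        by (rule bcontfun_eqI) (simp add: algebra_simps)
      have "norm (shift (z ^ j) 0 (shift 1 (real j *\<^sub>R b) g - shift 1 s g)) \<le> e/2"
        using norm_shift_le[of "z^j" 0 "shift 1 (real j *\<^sub>R b) g - shift 1 s g"] s(2) z by (simp add: norm_power)
      moreover have "norm (shift (z ^ j - w) s g) \<le> e/2"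
      proof -
        have "norm (shift (z ^ j - w) s g) \<le> d * norm g"
          using norm_shift_le[of "z^j - w" s g] w(2) mult_right_mono[OF w(2), of "norm g"] by simp
        also have "\<dots> \<le> d * (norm g + 1)" using \<open>d > 0\<close> by simp
        also have "\<dots> = e/2" using norm_ge_zero[of g] by (simp add: d_def add_nonneg_eq_0_iff field_simps)
        finally show ?thesis .
      qed
      ultimately have "norm ((shift z b ^^ j) g - shift w s g) \<le> e"
        unfolding funpow_shift of_nat_id eq using norm_triangle_ineq[of "shift (z ^ j) 0 (shift 1 (real j *\<^sub>R b) g - shift 1 s g)" "shift (z ^ j - w) s g"] by linarith
      then show "\<exists>y\<in>(\<lambda>(w, s). shift w s g) ` (Z \<times> S). norm ((shift z b ^^ j) g - y) \<le> e"
        using w s by force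
    qed (use Z S in auto)
  qed
  then obtain h where h: "(\<lambda>N. avg_op (shift z b) N g) \<longlonglongrightarrow> h" "shift z b h = h"
    using mean_ergodic[where U = "shift z b" and g = g, OF bounded_linear_shift contr] by metis
  \<comment> \<open>Averaging commutes with translations and is a contraction, so translates of the
    averages, and of their limit, differ no more than those of \<open>g\<close>.\<close>
  have "almost_periodic h"
  proof (rule almost_periodic_mono[OF g])
    fix s s'
    have eq: "shift 1 s (avg_op (shift z b) N g) - shift 1 s' (avg_op (shift z b) N g)
        = avg_op (shift z b) N (shift 1 s g - shift 1 s' g)" for N
      by (simp add: shift_avg_op avg_op_diff[where U = "shift z b", OF bounded_linear_shift contr])
    have "(\<lambda>N. shift 1 s (avg_op (shift z b) N g) - shift 1 s' (avg_op (shift z b) N g)) \<longlonglongrightarrow> shift 1 s h - shift 1 s' h"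
      by (intro tendsto_intros bounded_linear.tendsto[OF bounded_linear_shift] h)
    then show "norm (shift 1 s h - shift 1 s' h) \<le> norm (shift 1 s g - shift 1 s' g)"
      unfolding eq by (rule Lim_norm_ubound[rotated]) (auto intro!: always_eventually avg_op_contraction[where U = "shift z b", OF bounded_linear_shift contr])
  qed
  then show ?thesis using that h by blast
qed

section \<open>Functionals that vanish on characters\<close>

definition echar :: "'a::euclidean_space \<Rightarrow> 'a \<Rightarrow> complex" where
  "echar k t = exp (- 2 * pi * \<i> * complex_of_real (k \<bullet> t))"

lemma echar_eq_cis: "echar k t = cis (- 2 * pi * (k \<bullet> t))"
  by (simp add: echar_def cis_conv_exp mult_ac)

lemma echar_add_left: "echar (k + l) t = echar k t * echar l t"
  by (simp add: echar_eq_cis cis_mult inner_add_left algebra_simps)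

lemma echar_add_right: "echar k (s + t) = echar k s * echar k t"
  by (simp add: echar_eq_cis cis_mult inner_add_right algebra_simps)

lemma norm_echar [simp]: "cmod (echar k t) = 1"
  unfolding echar_eq_cis by simp

lemma continuous_on_echar [continuous_intros]: "continuous_on S (echar k)"
  unfolding echar_def by (intro continuous_intros)

inductive_set trig_poly :: "('a::euclidean_space \<Rightarrow> complex) set" where
  trig_char: "echar k \<in> trig_poly"
| trig_add: "f \<in> trig_poly \<Longrightarrow> g \<in> trig_poly \<Longrightarrow> (\<lambda>x. f x + g x) \<in> trig_poly"
| trig_scale: "f \<in> trig_poly \<Longrightarrow> (\<lambda>x. c * f x) \<in> trig_poly"

lemma trig_poly_const: "(\<lambda>_. c) \<in> trig_poly"
  using trig_scale[OF trig_char[of 0], of c] by (simp add: echar_def)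

lemma trig_poly_mult:
  assumes "f \<in> trig_poly" "g \<in> trig_poly" shows "(\<lambda>x. f x * g x) \<in> trig_poly"
  using assms
proof (induction arbitrary: g rule: trig_poly.induct)
  case (trig_char k)
  show ?case using trig_char
  proof (induction rule: trig_poly.induct)
    case (trig_char l)
    have "(\<lambda>x. echar k x * echar l x) = echar (k + l)" by (simp add: echar_add_left fun_eq_iff)
    then show ?case by (simp only: trig_poly.trig_char)
  next
    case (trig_add f g)
    then show ?case using trig_poly.trig_add[OF trig_add.IH] by (simp add: distrib_left)
  next
    case (trig_scale f c)
    then show ?case using trig_poly.trig_scale[OF trig_scale.IH, of c] by (simp add: mult_ac)
  qed
next
  case (trig_add f f')
  then show ?case using trig_poly.trig_add[OF trig_add.IH(1)[OF trig_add.prems] trig_add.IH(2)[OF trig_add.prems]]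
    by (simp add: distrib_right)
next
  case (trig_scale f c)
  then show ?case using trig_poly.trig_scale[OF trig_scale.IH[OF trig_scale.prems], of c] by (simp add: mult_ac)
qed

lemma trig_poly_sum:
  "(\<And>i. i \<in> I \<Longrightarrow> f i \<in> trig_poly) \<Longrightarrow> (\<lambda>x. \<Sum>i\<in>I. f i x) \<in> trig_poly"
  by (induction I rule: infinite_finite_induct) (auto intro: trig_poly_const trig_add)

lemma trig_poly_cos: "(\<lambda>x. complex_of_real (cos (2 * pi * (x \<bullet> k)))) \<in> trig_poly"
proof -
  have "(\<lambda>x. (1/2) * (echar k x + echar (-k) x)) \<in> trig_poly"
    by (intro trig_scale trig_add trig_char)
  moreover have "(1/2) * (echar k x + echar (-k) x) = complex_of_real (cos (2 * pi * (x \<bullet> k)))" for x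
    unfolding echar_eq_cis by (simp add: complex_eq_iff inner_commute)
  ultimately show ?thesis by (simp only:)
qed

lemma trig_poly_sin: "(\<lambda>x. complex_of_real (sin (2 * pi * (x \<bullet> k)))) \<in> trig_poly"
proof -
  have "(\<lambda>x. (\<i>/2) * (echar k x + (-1) * echar (-k) x)) \<in> trig_poly"
    by (intro trig_scale trig_add trig_char)
  moreover have "(\<i>/2) * (echar k x + (-1) * echar (-k) x) = complex_of_real (sin (2 * pi * (x \<bullet> k)))" for x
    unfolding echar_eq_cis by (simp add: complex_eq_iff inner_commute)
  ultimately show ?thesis by (simp only:)
qed

lemma trig_poly_bcontfun: "f \<in> trig_poly \<Longrightarrow> f \<in> bcontfun"
proof (induction rule: trig_poly.induct)
  case (trig_char k)
  show ?case by (rule bcontfun_normI[of _ 1]) (auto intro!: continuous_intros)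
next
  case (trig_add f g)
  then show ?case by (intro plus_cont)
next
  case (trig_scale f c)
  then obtain g where "f = apply_bcontfun g" by (auto elim: bcontfunE)
  then have "(\<lambda>x. c * f x) = apply_bcontfun (shift c 0 g)" by auto
  then show ?case by (metis apply_bcontfun)
qed

text \<open>The torus of dimension d embedded in real space of dimension 2d, each coordinate going
  to a point of the unit circle. Polynomials on the target pull back to trigonometric
  polynomials.\<close>

definition torus_map :: "'a::euclidean_space \<Rightarrow> 'a \<times> 'a" where
  "torus_map x = (\<Sum>i\<in>Basis. cos (2 * pi * (x \<bullet> i)) *\<^sub>R i, \<Sum>i\<in>Basis. sin (2 * pi * (x \<bullet> i)) *\<^sub>R i)"

lemma continuous_torus_map: "continuous_on S torus_map"
  unfolding torus_map_def by (intro continuous_intros)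

lemma trig_poly_real_polynomial:
  assumes "real_polynomial_function q"
  shows "(\<lambda>x. complex_of_real (q (torus_map x))) \<in> trig_poly"
  using assms
proof (induction rule: real_polynomial_function.induct)
  case (linear f)
  interpret f: bounded_linear f by fact
  have "f (torus_map x) = (\<Sum>i\<in>Basis. cos (2 * pi * (x \<bullet> i)) * f (i, 0) + sin (2 * pi * (x \<bullet> i)) * f (0, i))" for x
  proof -
    have "torus_map x = (\<Sum>i\<in>Basis. cos (2 * pi * (x \<bullet> i)) *\<^sub>R (i, 0) + sin (2 * pi * (x \<bullet> i)) *\<^sub>R (0, i))"
      by (simp add: torus_map_def prod_eq_iff fst_sum snd_sum)
    then show ?thesis by (simp only: f.sum f.add f.scaleR real_scaleR_def)
  qed
  then have "(\<lambda>x. complex_of_real (f (torus_map x))) =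
     (\<lambda>x. \<Sum>i\<in>Basis. complex_of_real (f (i, 0)) * complex_of_real (cos (2 * pi * (x \<bullet> i)))
        + complex_of_real (f (0, i)) * complex_of_real (sin (2 * pi * (x \<bullet> i))))"
    by (simp add: mult.commute)
  also have "\<dots> \<in> trig_poly"
    by (intro trig_poly_sum trig_add trig_scale trig_poly_cos trig_poly_sin)
  finally show ?case .
qed (auto intro: trig_poly_const trig_add trig_poly_mult simp: o_def)

lemma periodic_int:
  fixes p :: "'a::euclidean_space \<Rightarrow> 'b"
  assumes per: "\<And>i x. i \<in> Basis \<Longrightarrow> p (x + i) = p x"
    and int: "\<And>i. i \<in> Basis \<Longrightarrow> x \<bullet> i - y \<bullet> i \<in> \<int>"
  shows "p x = p y"
proof -
  have n: "p (x + of_nat n *\<^sub>R i) = p x" if "i \<in> Basis" for i x n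
  proof (induction n)
    case (Suc n)
    have "x + of_nat (Suc n) *\<^sub>R i = (x + of_nat n *\<^sub>R i) + i" by (simp add: algebra_simps)
    then have "p (x + of_nat (Suc n) *\<^sub>R i) = p ((x + of_nat n *\<^sub>R i) + i)" by (simp only:)
    also have "\<dots> = p x" unfolding per[OF that] by (rule Suc)
    finally show ?case .
  qed simp
  have z: "p (x + of_int m *\<^sub>R i) = p x" if "i \<in> Basis" for i x m
  proof (cases "m \<ge> 0")
    case True
    then show ?thesis using n[OF that, of x "nat m"] by simp
  next
    case False
    then have "p ((x + of_int m *\<^sub>R i) + of_nat (nat (- m)) *\<^sub>R i) = p (x + of_int m *\<^sub>R i)"
      by (intro n that)
    moreover have "(x + of_int m *\<^sub>R i) + of_nat (nat (- m)) *\<^sub>R i = x"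
      using False by (simp add: algebra_simps)
    ultimately show ?thesis by simp
  qed
  define m where "m i = \<lfloor>x \<bullet> i - y \<bullet> i\<rfloor>" for i
  have m: "x \<bullet> i - y \<bullet> i = of_int (m i)" if "i \<in> Basis" for i
    using int[OF that] unfolding m_def by (auto elim!: Ints_cases)
  have "p (y + (\<Sum>i\<in>B. of_int (m i) *\<^sub>R i)) = p y" if "B \<subseteq> Basis" for B
    using finite_subset[OF that finite_Basis] that
  proof (induction B rule: finite_induct)
    case (insert b B)
    have "y + (\<Sum>i\<in>insert b B. of_int (m i) *\<^sub>R i) = (y + (\<Sum>i\<in>B. of_int (m i) *\<^sub>R i)) + of_int (m b) *\<^sub>R b"
      using insert by (simp add: algebra_simps)
    then show ?case using insert z[of b "y + (\<Sum>i\<in>B. of_int (m i) *\<^sub>R i)" "m b"] by (simp only:) simp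
  qed simp
  moreover have "y + (\<Sum>i\<in>Basis. of_int (m i) *\<^sub>R i) = x"
    by (rule euclidean_eqI) (simp add: inner_add_left m[symmetric])
  ultimately show ?thesis by fastforce
qed

text \<open>A periodic function factors through the compact image of \<open>torus_map\<close>, where
  the factor is continuous and Stone-Weierstrass provides a polynomial.\<close>

lemma periodic_approx_trig_poly:
  fixes p :: "'a::euclidean_space \<Rightarrow> complex"
  assumes per: "\<And>i x. i \<in> Basis \<Longrightarrow> p (x + i) = p x"
    and cont: "continuous_on UNIV p" and e: "e > 0"
  obtains q where "q \<in> trig_poly" "\<And>x. cmod (p x - q x) \<le> e"
proof -
  define r :: "'a \<Rightarrow> 'a" where "r x = (\<Sum>i\<in>Basis. frac (x \<bullet> i) *\<^sub>R i)" for x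
  have r_Basis: "r x \<bullet> i = frac (x \<bullet> i)" if "i \<in> Basis" for x i using that by (simp add: r_def)
  have r_cbox: "r x \<in> cbox 0 One" for x
    by (auto simp: mem_box r_Basis frac_ge_0 less_imp_le[OF frac_lt_1])
  have eqI: "p x = p y" if "torus_map x = torus_map y" for x y
  proof (rule periodic_int[where p=p, OF per])
    fix i :: 'a assume i: "i \<in> Basis"
    have "fst (torus_map x) \<bullet> i = fst (torus_map y) \<bullet> i" "snd (torus_map x) \<bullet> i = snd (torus_map y) \<bullet> i"
      using that by simp_all
    then have "cos (2 * pi * (x \<bullet> i)) = cos (2 * pi * (y \<bullet> i)) \<and> sin (2 * pi * (x \<bullet> i)) = sin (2 * pi * (y \<bullet> i))"
      using i by (simp add: torus_map_def)
    then obtain n :: int where "2 * pi * (x \<bullet> i) = 2 * pi * (y \<bullet> i) + 2 * pi * n"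
      using sin_cos_eq_iff[of "2 * pi * (x \<bullet> i)" "2 * pi * (y \<bullet> i)"] by blast
    then have "2 * pi * (x \<bullet> i - y \<bullet> i) = 2 * pi * n" by (simp add: algebra_simps)
    then have "x \<bullet> i - y \<bullet> i = n" by (subst (asm) mult_cancel_left) simp
    then show "x \<bullet> i - y \<bullet> i \<in> \<int>" by simp
  qed
  have torus_r: "torus_map (r x) = torus_map x" for x
  proof -
    have "cos (2 * pi * frac t) = cos (2 * pi * t) \<and> sin (2 * pi * frac t) = sin (2 * pi * t)" for t :: real
    proof -
      have "2 * pi * t = 2 * pi * frac t + 2 * pi * of_int \<lfloor>t\<rfloor>" by (simp add: frac_def algebra_simps)
      then show ?thesis using sin_cos_eq_iff[of "2 * pi * t" "2 * pi * frac t"] by auto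
    qed
    then show ?thesis by (auto simp: torus_map_def r_Basis intro!: sum.cong)
  qed
  define P where "P w = p (SOME x. torus_map x = w)" for w
  have P: "P (torus_map x) = p x" for x
    unfolding P_def by (rule eqI) (rule someI, rule refl)
  define K :: "('a \<times> 'a) set" where "K = torus_map ` cbox 0 One"
  have compK: "compact K" unfolding K_def by (intro compact_continuous_image continuous_torus_map compact_cbox)
  have inK: "torus_map x \<in> K" for x unfolding K_def using torus_r[of x] r_cbox[of x] by (metis imageI)
  \<comment> \<open>Quotient map argument: preimages of closed sets under \<open>P\<close> are
    images of compact subsets of the unit cube, hence closed.\<close>
  have "continuous_on K P"
    unfolding continuous_on_closed_vimage[OF compact_imp_closed[OF compK]]
  proof (intro allI impI)
    fix B :: "complex set" assume "closed B"
    have "P -` B \<inter> K = torus_map ` (cbox 0 One \<inter> p -` B)" by (auto simp: K_def P)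
    moreover have "closed (p -` B)" using cont
      by (intro continuous_closed_vimage[OF \<open>closed B\<close>]) (simp add: continuous_on_eq_continuous_at)
    then have "compact (cbox 0 One \<inter> p -` B)" by (intro compact_Int_closed compact_cbox)
    ultimately show "closed (P -` B \<inter> K)"
      by (auto intro!: compact_imp_closed compact_continuous_image continuous_torus_map)
  qed
  from Stone_Weierstrass_polynomial_function[OF compK this e]
  obtain g where g: "polynomial_function g" "\<And>w. w \<in> K \<Longrightarrow> cmod (P w - g w) < e" by blast
  have "real_polynomial_function (\<lambda>w. Re (g w))" "real_polynomial_function (\<lambda>w. Im (g w))"
    using g(1) unfolding polynomial_function_def o_def by (auto intro: bounded_linear_Re bounded_linear_Im)
  then have "(\<lambda>x. complex_of_real (Re (g (torus_map x))) + \<i> * complex_of_real (Im (g (torus_map x)))) \<in> trig_poly"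
    by (intro trig_add trig_scale trig_poly_real_polynomial)
  then have "(\<lambda>x. g (torus_map x)) \<in> trig_poly" unfolding complex_eq[symmetric] .
  then show ?thesis
    by (rule that) (metis P g(2) inK less_imp_le)
qed

section \<open>Bounded complex-linear functionals on bounded continuous functions\<close>

locale bounded_functional =
  fixes \<Phi> :: "('a::euclidean_space \<Rightarrow>\<^sub>C complex) \<Rightarrow> complex" and C :: real
  assumes add: "\<Phi> (f + g) = \<Phi> f + \<Phi> g"
    and scale: "\<Phi> (shift c 0 f) = c * \<Phi> f"
    and bound: "cmod (\<Phi> f) \<le> C * norm f"
begin

lemma diff: "\<Phi> (f - g) = \<Phi> f - \<Phi> g"
  by (metis add add_diff_cancel_right' diff_add_cancel)

lemma zero: "\<Phi> 0 = 0" using bound[of 0] by simp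

lemma sum: "\<Phi> (\<Sum>i\<in>I. f i) = (\<Sum>i\<in>I. \<Phi> (f i))"
  by (induction I rule: infinite_finite_induct) (auto simp: zero add)

lemma C_nonneg: "C \<ge> 0"
proof -
  let ?f = "const_bcontfun 1 :: 'a \<Rightarrow>\<^sub>C complex"
  have "1 \<le> norm ?f" using norm_bounded[of ?f 0] by simp
  moreover have "0 \<le> C * norm ?f" using bound[of ?f] norm_ge_zero order_trans by blast
  ultimately show ?thesis using mult_neg_pos[of C "norm ?f"] by linarith
qed

lemma eq_zeroI:
  assumes "\<And>e. e > 0 \<Longrightarrow> \<exists>h. \<Phi> h = 0 \<and> norm (g - h) \<le> e"
  shows "\<Phi> g = 0"
proof (rule ccontr)
  assume nz: "\<Phi> g \<noteq> 0"
  \<comment> \<open>The constant \<open>C\<close> may be 0; \<open>C + 1\<close> keeps the quotient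
    defined, and an error of \<open>e\<close> accounts for at most half of the modulus of
    \<open>\<Phi> g\<close>.\<close>
  define e where "e = cmod (\<Phi> g) / (2 * (C + 1))"
  have "e > 0" using nz C_nonneg by (simp add: e_def)
  then obtain h where h: "\<Phi> h = 0" "norm (g - h) \<le> e" using assms by blast
  have "cmod (\<Phi> g) = cmod (\<Phi> (g - h))" using h by (simp add: diff)
  also have "\<dots> \<le> C * e" using bound[of "g - h"] mult_left_mono[OF h(2) C_nonneg] by linarith
  also have "\<dots> \<le> (C + 1) * e" using \<open>e > 0\<close> by simp
  also have "\<dots> = cmod (\<Phi> g) / 2" using C_nonneg by (simp add: e_def field_simps)
  finally show False using nz by simp
qed

lemma trig_poly_zero:
  assumes zero: "\<And>k. \<Phi> (Bcontfun (echar k)) = 0" and "f \<in> trig_poly"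
  shows "\<Phi> (Bcontfun f) = 0"
  using assms(2)
proof (induction rule: trig_poly.induct)
  case (trig_add f g)
  have "Bcontfun (\<lambda>x. f x + g x) = Bcontfun f + Bcontfun g"
    using trig_add by (intro bcontfun_eqI) (simp add: Bcontfun_inverse trig_poly_bcontfun trig_poly.trig_add)
  then show ?case using trig_add by (simp add: add)
next
  case (trig_scale f c)
  have "Bcontfun (\<lambda>x. c * f x) = shift c 0 (Bcontfun f)"
    using trig_scale by (intro bcontfun_eqI) (simp add: Bcontfun_inverse trig_poly_bcontfun trig_poly.trig_scale)
  then show ?case using trig_scale by (simp add: scale)
qed (rule zero)

text \<open>A suitable character absorbs all multipliers, leaving a function periodic under the
  integer lattice. Multiplying its trigonometric approximation by the inverse character gives a
  trigonometric polynomial near \<open>g\<close>.\<close>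

lemma quasi_periodic_zero:
  assumes zero: "\<And>k. \<Phi> (Bcontfun (echar k)) = 0"
    and qp: "\<And>i. i \<in> Basis \<Longrightarrow> \<exists>z. cmod z = 1 \<and> shift 1 i g = shift z 0 g"
  shows "\<Phi> g = 0"
proof (rule eq_zeroI)
  fix e :: real assume "e > 0"
  obtain z where z: "\<And>i. i \<in> Basis \<Longrightarrow> cmod (z i) = 1 \<and> shift 1 i g = shift (z i) 0 g"
    using qp by metis
  \<comment> \<open>Chosen so that \<open>echar k i\<close> is the conjugate of \<open>z i\<close>
    in each basis direction.\<close>
  define k where "k = (\<Sum>i\<in>Basis. (Arg (z i) / (2 * pi)) *\<^sub>R i)"
  define p where "p x = echar k x * g x" for x
  have "p (x + i) = p x" if i: "i \<in> Basis" for i x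
  proof -
    have "g (x + i) = z i * g x" using z[OF i] apply_shift[of 1 i g x] apply_shift[of "z i" 0 g x] by simp
    moreover have "echar k i * z i = 1"
    proof -
      have "z i = cis (Arg (z i))" using rcis_cmod_Arg[of "z i"] z[OF i] by (simp add: rcis_def)
      moreover have "echar k i = cis (- Arg (z i))" unfolding echar_eq_cis using i by (simp add: k_def)
      ultimately show ?thesis by (metis cis_mult add.left_inverse cis_zero)
    qed
    ultimately show ?thesis unfolding p_def echar_add_right
      by (simp only: mult_ac) (simp add: mult.assoc[symmetric])
  qed
  moreover have "continuous_on UNIV p" unfolding p_def by (intro continuous_intros continuous_on_apply_bcontfun)
  ultimately obtain q where q: "q \<in> trig_poly" "\<And>x. cmod (p x - q x) \<le> e"
    using periodic_approx_trig_poly \<open>e > 0\<close> by metis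
  define h where "h = Bcontfun (\<lambda>x. echar (-k) x * q x)"
  have tp: "(\<lambda>x. echar (-k) x * q x) \<in> trig_poly" by (intro trig_poly_mult trig_char q)
  have "norm (g - h) \<le> e"
  proof (rule norm_bound)
    fix x
    have "echar (-k) x * p x = g x" unfolding p_def
      by (simp add: mult.assoc[symmetric] echar_add_left[symmetric]) (simp add: echar_def)
    then have "(g - h) x = echar (-k) x * (p x - q x)"
      unfolding h_def by (simp add: Bcontfun_inverse[OF trig_poly_bcontfun[OF tp]] right_diff_distrib)
    then show "cmod ((g - h) x) \<le> e" using q(2) by (simp only: norm_mult norm_echar mult_1_left)
  qed
  then show "\<exists>h. \<Phi> h = 0 \<and> norm (g - h) \<le> e"
    using trig_poly_zero[OF zero tp] unfolding h_def by blast
qed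

text \<open>Induction on the directions in which \<open>g\<close> is not yet quasi-periodic: ergodic averages produce
  functions that are quasi-periodic in one more direction.\<close>
lemma almost_periodic_zero_aux:
  assumes zero: "\<And>k. \<Phi> (Bcontfun (echar k)) = 0" and "finite B"
    and "almost_periodic g" and "\<And>i. i \<in> Basis - B \<Longrightarrow> \<exists>z. cmod z = 1 \<and> shift 1 i g = shift z 0 g"
  shows "\<Phi> g = 0"
  using assms(2-)
proof (induction B arbitrary: g rule: finite_induct)
  case empty
  then show ?case using quasi_periodic_zero[OF zero] by simp
next
  case (insert b B)
  note ap = insert.prems(1) and qp = insert.prems(2)
  define f where "f j = \<Phi> (shift 1 (of_int j *\<^sub>R b) g)" for j :: int
  have "f 0 = 0"
  proof (rule almost_periodic_sequence_zero)
    show "cmod (f j) \<le> C * norm g" for j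
      unfolding f_def using bound[of "shift 1 (of_int j *\<^sub>R b) g"]
        mult_left_mono[OF norm_shift_le[of 1 "of_int j *\<^sub>R b" g] C_nonneg] by simp
  next
    fix \<delta> :: real assume \<delta>: "\<delta> > 0"
    define e where "e = \<delta> / (2 * (C + 1))"
    have e: "e > 0" "C * (2 * e) \<le> \<delta>" using \<delta> C_nonneg by (simp_all add: e_def field_simps)
    obtain S where S: "finite S" "\<And>s. \<exists>s'\<in>S. norm (shift 1 s g - shift 1 s' g) \<le> e"
      using ap e unfolding almost_periodic_def by meson
    \<comment> \<open>Net points need not be multiples of \<open>b\<close>. Each is replaced by an
      integer translate near it, doubling the error; where none exists the choice is arbitrary and
      harmless.\<close>
    define r where "r y = (SOME i::int. norm (shift 1 (of_int i *\<^sub>R b) g - shift 1 y g) \<le> e)" for y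
    show "\<exists>S. finite S \<and> (\<forall>s. \<exists>s'\<in>S. \<forall>j. cmod (f (s + j) - f (s' + j)) \<le> \<delta>)"
    proof (intro exI[of _ "r ` S"] conjI allI)
      fix s :: int
      obtain y where y: "y \<in> S" "norm (shift 1 (of_int s *\<^sub>R b) g - shift 1 y g) \<le> e" using S by blast
      then have ry: "norm (shift 1 (of_int (r y) *\<^sub>R b) g - shift 1 y g) \<le> e"
        unfolding r_def by (intro someI[where P="\<lambda>i::int. norm (shift 1 (of_int i *\<^sub>R b) g - shift 1 y g) \<le> e"])
      have d: "norm (shift 1 (of_int s *\<^sub>R b) g - shift 1 (of_int (r y) *\<^sub>R b) g) \<le> 2 * e"
        using norm_triangle_ineq4[of "shift 1 (of_int s *\<^sub>R b) g - shift 1 y g" "shift 1 (of_int (r y) *\<^sub>R b) g - shift 1 y g"]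
          y ry by simp
      have "cmod (f (s + j) - f (r y + j)) \<le> \<delta>" for j
      proof -
        have "f (s + j) - f (r y + j) = \<Phi> (shift 1 (of_int j *\<^sub>R b) (shift 1 (of_int s *\<^sub>R b) g - shift 1 (of_int (r y) *\<^sub>R b) g))"
          by (simp add: f_def diff shift_diff shift_shift scaleR_add_left add.commute)
        also have "cmod \<dots> \<le> C * norm (shift 1 (of_int j *\<^sub>R b) (shift 1 (of_int s *\<^sub>R b) g - shift 1 (of_int (r y) *\<^sub>R b) g))"
          by (rule bound)
        also have "\<dots> \<le> C * (2 * e)"
          using d norm_shift_le[of 1 "of_int j *\<^sub>R b" "shift 1 (of_int s *\<^sub>R b) g - shift 1 (of_int (r y) *\<^sub>R b) g"]
          by (intro mult_left_mono C_nonneg) auto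
        finally show ?thesis using e by linarith
      qed
      then show "\<exists>s'\<in>r ` S. \<forall>j. cmod (f (s + j) - f (s' + j)) \<le> \<delta>" using y by blast
    qed (use S in auto)
  next
    fix z :: complex and e :: real assume z: "cmod z = 1" and e: "e > 0"
    let ?U = "shift z b"
    obtain h where h: "(\<lambda>N. avg_op ?U N g) \<longlonglongrightarrow> h" "?U h = h" "almost_periodic h"
      using almost_periodic_ergodic[OF ap z] by blast
    have z0: "z \<noteq> 0" using z by auto
    \<comment> \<open>In direction \<open>b\<close> the multiplier comes from the eigenfunction
      equation; in the other directions that of \<open>g\<close> survives, because averaging
      commutes with translations.\<close>
    have h_qp: "\<exists>w. cmod w = 1 \<and> shift 1 i h = shift w 0 h" if i: "i \<in> Basis - B" for i
    proof (cases "i = b")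
      case True
      have "shift 1 b h = shift (inverse z) 0 (shift z b h)" using z0 by (simp add: shift_shift)
      also have "\<dots> = shift (inverse z) 0 h" by (simp add: h)
      finally show ?thesis using True z by (intro exI[of _ "inverse z"]) (simp add: norm_inverse)
    next
      case False
      then obtain w where w: "cmod w = 1" "shift 1 i g = shift w 0 g" using qp i by blast
      have "shift 1 i (avg_op ?U N g) = shift w 0 (avg_op ?U N g)" for N
        by (simp only: shift_avg_op w(2))
      moreover have "(\<lambda>N. shift 1 i (avg_op ?U N g)) \<longlonglongrightarrow> shift 1 i h" "(\<lambda>N. shift w 0 (avg_op ?U N g)) \<longlonglongrightarrow> shift w 0 h"
        by (intro bounded_linear.tendsto[OF bounded_linear_shift] h)+
      ultimately have "shift 1 i h = shift w 0 h" using LIMSEQ_unique by auto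
      then show ?thesis using w by blast
    qed
    \<comment> \<open>The induction hypothesis is needed for every translate of \<open>h\<close>;
      this makes the estimate of the exponential sums uniform in the starting point
      \<open>x\<close>.\<close>
    have \<Phi>h: "\<Phi> (shift 1 t h) = 0" for t
    proof (rule insert.IH)
      show "almost_periodic (shift 1 t h)" by (rule almost_periodic_shift[OF h(3)])
      fix i :: 'a assume "i \<in> Basis - B"
      then obtain w where w: "cmod w = 1" "shift 1 i h = shift w 0 h" using h_qp by blast
      have "shift 1 i (shift 1 t h) = shift 1 t (shift 1 i h)" by (simp add: shift_shift add.commute)
      also have "\<dots> = shift w 0 (shift 1 t h)" by (simp add: w shift_shift)
      finally show "\<exists>z. cmod z = 1 \<and> shift 1 i (shift 1 t h) = shift z 0 (shift 1 t h)"
        using w by blast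
    qed
    have "e / (C + 1) > 0" using e C_nonneg by simp
    from LIMSEQ_D[OF h(1) this] obtain N0 where N0: "\<And>n. n \<ge> N0 \<Longrightarrow> norm (avg_op ?U n g - h) < e / (C + 1)" by blast
    define N where "N = Suc N0"
    show "\<exists>N>0. \<forall>x. cmod (\<Sum>j<N. f (x + int j) * z ^ j) \<le> e * real N"
    proof (intro exI[of _ N] conjI allI)
      fix x :: int
      have "f (x + int j) * z ^ j = \<Phi> (shift 1 (of_int x *\<^sub>R b) ((?U ^^ j) g))" for j
        unfolding funpow_shift f_def scale[symmetric, of "z ^ j"] mult.commute[of _ "z ^ j"]
        by (simp add: shift_shift scaleR_add_left add.commute)
      then have "(\<Sum>j<N. f (x + int j) * z ^ j) = \<Phi> (shift 1 (of_int x *\<^sub>R b) (\<Sum>j<N. (?U ^^ j) g))"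
        by (simp add: sum[symmetric] linear_sum[OF bounded_linear.linear[OF bounded_linear_shift]])
      also have "(\<Sum>j<N. (?U ^^ j) g) = shift (of_nat N) 0 (avg_op ?U N g)"
      proof -
        have "(\<Sum>j<N. (?U ^^ j) g) = real N *\<^sub>R avg_op ?U N g" by (simp add: avg_op_def N_def)
        moreover have "shift (of_nat N) 0 y = real N *\<^sub>R y" for y :: "'a \<Rightarrow>\<^sub>C complex"
          by (rule bcontfun_eqI) (simp add: scaleR_conv_of_real)
        ultimately show ?thesis by (simp only:)
      qed
      also have "shift 1 (of_int x *\<^sub>R b) (shift (of_nat N) 0 (avg_op ?U N g)) = shift (of_nat N) 0 (shift 1 (of_int x *\<^sub>R b) (avg_op ?U N g))"
        by (simp add: shift_shift)
      also have "\<Phi> \<dots> = of_nat N * \<Phi> (shift 1 (of_int x *\<^sub>R b) (avg_op ?U N g))" by (rule scale)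
      also have "\<Phi> (shift 1 (of_int x *\<^sub>R b) (avg_op ?U N g)) = \<Phi> (shift 1 (of_int x *\<^sub>R b) (avg_op ?U N g - h))"
        by (simp add: shift_diff diff \<Phi>h)
      finally have eq: "(\<Sum>j<N. f (x + int j) * z ^ j) = of_nat N * \<Phi> (shift 1 (of_int x *\<^sub>R b) (avg_op ?U N g - h))" .
      have "cmod (\<Phi> (shift 1 (of_int x *\<^sub>R b) (avg_op ?U N g - h))) \<le> C * norm (shift 1 (of_int x *\<^sub>R b) (avg_op ?U N g - h))"
        by (rule bound)
      also have "\<dots> \<le> C * (e / (C + 1))"
        using norm_shift_le[of 1 "of_int x *\<^sub>R b" "avg_op ?U N g - h"] N0[of N]
        by (intro mult_left_mono C_nonneg) (auto simp: N_def)
      also have "\<dots> \<le> e" using e C_nonneg by (simp add: field_simps)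
      finally show "cmod (\<Sum>j<N. f (x + int j) * z ^ j) \<le> e * real N"
        unfolding eq by (simp add: norm_mult mult.commute[of e] mult_left_mono)
    qed (simp add: N_def)
  qed
  then show ?case by (simp add: f_def)
qed

lemma almost_periodic_zero:
  assumes "\<And>k. \<Phi> (Bcontfun (echar k)) = 0" "almost_periodic g"
  shows "\<Phi> g = 0"
  using almost_periodic_zero_aux[OF assms(1) finite_Basis assms(2)] by simp

end

text \<open>If convergence failed, the functionals would have a cluster point along the indices
  where they stay away from 0 at \<open>g\<close>. It would still be bounded, linear and zero on
  characters, but nonzero at the almost periodic \<open>g\<close>.\<close>

lemma bounded_functional_limit:
  assumes \<Phi>: "\<And>n. bounded_functional (\<Phi> n) C"
    and zero: "\<And>k. (\<lambda>n. \<Phi> n (Bcontfun (echar k))) \<longlonglongrightarrow> 0"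
    and g: "almost_periodic g"
  shows "(\<lambda>n. \<Phi> n g) \<longlonglongrightarrow> 0"
proof (rule ccontr)
  assume "\<not> ?thesis"
  then obtain e where e: "e > 0" "\<exists>\<^sub>F n in sequentially. e \<le> cmod (\<Phi> n g)"
    by (auto simp: tendsto_iff not_eventually not_less)
  \<comment> \<open>The indices \<open>n\<close> at which \<open>\<Phi> n g\<close> stays large, as
    a filter at infinity; it is proper because there are infinitely many.\<close>
  define F where "F = inf sequentially (principal {n. e \<le> cmod (\<Phi> n g)})"
  have "F \<noteq> bot" using e(2) by (simp add: F_def trivial_limit_def eventually_inf_principal frequently_def)
  then have F2: "filtermap \<Phi> F \<noteq> bot" by (simp add: filtermap_bot_iff)
  \<comment> \<open>Tychonoff, with the common bound \<open>C\<close> supplying the discs. A product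
    over so many functions need not be sequentially compact, so the cluster point is found with
    filters instead of subsequences.\<close>
  have "compact (PiE UNIV (\<lambda>g. cball (0::complex) (C * norm g)) :: (('a \<Rightarrow>\<^sub>C complex) \<Rightarrow> complex) set)"
  proof -
    have "compactin (product_topology (\<lambda>_. euclidean) UNIV) (PiE UNIV (\<lambda>g. cball (0::complex) (C * norm (g :: 'a \<Rightarrow>\<^sub>C complex))))"
      by (subst compactin_PiE) auto
    then show ?thesis by (simp add: euclidean_product_topology)
  qed
  moreover have "eventually (\<lambda>\<phi>. \<phi> \<in> PiE UNIV (\<lambda>g. cball 0 (C * norm g))) (filtermap \<Phi> F)"
    unfolding eventually_filtermap
    by (intro always_eventually allI) (auto simp: bounded_functional.bound[OF \<Phi>])
  ultimately obtain \<Psi> where \<Psi>: "inf (nhds \<Psi>) (filtermap \<Phi> F) \<noteq> bot"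
    using F2 unfolding compact_filter by blast
  \<comment> \<open>Along \<open>G\<close> every evaluation converges to that of
    \<open>\<Psi>\<close>, and everything that holds eventually along \<open>F\<close>
    persists.\<close>
  define G where "G = inf (nhds \<Psi>) (filtermap \<Phi> F)"
  have G: "G \<noteq> bot" using \<Psi> by (simp add: G_def)
  have lim: "((\<lambda>\<phi>. \<phi> f) \<longlongrightarrow> \<Psi> f) G" for f
  proof -
    have "continuous_on UNIV (\<lambda>\<phi>::('a \<Rightarrow>\<^sub>C complex) \<Rightarrow> complex. \<phi> f)"
      by (rule continuous_on_product_coordinates)
    then have "(\<lambda>\<phi>. \<phi> f) \<midarrow>\<Psi>\<rightarrow> \<Psi> f" by (simp add: continuous_on_def)
    then have "((\<lambda>\<phi>. \<phi> f) \<longlongrightarrow> \<Psi> f) (nhds \<Psi>)"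
      by (simp only: tendsto_at_iff_tendsto_nhds[of "\<lambda>\<phi>. \<phi> f" \<Psi>])
    then show ?thesis by (rule tendsto_mono[rotated]) (simp add: G_def)
  qed
  have ev: "eventually P G" if "eventually P (filtermap \<Phi> F)" for P
    using filter_leD[of G "filtermap \<Phi> F" P] that by (simp add: G_def)
  have ev_all: "eventually P G" if "\<And>n. P (\<Phi> n)" for P
    by (rule ev) (simp add: eventually_filtermap that)
  interpret \<Psi>: bounded_functional \<Psi> C
  proof
    fix f g c
    have "((\<lambda>\<phi>. \<phi> (f + g) - (\<phi> f + \<phi> g)) \<longlongrightarrow> \<Psi> (f + g) - (\<Psi> f + \<Psi> g)) G" by (intro tendsto_intros lim)
    moreover have "((\<lambda>\<phi>. \<phi> (f + g) - (\<phi> f + \<phi> g)) \<longlongrightarrow> 0) G"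
      by (rule tendsto_eventually, rule ev_all) (simp add: bounded_functional.add[OF \<Phi>])
    ultimately show "\<Psi> (f + g) = \<Psi> f + \<Psi> g" using tendsto_unique[OF G] by fastforce
    have "((\<lambda>\<phi>. \<phi> (shift c 0 f) - c * \<phi> f) \<longlongrightarrow> \<Psi> (shift c 0 f) - c * \<Psi> f) G" by (intro tendsto_intros lim)
    moreover have "((\<lambda>\<phi>. \<phi> (shift c 0 f) - c * \<phi> f) \<longlongrightarrow> 0) G"
      by (rule tendsto_eventually, rule ev_all) (simp add: bounded_functional.scale[OF \<Phi>])
    ultimately show "\<Psi> (shift c 0 f) = c * \<Psi> f" using tendsto_unique[OF G] by fastforce
    show "cmod (\<Psi> f) \<le> C * norm f"
      by (rule Lim_norm_ubound[OF G lim], rule ev_all) (rule bounded_functional.bound[OF \<Phi>])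
  qed
  have "\<Psi> (Bcontfun (echar k)) = 0" for k
  proof (rule tendsto_unique[OF G lim])
    have "((\<lambda>n. \<Phi> n (Bcontfun (echar k))) \<longlongrightarrow> 0) F"
      by (rule tendsto_mono[OF _ zero]) (simp add: F_def)
    then have "((\<lambda>\<phi>. \<phi> (Bcontfun (echar k))) \<longlongrightarrow> 0) (filtermap \<Phi> F)"
      by (simp add: filterlim_filtermap)
    then show "((\<lambda>\<phi>. \<phi> (Bcontfun (echar k))) \<longlongrightarrow> 0) G"
      by (rule tendsto_mono[rotated]) (simp add: G_def)
  qed
  then have "\<Psi> g = 0" by (rule \<Psi>.almost_periodic_zero[OF _ g])
  moreover have "e \<le> cmod (\<Psi> g)"
  proof (rule tendsto_lowerbound[OF tendsto_norm[OF lim] _ G])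
    show "eventually (\<lambda>\<phi>. e \<le> cmod (\<phi> g)) G"
      by (rule ev) (simp add: eventually_filtermap F_def eventually_inf_principal)
  qed
  ultimately show False using e by simp
qed

section \<open>Packing and van Hove boundaries\<close>

text \<open>Take a \<open>2 * r\<close> separated subset of \<open>B\<close> of greatest
  cardinality. Its \<open>r\<close>-balls are disjoint inside \<open>Q\<close>, which bounds the
  cardinality; maximality makes the \<open>2 * r\<close>-balls cover \<open>B\<close>.\<close>

lemma packing_cover:
  fixes B :: "'a::euclidean_space set"
  assumes r: "r > 0" and Q: "Q \<in> lmeasurable" and sub: "(\<Union>x\<in>B. ball x r) \<subseteq> Q"
  obtains F where "finite F" "F \<subseteq> B" "B \<subseteq> (\<Union>x\<in>F. ball x (2 * r))"
    "real (card F) * measure lebesgue (ball (0::'a) r) \<le> measure lebesgue Q"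
proof -
  let ?v = "measure lebesgue (ball (0::'a) r)"
  have v: "?v > 0" using content_ball_pos[OF r, of 0] by simp
  define P where "P F \<longleftrightarrow> finite F \<and> F \<subseteq> B \<and> (\<forall>x\<in>F. \<forall>y\<in>F. x \<noteq> y \<longrightarrow> 2 * r \<le> dist x y)" for F
  have card: "real (card F) * ?v \<le> measure lebesgue Q" if "P F" for F
  proof -
    have disj: "pairwise (\<lambda>x y. disjnt (ball x r) (ball y r)) F"
    proof (rule pairwiseI)
      fix x y assume xy: "x \<in> F" "y \<in> F" "x \<noteq> y"
      then have d: "2 * r \<le> dist x y" using that by (auto simp: P_def)
      have False if "z \<in> ball x r" "z \<in> ball y r" for z
        using dist_triangle[of x y z] that d by (auto simp: dist_commute)
      then show "disjnt (ball x r) (ball y r)" by (auto simp: disjnt_def)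
    qed
    have "measure lebesgue (\<Union>x\<in>F. ball x r) = (\<Sum>x\<in>F. measure lebesgue (ball x r))"
      using that disj by (intro measure_UNION') (auto simp: P_def)
    also have "\<dots> = (\<Sum>x\<in>F. ?v)"
    proof (rule sum.cong[OF refl])
      fix x assume "x \<in> F"
      show "measure lebesgue (ball x r) = ?v"
        using content_ball_conv_unit_ball[of r x] content_ball_conv_unit_ball[of r "0::'a"] r by simp
    qed
    finally have "real (card F) * ?v = measure lebesgue (\<Union>x\<in>F. ball x r)" by simp
    also have "\<dots> \<le> measure lebesgue Q"
      using that sub Q by (intro measure_mono_fmeasurable) (auto simp: P_def)
    finally show ?thesis .
  qed
  have "\<forall>F. P F \<longrightarrow> card F \<le> nat \<lceil>measure lebesgue Q / ?v\<rceil>"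
  proof (intro allI impI)
    fix F assume "P F"
    then have "real (card F) \<le> measure lebesgue Q / ?v" using card v by (simp add: field_simps)
    then show "card F \<le> nat \<lceil>measure lebesgue Q / ?v\<rceil>" by linarith
  qed
  then have "\<exists>F. P F \<and> (\<forall>G. P G \<longrightarrow> card G \<le> card F)"
    by (intro ex_has_greatest_nat[of P "{}" card "Suc (nat \<lceil>measure lebesgue Q / ?v\<rceil>)"])
       (simp_all add: P_def less_Suc_eq_le)
  then obtain F where F: "P F" "\<And>G. P G \<Longrightarrow> card G \<le> card F" by blast
  have "B \<subseteq> (\<Union>x\<in>F. ball x (2 * r))"
  proof
    fix b assume b: "b \<in> B"
    show "b \<in> (\<Union>x\<in>F. ball x (2 * r))"
    proof (rule ccontr)
      assume "b \<notin> (\<Union>x\<in>F. ball x (2 * r))"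
      then have far: "2 * r \<le> dist x b" if "x \<in> F" for x using that by (auto simp: not_less)
      then have "b \<notin> F" using r far[of b] by auto
      have "P (insert b F)" using F(1) b far by (auto simp: P_def dist_commute)
      from F(2)[OF this] show False using F(1) \<open>b \<notin> F\<close> by (simp add: P_def)
    qed
  qed
  then show ?thesis using F(1) card[OF F(1)] by (intro that[of F]) (simp_all add: P_def)
qed

text \<open>Whatever is uniformly bounded on balls of radius \<open>2 * r\<close> grows at most like
  the volume of a thickening; here for point counts, next for measures.\<close>

lemma card_le_volume:
  fixes p :: "'b \<Rightarrow> 'a::euclidean_space"
  assumes r: "r > 0" and Q: "Q \<in> lmeasurable" and sub: "(\<Union>x\<in>B. ball x r) \<subseteq> Q"
    and M: "\<And>x. finite {y\<in>T. p y \<in> ball x (2 * r)}" "\<And>x. real (card {y\<in>T. p y \<in> ball x (2 * r)}) \<le> M"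
  shows "finite {y\<in>T. p y \<in> B}"
    and "real (card {y\<in>T. p y \<in> B}) * measure lebesgue (ball (0::'a) r) \<le> M * measure lebesgue Q"
proof -
  obtain F where F: "finite F" "F \<subseteq> B" "B \<subseteq> (\<Union>x\<in>F. ball x (2 * r))"
    "real (card F) * measure lebesgue (ball (0::'a) r) \<le> measure lebesgue Q"
    using packing_cover[OF r Q sub] .
  have sub': "{y\<in>T. p y \<in> B} \<subseteq> (\<Union>x\<in>F. {y\<in>T. p y \<in> ball x (2 * r)})" using F(3) by blast
  have fin: "finite (\<Union>x\<in>F. {y\<in>T. p y \<in> ball x (2 * r)})" using F(1) M(1) by blast
  show "finite {y\<in>T. p y \<in> B}" by (rule finite_subset[OF sub' fin])
  have M0: "M \<ge> 0" by (rule order_trans[OF of_nat_0_le_iff M(2)[of 0]])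
  have "card {y\<in>T. p y \<in> B} \<le> (\<Sum>x\<in>F. card {y\<in>T. p y \<in> ball x (2 * r)})"
    by (rule le_trans[OF card_mono[OF fin sub'] card_UN_le[OF F(1)]])
  then have "real (card {y\<in>T. p y \<in> B}) \<le> (\<Sum>x\<in>F. real (card {y\<in>T. p y \<in> ball x (2 * r)}))"
    unfolding of_nat_sum[symmetric] of_nat_le_iff .
  also have "\<dots> \<le> real (card F) * M" by (rule sum_bounded_above) (rule M(2))
  finally have "real (card {y\<in>T. p y \<in> B}) * measure lebesgue (ball (0::'a) r)
     \<le> real (card F) * M * measure lebesgue (ball (0::'a) r)" by (rule mult_right_mono) simp
  also have "\<dots> \<le> M * measure lebesgue Q"
    using mult_left_mono[OF F(4) M0] by (simp add: mult_ac)
  finally show "real (card {y\<in>T. p y \<in> B}) * measure lebesgue (ball (0::'a) r) \<le> M * measure lebesgue Q" .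
qed

lemma measure_le_volume:
  fixes \<nu> :: "'a::euclidean_space measure"
  assumes r: "r > 0" and Q: "Q \<in> lmeasurable" and sub: "(\<Union>x\<in>B. ball x r) \<subseteq> Q"
    and \<nu>: "sets \<nu> = sets borel" and c: "c \<ge> 0" "\<And>x. emeasure \<nu> (ball x (2 * r)) \<le> ennreal c"
  shows "measure \<nu> B * measure lebesgue (ball (0::'a) r) \<le> c * measure lebesgue Q"
proof -
  obtain F where F: "finite F" "F \<subseteq> B" "B \<subseteq> (\<Union>x\<in>F. ball x (2 * r))"
    "real (card F) * measure lebesgue (ball (0::'a) r) \<le> measure lebesgue Q"
    using packing_cover[OF r Q sub] .
  have "emeasure \<nu> B \<le> emeasure \<nu> (\<Union>x\<in>F. ball x (2 * r))"
    using F(3) by (rule emeasure_mono) (simp add: \<nu> borel_open open_UN)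
  also have "\<dots> \<le> (\<Sum>x\<in>F. emeasure \<nu> (ball x (2 * r)))"
    using F(1) by (intro emeasure_subadditive_finite) (auto simp: \<nu>)
  also have "\<dots> \<le> (\<Sum>x\<in>F. ennreal c)" by (intro sum_mono c)
  also have "\<dots> = ennreal (real (card F) * c)" using c(1) by (simp add: ennreal_mult ennreal_of_nat_eq_real_of_nat)
  finally have "measure \<nu> B \<le> real (card F) * c"
    using c(1) by (simp add: measure_def enn2real_leI)
  then have "measure \<nu> B * measure lebesgue (ball (0::'a) r) \<le> real (card F) * c * measure lebesgue (ball (0::'a) r)"
    by (rule mult_right_mono) simp
  also have "\<dots> \<le> c * measure lebesgue Q" using mult_left_mono[OF F(4) c(1)] by (simp add: mult_ac)
  finally show ?thesis .
qed

section \<open>Boundary layers of radius \<open>R\<close> and thickenings\<close>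

abbreviation bdry :: "real \<Rightarrow> 'a::euclidean_space set \<Rightarrow> 'a set" where
  "bdry R A \<equiv> K_boundary (cball 0 R) A"

lemma compact_K_boundary:
  assumes "compact K" "compact A" shows "compact (K_boundary K A)"
proof -
  have "compact ({c + k | c k. c \<in> A \<and> k \<in> K} - interior A)"
    by (intro compact_diff compact_sums assms open_interior)
  moreover have "closed {y - k | y k. y \<in> closure (UNIV - A) \<and> k \<in> K}"
  proof -
    have "{y - k | y k. y \<in> closure (UNIV - A) \<and> k \<in> K} = (\<Union>y\<in>closure (UNIV - A). \<Union>k\<in>K. {y - k})"
      by auto
    then show ?thesis using closed_compact_differences[OF closed_closure assms(1), of "UNIV - A"] by simp
  qed
  then have "compact ({y - k | y k. y \<in> closure (UNIV - A) \<and> k \<in> K} \<inter> A)"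
    by (rule closed_Int_compact[OF _ assms(2)])
  ultimately show ?thesis unfolding K_boundary_def by (rule compact_Un)
qed

lemma bdry_outI: "a \<in> A \<Longrightarrow> dist a x \<le> R \<Longrightarrow> x \<notin> interior A \<Longrightarrow> x \<in> bdry R A"
  unfolding K_boundary_def
  by (rule UnI1, rule DiffI, rule CollectI, rule exI[of _ a], rule exI[of _ "x - a"])
     (auto simp: dist_norm norm_minus_commute)

lemma bdry_inI: "z \<in> closure (- A) \<Longrightarrow> dist z x \<le> R \<Longrightarrow> x \<in> A \<Longrightarrow> x \<in> bdry R A"
  unfolding K_boundary_def
  by (rule UnI2, rule IntI, rule CollectI, rule exI[of _ z], rule exI[of _ "z - x"])
     (auto simp: dist_norm Compl_eq_Diff_UNIV norm_minus_commute)

lemma bdry_cases: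
  assumes "x \<in> bdry R A"
  obtains a where "a \<in> A" "dist a x \<le> R" "x \<notin> interior A"
  | z where "z \<in> closure (- A)" "dist z x \<le> R" "x \<in> A"
proof -
  from assms consider "x \<in> {c + k | c k. c \<in> A \<and> k \<in> cball 0 R}" "x \<notin> interior A"
    | "x \<in> {y - k | y k. y \<in> closure (UNIV - A) \<and> k \<in> cball 0 R}" "x \<in> A"
    unfolding K_boundary_def by blast
  then show ?thesis
  proof cases
    case 1
    then obtain c k where "x = c + k" "c \<in> A" "k \<in> cball 0 R" by blast
    then show ?thesis using 1(2) by (intro that(1)[of c]) (simp_all add: dist_norm)
  next
    case 2
    then obtain y k where "x = y - k" "y \<in> closure (UNIV - A)" "k \<in> cball 0 R" by blast
    then show ?thesis using 2(2) by (intro that(2)[of y]) (simp_all add: dist_norm Compl_eq_Diff_UNIV)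
  qed
qed

lemma bdry_mono: "R \<le> R' \<Longrightarrow> bdry R A \<subseteq> bdry R' A"
proof
  fix x assume le: "R \<le> R'" and "x \<in> bdry R A"
  from this(2) show "x \<in> bdry R' A"
    by (cases rule: bdry_cases) (use le in \<open>meson order_trans bdry_outI bdry_inI\<close>)+
qed

lemma thicken_set: "(\<Union>x\<in>A. cball x R) \<subseteq> A \<union> bdry R A"
  using interior_subset[of A] by (auto intro!: bdry_outI)

text \<open>Radii add by the triangle inequality as long as \<open>x\<close> and \<open>y\<close>
  are on the same side of \<open>A\<close>. If the step from \<open>x\<close> to \<open>y\<close>
  crosses the boundary, then \<open>x\<close> itself witnesses that \<open>y\<close> lies in the
  layer of radius \<open>r\<close>.\<close>

lemma thicken_bdry: "(\<Union>x\<in>bdry R A. cball x r) \<subseteq> bdry (R + r) A"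
proof (safe, simp)
  fix x y assume x: "x \<in> bdry R A" and xy: "dist x y \<le> r"
  show "y \<in> bdry (R + r) A"
    using x
  proof (cases rule: bdry_cases)
    case (1 a)
    show ?thesis
    proof (cases "y \<in> interior A")
      case True
      have "x \<in> closure (- A)" using 1 by (simp add: closure_complement)
      then have "y \<in> bdry r A" by (rule bdry_inI) (use xy True interior_subset in auto)
      moreover have "r \<le> R + r" using 1(2) zero_le_dist[of a x] by linarith
      ultimately show ?thesis using bdry_mono by blast
    next
      case False
      then show ?thesis using 1 xy dist_triangle[of a y x] by (intro bdry_outI[of a]) auto
    qed
  next
    case (2 z)
    show ?thesis
    proof (cases "y \<in> A")
      case True
      then show ?thesis using 2 xy dist_triangle[of z y x] by (intro bdry_inI[of z]) auto
    next
      case False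
      then have "y \<in> bdry r A" using 2 xy interior_subset by (intro bdry_outI[of x]) auto
      moreover have "r \<le> R + r" using 2(2) zero_le_dist[of z x] by linarith
      ultimately show ?thesis using bdry_mono by blast
    qed
  qed
qed

lemma thicken_thickened: "(\<Union>x\<in>A \<union> bdry R A. cball x r) \<subseteq> A \<union> bdry (R + r) A" if "R \<ge> 0"
  using thicken_set[of r A] thicken_bdry[of r R A] bdry_mono[of r "R + r" A] that unfolding UN_Un by auto

lemma lmeasurable_bdry: "compact A \<Longrightarrow> bdry R A \<in> lmeasurable"
  by (intro lmeasurable_compact compact_K_boundary) auto

lemma vol_thickened_le:
  assumes "compact A" shows "A \<union> bdry R A \<in> lmeasurable" "vol (A \<union> bdry R A) \<le> vol A + vol (bdry R A)"
  unfolding vol_def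
  using assms lmeasurable_bdry[OF assms, of R] lmeasurable_compact[OF assms]
  by (auto intro!: measure_Un_le fmeasurable.Un fmeasurableD)

text \<open>The first sets may be empty or null; once the origin has entered the sequence, it is
  interior to every later set.\<close>

lemma averaging_sequence_vol_pos:
  assumes "averaging_sequence A" shows "\<forall>\<^sub>F n in sequentially. vol (A n) > 0"
proof -
  have comp: "compact (A n)" and sub: "A n \<subseteq> interior (A (Suc n))" for n
    using assms by (auto simp: averaging_sequence_def)
  obtain n where n: "0 \<in> A n" using assms unfolding averaging_sequence_def by blast
  have mono: "m \<le> k \<Longrightarrow> A m \<subseteq> A k" for m k
    by (rule lift_Suc_mono_le[of A]) (use sub interior_subset in blast)+
  have "vol (A k) > 0" if k: "k > n" for k
  proof -
    obtain j where j: "k = Suc j" "n \<le> j" using k by (cases k) auto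
    then have "0 \<in> interior (A k)" using n mono[of n j] sub[of j] by auto
    then obtain e where e: "e > 0" "ball 0 e \<subseteq> A k" by (meson interior_subset mem_interior)
    have "0 < measure lebesgue (ball (0::'a) e)" using content_ball_pos[OF e(1), of "0::'a"] by simp
    also have "\<dots> \<le> measure lebesgue (A k)"
      using e comp by (intro measure_mono_fmeasurable lmeasurable_compact) auto
    finally show ?thesis by (simp add: vol_def)
  qed
  then show ?thesis using eventually_gt_at_top[of n] by (rule eventually_mono[rotated])
qed

text \<open>Passes from the one compact set of the definition to balls of any radius: a finite cover
  of the ball by translates of the interior of \<open>K\<close> can be moved to every
  centre.\<close>

lemma translation_bounded_ball:
  assumes "translation_bounded \<nu>" "sets \<nu> = sets borel"
  obtains c where "c > 0" "\<And>x. emeasure \<nu> (cball x R) \<le> ennreal c"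
proof -
  obtain K :: "'a set" where K: "compact K" "interior K \<noteq> {}" "(SUP t. emeasure \<nu> ((\<lambda>x. t + x) ` K)) < \<infinity>"
    using assms(1) unfolding translation_bounded_def by blast
  define s where "s = (SUP t. emeasure \<nu> ((\<lambda>x. t + x) ` K))"
  have s: "emeasure \<nu> ((\<lambda>x. t + x) ` K) \<le> s" for t unfolding s_def by (rule SUP_upper) simp
  obtain x0 where x0: "x0 \<in> interior K" using K(2) by blast
  have "compact (cball (0::'a) R)" by simp
  moreover have "\<And>t. t \<in> UNIV \<Longrightarrow> open ((\<lambda>x. t + x) ` interior K)" by (intro open_translation open_interior)
  moreover have "cball 0 R \<subseteq> (\<Union>t\<in>UNIV. (\<lambda>x. t + x) ` interior K)"
  proof
    fix y :: 'a assume "y \<in> cball 0 R"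
    have "y = (y - x0) + x0" by simp
    then show "y \<in> (\<Union>t\<in>UNIV. (\<lambda>x. t + x) ` interior K)" using x0 by blast
  qed
  ultimately obtain T where T: "finite T" "cball 0 R \<subseteq> (\<Union>t\<in>T. (\<lambda>x. t + x) ` interior K)"
    by (rule compactE_image)
  have bound: "emeasure \<nu> (cball x R) \<le> of_nat (card T) * s" for x
  proof -
    have "cball x R \<subseteq> (\<Union>t\<in>T. (\<lambda>y. (x + t) + y) ` K)"
    proof
      fix y assume "y \<in> cball x R"
      then have "y - x \<in> cball 0 R" by (simp add: dist_norm norm_minus_commute)
      then obtain t k where "t \<in> T" "k \<in> interior K" "y - x = t + k" using T by blast
      moreover from this have "y = (x + t) + k" by (simp add: algebra_simps)
      ultimately show "y \<in> (\<Union>t\<in>T. (\<lambda>y. (x + t) + y) ` K)" using interior_subset by blast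
    qed
    moreover have tr: "(\<lambda>y. (x + t) + y) ` K \<in> sets \<nu>" for t
      using assms(2) K(1) by (metis borel_compact compact_translation)
    ultimately have "emeasure \<nu> (cball x R) \<le> emeasure \<nu> (\<Union>t\<in>T. (\<lambda>y. (x + t) + y) ` K)"
      using T(1) by (intro emeasure_mono sets.finite_UN) auto
    also have "\<dots> \<le> (\<Sum>t\<in>T. emeasure \<nu> ((\<lambda>y. (x + t) + y) ` K))"
      using T(1) tr by (intro emeasure_subadditive_finite) auto
    also have "\<dots> \<le> of_nat (card T) * s" by (rule sum_bounded_above) (rule s)
    finally show ?thesis .
  qed
  have fin: "of_nat (card T) * s < \<infinity>" using K(3) by (simp add: s_def ennreal_mult_less_top of_nat_less_top)
  define c where "c = enn2real (of_nat (card T) * s) + 1"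
  have "of_nat (card T) * s = ennreal (enn2real (of_nat (card T) * s))" using fin by (simp add: less_top)
  also have "\<dots> \<le> ennreal c" by (simp add: c_def ennreal_leI)
  finally have "emeasure \<nu> (cball x R) \<le> ennreal c" for x by (rule order_trans[OF bound])
  then show ?thesis using that[of c] by (simp add: c_def add_nonneg_pos)
qed

section \<open>Weighted lattice combs\<close>

lemma open_shift_vimage:
  fixes V :: "'g::topological_ab_group_add set"
  assumes "open V" shows "open {x. x - a \<in> V}" "open {x. a + x \<in> V}" "open {x. a - x \<in> V}" "open {x. - x \<in> V}"
proof -
  have "open ((\<lambda>x. x - a) -` V)" "open ((\<lambda>x. a + x) -` V)" "open ((\<lambda>x. a - x) -` V)" "open (uminus -` V)"
    by (intro open_vimage assms continuous_intros)+
  then show "open {x. x - a \<in> V}" "open {x. a + x \<in> V}" "open {x. a - x \<in> V}" "open {x. - x \<in> V}"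
    by (simp_all add: vimage_def)
qed

text \<open>Plays the part of halving a radius, since the internal group carries no metric.\<close>

lemma nhd_zero:
  fixes U :: "'g::topological_ab_group_add set"
  assumes "open U" "0 \<in> U"
  shows "\<exists>V. open V \<and> 0 \<in> V \<and> (\<forall>v\<in>V. \<forall>w\<in>V. v - w \<in> U \<and> v + w \<in> U)"
proof -
  have "open ((\<lambda>p::'g \<times> 'g. fst p - snd p) -` U)" "open ((\<lambda>p::'g \<times> 'g. fst p + snd p) -` U)"
    by (intro open_vimage assms continuous_intros)+
  then have "open ((\<lambda>p::'g \<times> 'g. fst p - snd p) -` U \<inter> (\<lambda>p::'g \<times> 'g. fst p + snd p) -` U)" by (rule open_Int)
  moreover have "(0, 0) \<in> (\<lambda>p::'g \<times> 'g. fst p - snd p) -` U \<inter> (\<lambda>p::'g \<times> 'g. fst p + snd p) -` U"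
    using assms by simp
  ultimately obtain A B where AB: "open A" "open B" "(0,0) \<in> A \<times> B"
    "A \<times> B \<subseteq> (\<lambda>p::'g \<times> 'g. fst p - snd p) -` U \<inter> (\<lambda>p::'g \<times> 'g. fst p + snd p) -` U"
    by (rule open_prod_elim)
  show ?thesis
  proof (intro exI[of _ "A \<inter> B"] conjI ballI)
    fix v w assume "v \<in> A \<inter> B" "w \<in> A \<inter> B"
    then have "(v, w) \<in> A \<times> B" by simp
    then show "v - w \<in> U" "v + w \<in> U" using AB(4) by auto
  qed (use AB in auto)
qed

lemma compact_plus:
  fixes S T :: "'g::topological_ab_group_add set"
  assumes "compact S" "compact T" shows "compact ((\<lambda>(s,t). s + t) ` (S \<times> T))"
  unfolding case_prod_unfold
  by (intro compact_continuous_image compact_Times assms continuous_intros)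

lemma compact_minus:
  fixes S T :: "'g::topological_ab_group_add set"
  assumes "compact S" "compact T" shows "compact ((\<lambda>(s,t). s - t) ` (S \<times> T))"
  unfolding case_prod_unfold
  by (intro compact_continuous_image compact_Times assms continuous_intros)

lemma locally_compact_group_zero:
  assumes "locally_compact_group TYPE('h::{topological_ab_group_add, t2_space})"
  shows "\<exists>U K. open U \<and> compact K \<and> (0::'h) \<in> U \<and> U \<subseteq> K"
  using assms unfolding locally_compact_group_def by (rule spec)

text \<open>The usual Heine argument over a finite subcover of the support, with neighbourhoods of 0
  in place of radii.\<close>

lemma compact_support_uniformly_continuous:
  fixes f :: "'g::topological_ab_group_add \<Rightarrow> 'c::real_normed_vector"
  assumes f: "continuous_on UNIV f" and C: "compact C" "\<forall>x. x \<notin> C \<longrightarrow> f x = 0" and e: "e > 0"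
  shows "\<exists>V. open V \<and> 0 \<in> V \<and> (\<forall>u. \<forall>v\<in>V. norm (f (u + v) - f u) < e)"
proof -
  \<comment> \<open>Symmetry of \<open>V\<close> handles a base point outside \<open>C\<close> that
    is moved into \<open>C\<close>: the estimate is then read backwards from
    \<open>u + v\<close>.\<close>
  have "\<exists>V. open V \<and> 0 \<in> V \<and> (\<forall>v\<in>V. - v \<in> V) \<and> (\<forall>v\<in>V. \<forall>w\<in>V. norm (f (c + v + w) - f c) < e / 2)" for c
  proof -
    have "open {x. norm (f x - f c) < e / 2}"
      by (intro open_Collect_less continuous_intros f)
    from open_shift_vimage(2)[OF this, of c]
    have o: "open {w. norm (f (c + w) - f c) < e / 2}" by simp
    have z: "0 \<in> {w. norm (f (c + w) - f c) < e / 2}" using e by simp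
    obtain V where V: "open V" "0 \<in> V" "\<And>v w. v \<in> V \<Longrightarrow> w \<in> V \<Longrightarrow> v + w \<in> {w. norm (f (c + w) - f c) < e / 2}"
      using nhd_zero[OF o z] by blast
    have 1: "open (V \<inter> {x. - x \<in> V})" using V(1) open_shift_vimage(4) by (intro open_Int) auto
    have 2: "norm (f (c + v + w) - f c) < e / 2" if "v \<in> V \<inter> {x. - x \<in> V}" "w \<in> V \<inter> {x. - x \<in> V}" for v w
      using V(3)[of v w] that by (simp add: add.assoc)
    show ?thesis by (rule exI[of _ "V \<inter> {x. - x \<in> V}"]) (use 1 2 V(2) in auto)
  qed
  then obtain V where V: "\<And>c. open (V c)" "\<And>c. 0 \<in> V c" "\<And>c v. v \<in> V c \<Longrightarrow> - v \<in> V c"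
    "\<And>c v w. v \<in> V c \<Longrightarrow> w \<in> V c \<Longrightarrow> norm (f (c + v + w) - f c) < e / 2"
    by metis
  have op: "\<And>c. c \<in> C \<Longrightarrow> open {x. x - c \<in> V c}" using V(1) by (intro open_shift_vimage)
  have cov: "C \<subseteq> (\<Union>c\<in>C. {x. x - c \<in> V c})" using V(2) by auto
  obtain F where F: "F \<subseteq> C" "finite F" "C \<subseteq> (\<Union>c\<in>F. {x. x - c \<in> V c})"
    using compactE_image[OF C(1) op cov] .
  have close: "norm (f (u + v) - f u) < e" if "u \<in> C" "\<And>c. c \<in> F \<Longrightarrow> v \<in> V c" for u v
  proof -
    obtain c where c: "c \<in> F" "u - c \<in> V c" using F(3) \<open>u \<in> C\<close> by blast
    have "norm (f (c + (u - c) + v) - f c) < e / 2" using c that(2) V(4) by blast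
    moreover have "norm (f (c + (u - c) + 0) - f c) < e / 2" using c V(2,4) by blast
    ultimately show ?thesis
      using norm_triangle_ineq4[of "f (u + v) - f c" "f u - f c"] by simp
  qed
  show ?thesis
  proof (intro exI[of _ "\<Inter>c\<in>F. V c"] conjI allI ballI)
    show "open (\<Inter>c\<in>F. V c)" using F(2) V(1) by blast
    show "0 \<in> (\<Inter>c\<in>F. V c)" using V(2) by blast
    fix u v assume v: "v \<in> (\<Inter>c\<in>F. V c)"
    show "norm (f (u + v) - f u) < e"
    proof (cases "u \<in> C")
      case True
      then show ?thesis using close v by blast
    next
      case False
      show ?thesis
      proof (cases "u + v \<in> C")
        case True
        have "norm (f (u + v + (- v)) - f (u + v)) < e" using close[OF True, of "- v"] v V(3) by blast
        then show ?thesis by (simp add: norm_minus_commute)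
      next
        case F2: False
        then show ?thesis using False C(2) e by simp
      qed
    qed
  qed
qed

lemma compact_support_bounded:
  fixes f :: "'g::topological_space \<Rightarrow> 'c::real_normed_vector"
  assumes f: "continuous_on UNIV f" and C: "compact C" "\<forall>x. x \<notin> C \<longrightarrow> f x = 0"
  shows "\<exists>B>0. \<forall>x. norm (f x) \<le> B"
proof -
  have "compact (f ` C)" using C(1) continuous_on_subset[OF f] by (intro compact_continuous_image) auto
  then have "bounded (f ` C)" by (rule compact_imp_bounded)
  then obtain B where "B > 0" "\<forall>y\<in>f ` C. norm y \<le> B" unfolding bounded_pos by blast
  then have "norm (f x) \<le> B" for x using C(2) by (cases "x \<in> C") auto
  then show ?thesis using \<open>B > 0\<close> by blast
qed

section \<open>Lattice points over compact windows\<close>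

locale lattice =
  fixes L :: "('a::euclidean_space \<times> 'h::{topological_ab_group_add, t2_space}) set"
  assumes lat: "is_lattice L"
begin

lemma zero_mem: "0 \<in> L" using lat by (simp add: is_lattice_def)

lemma diff_mem: "x \<in> L \<Longrightarrow> y \<in> L \<Longrightarrow> x - y \<in> L" using lat by (simp add: is_lattice_def)

lemma add_mem: "x \<in> L \<Longrightarrow> y \<in> L \<Longrightarrow> x + y \<in> L"
  using diff_mem[of x "0 - y"] diff_mem[of 0 y] zero_mem by simp

text \<open>Discreteness at 0 is transported by differences: a neighbourhood whose difference set
  isolates 0 contains at most one lattice point.\<close>

lemma finite_compact_Int:
  assumes K: "compact K" shows "finite (K \<inter> L)"
proof -
  have "\<forall>y\<in>L. \<exists>U. open U \<and> U \<inter> L = {y}" using lat by (simp add: is_lattice_def)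
  then obtain U where U: "open U" "U \<inter> L = {0}" using zero_mem by blast
  have "(0, 0) \<in> U" using U(2) by (auto simp: zero_prod_def)
  with U(1) obtain A B where AB: "open A" "open B" "(0, 0) \<in> A \<times> B" "A \<times> B \<subseteq> U" by (rule open_prod_elim)
  obtain A' where A': "open A'" "0 \<in> A'" "\<And>v w. v \<in> A' \<Longrightarrow> w \<in> A' \<Longrightarrow> v - w \<in> A"
    using nhd_zero[OF AB(1)] AB(3) by blast
  obtain B' where B': "open B'" "0 \<in> B'" "\<And>v w. v \<in> B' \<Longrightarrow> w \<in> B' \<Longrightarrow> v - w \<in> B"
    using nhd_zero[OF AB(2)] AB(3) by blast
  define N where "N p = {x. x - fst p \<in> A'} \<times> {x. x - snd p \<in> B'}" for p :: "'a \<times> 'h"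
  have op: "\<And>p. p \<in> K \<Longrightarrow> open (N p)" unfolding N_def using A' B' by (intro open_Times open_shift_vimage)
  have cov: "K \<subseteq> (\<Union>p\<in>K. N p)" using A' B' by (auto simp: N_def)
  obtain F where F: "F \<subseteq> K" "finite F" "K \<subseteq> (\<Union>p\<in>F. N p)"
    using compactE_image[OF K op cov] .
  have "finite (N p \<inter> L)" for p
  proof -
    have "y = y'" if "y \<in> N p \<inter> L" "y' \<in> N p \<inter> L" for y y'
    proof -
      have "fst y - fst y' \<in> A" "snd y - snd y' \<in> B"
        using that A'(3)[of "fst y - fst p" "fst y' - fst p"] B'(3)[of "snd y - snd p" "snd y' - snd p"]
        by (simp_all add: N_def mem_Times_iff)
      then have "y - y' \<in> U" using AB(4) by (auto simp: mem_Times_iff)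
      moreover have "y - y' \<in> L" using that by (intro diff_mem) auto
      ultimately have "y - y' \<in> U \<inter> L" by simp
      then show ?thesis using U(2) by simp
    qed
    then have sub: "N p \<inter> L \<subseteq> {y}" if "y \<in> N p \<inter> L" for y using that by blast
    show ?thesis
    proof (cases "N p \<inter> L = {}")
      case False
      then obtain y where "y \<in> N p \<inter> L" by blast
      from finite_subset[OF sub[OF this]] show ?thesis by simp
    qed simp
  qed
  then have "finite (\<Union>p\<in>F. N p \<inter> L)" using F(2) by blast
  then show ?thesis by (rule finite_subset[rotated]) (use F(3) in blast)
qed

text \<open>Subtracting one point of the set injects it into a finite set of lattice differences
  that does not depend on \<open>x\<close>.\<close>

lemma uniform_count:
  assumes C: "compact C"
  shows "\<exists>M>0. \<forall>x. finite {y\<in>L. snd y \<in> C \<and> fst y \<in> cball x R} \<and>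
    real (card {y\<in>L. snd y \<in> C \<and> fst y \<in> cball x R}) \<le> M"
proof -
  define D where "D = (cball (0::'a) (2 * R) \<times> (\<lambda>(s,t). s - t) ` (C \<times> C)) \<inter> L"
  have finD: "finite D" unfolding D_def by (intro finite_compact_Int compact_Times compact_cball compact_minus C)
  have fin: "finite {y\<in>L. snd y \<in> C \<and> fst y \<in> cball x R}" for x
    by (rule finite_subset[OF _ finite_compact_Int[of "cball x R \<times> C"]]) (auto intro!: compact_Times C simp: mem_Times_iff)
  have card: "card {y\<in>L. snd y \<in> C \<and> fst y \<in> cball x R} \<le> card D" for x
  proof (cases "{y\<in>L. snd y \<in> C \<and> fst y \<in> cball x R} = {}")
    case False
    then obtain y0 where y0: "y0 \<in> L" "snd y0 \<in> C" "fst y0 \<in> cball x R" by blast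
    show ?thesis
    proof (rule card_inj_on_le[OF _ _ finD])
      show "inj_on (\<lambda>y. y - y0) {y\<in>L. snd y \<in> C \<and> fst y \<in> cball x R}" by (simp add: inj_on_def)
      show "(\<lambda>y. y - y0) ` {y\<in>L. snd y \<in> C \<and> fst y \<in> cball x R} \<subseteq> D"
      proof (rule image_subsetI)
        fix y assume "y \<in> {y\<in>L. snd y \<in> C \<and> fst y \<in> cball x R}"
        then have y: "y \<in> L" "snd y \<in> C" "fst y \<in> cball x R" by auto
        have "dist (fst y) (fst y0) \<le> 2 * R" using y y0 dist_triangle[of "fst y" "fst y0" x] by (simp add: dist_commute)
        then have "norm (fst y - fst y0) \<le> 2 * R" by (simp add: dist_norm)
        moreover have "snd y - snd y0 \<in> (\<lambda>(s,t). s - t) ` (C \<times> C)"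
          by (rule image_eqI[of _ _ "(snd y, snd y0)"]) (use y y0 in auto)
        moreover have "y - y0 \<in> L" using y y0 diff_mem by blast
        ultimately show "y - y0 \<in> D" by (simp add: D_def mem_Times_iff)
      qed
    qed
  next
    case True
    then show ?thesis by (simp only: card.empty)
  qed
  show ?thesis
  proof (intro exI[of _ "real (card D) + 1"] conjI allI fin)
    show "real (card {y\<in>L. snd y \<in> C \<and> fst y \<in> cball x R}) \<le> real (card D) + 1" for x
      using card[of x] by linarith
  qed simp
qed

lemma count_volume:
  assumes C: "compact C"
  obtains M where "M > 0" "\<And>B. bounded B \<Longrightarrow> finite {y\<in>L. snd y \<in> C \<and> fst y \<in> B}"
    "\<And>B Q. Q \<in> lmeasurable \<Longrightarrow> (\<Union>x\<in>B. ball x 1) \<subseteq> Q \<Longrightarrow> real (card {y\<in>L. snd y \<in> C \<and> fst y \<in> B}) \<le> M * vol Q"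
proof -
  obtain M where M: "M > 0" "\<And>x. finite {y\<in>L. snd y \<in> C \<and> fst y \<in> cball x 2}"
    "\<And>x. real (card {y\<in>L. snd y \<in> C \<and> fst y \<in> cball x 2}) \<le> M"
    using uniform_count[OF C, of 2] by blast
  define T where "T = {y\<in>L. snd y \<in> C}"
  have sub: "{y\<in>T. fst y \<in> ball x (2 * 1)} \<subseteq> {y\<in>L. snd y \<in> C \<and> fst y \<in> cball x 2}" for x
    by (auto simp: T_def)
  have f: "finite {y\<in>T. fst y \<in> ball x (2 * 1)}" for x by (rule finite_subset[OF sub M(2)])
  have c: "real (card {y\<in>T. fst y \<in> ball x (2 * 1)}) \<le> M" for x
    using card_mono[OF M(2) sub, of x] M(3)[of x] by linarith
  let ?v = "measure lebesgue (ball (0::'a) 1)"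
  have v: "?v > 0" using content_ball_pos[of 1 "0::'a"] by simp
  have T: "{y\<in>T. fst y \<in> B} = {y\<in>L. snd y \<in> C \<and> fst y \<in> B}" for B by (auto simp: T_def)
  show ?thesis
  proof (rule that[of "M / ?v"])
    show "M / ?v > 0" using M(1) v by simp
    fix B :: "'a set" assume "bounded B"
    then obtain a where a: "\<And>x. x \<in> B \<Longrightarrow> norm x \<le> a" unfolding bounded_iff by blast
    show "finite {y\<in>L. snd y \<in> C \<and> fst y \<in> B}"
      by (rule finite_subset[OF _ finite_compact_Int[OF compact_Times[OF compact_cball C], of 0 a]])
         (use a in \<open>auto simp: mem_Times_iff\<close>)
  next
    fix B Q :: "'a set" assume "Q \<in> lmeasurable" "(\<Union>x\<in>B. ball x 1) \<subseteq> Q"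
    from card_le_volume(2)[OF zero_less_one this f c]
    have "real (card {y\<in>L. snd y \<in> C \<and> fst y \<in> B}) * ?v \<le> M * vol Q"
      unfolding T vol_def .
    then show "real (card {y\<in>L. snd y \<in> C \<and> fst y \<in> B}) \<le> M / ?v * vol Q"
      using v by (simp add: pos_le_divide_eq)
  qed
qed

end

section \<open>Combs with a continuous weight and their almost periodicity\<close>

locale weighted_comb = lattice L
  for L :: "('a::euclidean_space \<times> 'h::{topological_ab_group_add, t2_space}) set" +
  fixes \<phi> :: "'a \<Rightarrow> complex" and R :: real and \<omega> :: "'h \<Rightarrow> real" and C :: "'h set"
  assumes lc: "locally_compact_group TYPE('h)"
    and \<phi>: "continuous_on UNIV \<phi>" "\<forall>x. x \<notin> cball 0 R \<longrightarrow> \<phi> x = 0"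
    and \<omega>: "continuous_on UNIV \<omega>" "compact C" "\<forall>x. x \<notin> C \<longrightarrow> \<omega> x = 0"
begin

definition summand :: "'a \<Rightarrow> 'h \<Rightarrow> 'a \<times> 'h \<Rightarrow> complex" where
  "summand x \<eta> y = \<phi> (x + fst y) * complex_of_real (\<omega> (\<eta> + snd y))"

text \<open>The second argument makes this a function on the product group that is periodic under
  \<open>L\<close>; the function whose averages matter is its restriction to
  \<open>\<eta> = 0\<close>. Only finitely many summands are nonzero, since both factors have
  compact support.\<close>

definition comb :: "'a \<Rightarrow> 'h \<Rightarrow> complex" where
  "comb x \<eta> = (\<Sum>y\<in>{y\<in>L. summand x \<eta> y \<noteq> 0}. summand x \<eta> y)"

lemma comb_eq:
  assumes "finite T" "T \<subseteq> L" "\<And>y. y \<in> L \<Longrightarrow> summand x \<eta> y \<noteq> 0 \<Longrightarrow> y \<in> T"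
  shows "comb x \<eta> = (\<Sum>y\<in>T. summand x \<eta> y)"
  unfolding comb_def by (rule sum.mono_neutral_left) (use assms in auto)

lemma summand_nonzero:
  assumes "summand x \<eta> y \<noteq> 0" shows "fst y \<in> cball (- x) R" "\<eta> + snd y \<in> C"
proof -
  have "\<phi> (x + fst y) \<noteq> 0" "\<omega> (\<eta> + snd y) \<noteq> 0" using assms by (auto simp: summand_def)
  then have "x + fst y \<in> cball 0 R" "\<eta> + snd y \<in> C" using \<phi>(2) \<omega>(3) by blast+
  moreover have "dist (- x) (fst y) = norm (x + fst y)" by (metis add.commute dist_norm norm_minus_commute diff_minus_eq_add)
  ultimately show "fst y \<in> cball (- x) R" "\<eta> + snd y \<in> C" by simp_all
qed

lemma comb_invariant:
  assumes "l \<in> L" shows "comb (x + fst l) (\<eta> + snd l) = comb x \<eta>"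
  unfolding comb_def
proof (rule sum.reindex_bij_witness[of _ "\<lambda>y. y - l" "\<lambda>y. y + l"])
  have s: "summand (x + fst l) (\<eta> + snd l) y = summand x \<eta> (y + l)" for y
    by (simp add: summand_def algebra_simps)
  have s': "summand (x + fst l) (\<eta> + snd l) (y - l) = summand x \<eta> y" for y
    by (simp add: summand_def algebra_simps)
  fix y
  show "y \<in> {y \<in> L. summand (x + fst l) (\<eta> + snd l) y \<noteq> 0} \<Longrightarrow> y + l \<in> {y \<in> L. summand x \<eta> y \<noteq> 0}"
    using add_mem[OF _ assms] by (simp add: s)
  show "y \<in> {y \<in> L. summand x \<eta> y \<noteq> 0} \<Longrightarrow> y - l \<in> {y \<in> L. summand (x + fst l) (\<eta> + snd l) y \<noteq> 0}"
    using diff_mem[OF _ assms] by (simp add: s')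
  show "summand x \<eta> (y + l) = summand (x + fst l) (\<eta> + snd l) y" by (simp add: s)
qed simp_all

text \<open>Uniformity in \<open>x\<close> comes from \<open>uniform_count\<close>: at every
  \<open>x\<close> at most \<open>M\<close> terms are involved, and each varies little by uniform
  continuity of both factors.\<close>

lemma comb_equicontinuous:
  assumes e: "e > 0"
  shows "\<exists>\<delta>>0. \<exists>V. open V \<and> 0 \<in> V \<and>
    (\<forall>x \<kappa> \<eta>. norm \<kappa> < \<delta> \<longrightarrow> \<eta> \<in> V \<longrightarrow> cmod (comb (x + \<kappa>) \<eta> - comb x 0) \<le> e)"
proof -
  obtain V0 K0 :: "'h set" where V0: "open V0" "compact K0" "0 \<in> V0" "V0 \<subseteq> K0"
    using locally_compact_group_zero[OF lc] by blast
  \<comment> \<open>For \<open>\<eta>\<close> in \<open>V0\<close> the shifted supports all stay in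
    this compact set; the radius \<open>R + 1\<close> below likewise absorbs
    \<open>norm \<kappa> < 1\<close>.\<close>
  define C' where "C' = (\<lambda>(s,t). s - t) ` (C \<times> K0)"
  have C': "compact C'" unfolding C'_def by (intro compact_minus \<omega> V0)
  obtain M where M: "M > 0" "\<And>x. finite {y\<in>L. snd y \<in> C' \<and> fst y \<in> cball x (R + 1)}"
    "\<And>x. real (card {y\<in>L. snd y \<in> C' \<and> fst y \<in> cball x (R + 1)}) \<le> M"
    using uniform_count[OF C', of "R + 1"] by blast
  obtain B1 where B1: "B1 > 0" "\<And>x. cmod (\<phi> x) \<le> B1" using compact_support_bounded[OF \<phi>(1) compact_cball[of 0 R] \<phi>(2)] by blast
  obtain B2 where B2: "B2 > 0" "\<And>x. norm (\<omega> x) \<le> B2" using compact_support_bounded[OF \<omega>] by blast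
  define e' where "e' = e / (M * (B1 + B2))"
  have e': "e' > 0" using e M B1 B2 by (simp add: e'_def)
  obtain V1 where V1: "open V1" "0 \<in> V1" "\<forall>u. \<forall>v\<in>V1. cmod (\<phi> (u + v) - \<phi> u) < e'"
    using compact_support_uniformly_continuous[OF \<phi>(1) compact_cball[of 0 R] \<phi>(2) e'] by (elim exE conjE) (rule that)
  obtain V2 where V2: "open V2" "0 \<in> V2" "\<forall>u. \<forall>v\<in>V2. norm (\<omega> (u + v) - \<omega> u) < e'"
    using compact_support_uniformly_continuous[OF \<omega> e'] by (elim exE conjE) (rule that)
  obtain d where d: "d > 0" "ball 0 d \<subseteq> V1" using openE[OF V1(1,2)] by blast
  show ?thesis
  proof (intro exI[of _ "min d 1"] exI[of _ "V0 \<inter> V2"] conjI allI impI)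
    show "min d 1 > 0" using d by simp
    show "open (V0 \<inter> V2)" using V0(1) V2(1) by (rule open_Int)
    show "0 \<in> V0 \<inter> V2" using V0(3) V2(2) by simp
    fix x \<kappa> :: 'a and \<eta> :: 'h assume \<kappa>: "norm \<kappa> < min d 1" and \<eta>: "\<eta> \<in> V0 \<inter> V2"
    define T where "T = {y\<in>L. snd y \<in> C' \<and> fst y \<in> cball (- x) (R + 1)}"
    have in_C': "snd y \<in> C'" if "\<zeta> + snd y \<in> C" "\<zeta> \<in> V0" for y :: "'a \<times> 'h" and \<zeta>
    proof -
      have "snd y = (\<zeta> + snd y) - \<zeta>" by simp
      then show ?thesis unfolding C'_def
        by (intro image_eqI[of _ _ "(\<zeta> + snd y, \<zeta>)"]) (use that V0(4) in auto)
    qed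
    have 1: "comb (x + \<kappa>) \<eta> = (\<Sum>y\<in>T. summand (x + \<kappa>) \<eta> y)"
    proof (rule comb_eq)
      show "finite T" using M(2) by (simp add: T_def)
      fix y assume y: "y \<in> L" "summand (x + \<kappa>) \<eta> y \<noteq> 0"
      have "dist (- x) (- (x + \<kappa>)) = norm \<kappa>" by (simp add: dist_norm)
      then have "fst y \<in> cball (- x) (R + 1)"
        using summand_nonzero(1)[OF y(2)] dist_triangle[of "- x" "fst y" "- (x + \<kappa>)"] \<kappa> by simp
      then show "y \<in> T" using y in_C'[OF summand_nonzero(2)[OF y(2)]] \<eta> by (simp add: T_def)
    qed (auto simp: T_def)
    have 2: "comb x 0 = (\<Sum>y\<in>T. summand x 0 y)"
    proof (rule comb_eq)
      show "finite T" using M(2) by (simp add: T_def)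
      fix y assume y: "y \<in> L" "summand x 0 y \<noteq> 0"
      then show "y \<in> T" using summand_nonzero(1)[OF y(2)] in_C'[OF summand_nonzero(2)[OF y(2)] V0(3)] by (simp add: T_def)
    qed (auto simp: T_def)
    have "comb (x + \<kappa>) \<eta> - comb x 0 = (\<Sum>y\<in>T. summand (x + \<kappa>) \<eta> y - summand x 0 y)"
      unfolding 1 2 by (simp add: sum_subtractf)
    also have "cmod \<dots> \<le> real (card T) * (e' * (B1 + B2))"
    proof (rule sum_norm_bound)
      fix y assume "y \<in> T"
      have "summand (x + \<kappa>) \<eta> y - summand x 0 y
        = (\<phi> ((x + fst y) + \<kappa>) - \<phi> (x + fst y)) * complex_of_real (\<omega> (\<eta> + snd y))
        + \<phi> (x + fst y) * complex_of_real (\<omega> (snd y + \<eta>) - \<omega> (snd y))"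
        by (simp add: summand_def algebra_simps)
      also have "cmod \<dots> \<le> e' * B2 + B1 * e'"
      proof (rule norm_triangle_le, rule add_mono)
        have "\<kappa> \<in> V1" using \<kappa> d by auto
        then show "cmod ((\<phi> ((x + fst y) + \<kappa>) - \<phi> (x + fst y)) * complex_of_real (\<omega> (\<eta> + snd y))) \<le> e' * B2"
          using V1(3)[rule_format, of \<kappa> "x + fst y"] B2(2)[of "\<eta> + snd y"] e' unfolding norm_mult norm_of_real
          by (intro mult_mono) simp_all
        have "\<bar>\<omega> (snd y + \<eta>) - \<omega> (snd y)\<bar> \<le> e'" using V2(3)[rule_format, of \<eta> "snd y"] \<eta> by simp
        then show "cmod (\<phi> (x + fst y) * complex_of_real (\<omega> (snd y + \<eta>) - \<omega> (snd y))) \<le> B1 * e'"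
          using B1 unfolding norm_mult norm_of_real by (intro mult_mono) (simp_all add: less_imp_le)
      qed
      finally show "cmod (summand (x + \<kappa>) \<eta> y - summand x 0 y) \<le> e' * (B1 + B2)" by (simp add: algebra_simps)
    qed
    also have "\<dots> \<le> M * (e' * (B1 + B2))"
      using M(3)[of "- x"] e' B1 B2 unfolding T_def by (intro mult_right_mono) auto
    also have "\<dots> = e" using M B1 B2 by (simp add: e'_def)
    finally show "cmod (comb (x + \<kappa>) \<eta> - comb x 0) \<le> e" .
  qed
qed

definition comb_fun :: "'a \<Rightarrow>\<^sub>C complex" where
  "comb_fun = Bcontfun (\<lambda>x. comb x 0)"

lemma apply_comb_fun: "apply_bcontfun comb_fun x = comb x 0"
proof -
  obtain M where M: "M > 0" "\<And>x. finite {y\<in>L. snd y \<in> C \<and> fst y \<in> cball x R}"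
    "\<And>x. real (card {y\<in>L. snd y \<in> C \<and> fst y \<in> cball x R}) \<le> M"
    using uniform_count[OF \<omega>(2), of R] by blast
  obtain B1 where B1: "B1 > 0" "\<And>x. cmod (\<phi> x) \<le> B1" using compact_support_bounded[OF \<phi>(1) compact_cball[of 0 R] \<phi>(2)] by blast
  obtain B2 where B2: "B2 > 0" "\<And>x. norm (\<omega> x) \<le> B2" using compact_support_bounded[OF \<omega>] by blast
  have "(\<lambda>x. comb x 0) \<in> bcontfun"
  proof (rule bcontfun_normI)
    show "continuous_on UNIV (\<lambda>x. comb x 0)"
      unfolding continuous_on_iff
    proof (intro ballI allI impI)
      fix x :: 'a and e :: real assume "e > 0"
      then obtain \<delta> and V :: "'h set" where V: "\<delta> > 0" "open V" "0 \<in> V"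
        "\<forall>x \<kappa> \<eta>. norm \<kappa> < \<delta> \<longrightarrow> \<eta> \<in> V \<longrightarrow> cmod (comb (x + \<kappa>) \<eta> - comb x 0) \<le> e / 2"
        using comb_equicontinuous[of "e / 2"] by auto
      have "dist (comb x' 0) (comb x 0) < e" if "dist x' x < \<delta>" for x'
        using V(4)[rule_format, of "x' - x" 0 x] V(3) that \<open>e > 0\<close> by (simp add: dist_norm)
      then show "\<exists>d>0. \<forall>x'\<in>UNIV. dist x' x < d \<longrightarrow> dist (comb x' 0) (comb x 0) < e" using V(1) by blast
    qed
    fix x
    let ?T = "{y\<in>L. snd y \<in> C \<and> fst y \<in> cball (- x) R}"
    have "comb x 0 = (\<Sum>y\<in>?T. summand x 0 y)"
      by (rule comb_eq) (use M(2) summand_nonzero[of x 0] in auto)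
    also have "cmod \<dots> \<le> real (card ?T) * (B1 * B2)"
      by (rule sum_norm_bound) (use B1 B2 in \<open>auto simp: summand_def norm_mult intro!: mult_mono\<close>)
    also have "\<dots> \<le> M * (B1 * B2)" using M(3)[of "- x"] B1 B2 by (intro mult_right_mono) auto
    finally show "cmod (comb x 0) \<le> M * (B1 * B2)" .
  qed
  then show ?thesis by (simp add: comb_fun_def Bcontfun_inverse)
qed

text \<open>Modulo the lattice, \<open>(s, 0)\<close> lies in the compact \<open>K\<close>. If two
  translations fall into the same small neighbourhood there, invariance under \<open>L\<close> turns
  the difference of the translates into a small displacement of both arguments of
  \<open>comb\<close>.\<close>

lemma almost_periodic_comb_fun: "almost_periodic comb_fun"
  unfolding almost_periodic_def
proof (intro allI impI)
  fix e :: real assume "e > 0"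
  then obtain \<delta> and V :: "'h set" where V: "\<delta> > 0" "open V" "0 \<in> V"
    "\<forall>x \<kappa> \<eta>. norm \<kappa> < \<delta> \<longrightarrow> \<eta> \<in> V \<longrightarrow> cmod (comb (x + \<kappa>) \<eta> - comb x 0) \<le> e"
    using comb_equicontinuous[of e] by auto
  have "\<exists>K. compact K \<and> {l + k | l k. l \<in> L \<and> k \<in> K} = UNIV" using lat by (simp add: is_lattice_def)
  then obtain K where K: "compact K" "{l + k | l k. l \<in> L \<and> k \<in> K} = UNIV" by blast
  obtain V' where V': "open V'" "0 \<in> V'" "\<And>v w. v \<in> V' \<Longrightarrow> w \<in> V' \<Longrightarrow> v - w \<in> V"
    using nhd_zero[OF V(2,3)] by blast
  define N where "N p = ball (fst p) (\<delta> / 2) \<times> {x. x - snd p \<in> V'}" for p :: "'a \<times> 'h"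
  have op: "\<And>p. p \<in> K \<Longrightarrow> open (N p)" unfolding N_def using V' by (intro open_Times open_ball open_shift_vimage)
  have cov: "K \<subseteq> (\<Union>p\<in>K. N p)" using V' V by (auto simp: N_def)
  obtain F where F: "F \<subseteq> K" "finite F" "K \<subseteq> (\<Union>p\<in>F. N p)"
    using compactE_image[OF K(1) op cov] .
  \<comment> \<open>The translations \<open>s\<close> that are represented modulo \<open>L\<close>
    near the centre \<open>p\<close>; \<open>r\<close> picks one of them for the net.\<close>
  define P where "P p s \<longleftrightarrow> (\<exists>l\<in>L. (s, 0) - l \<in> N p)" for p and s :: 'a
  define r where "r p = (SOME s. P p s)" for p
  show "\<exists>S. finite S \<and> (\<forall>s. \<exists>s'\<in>S. norm (shift 1 s comb_fun - shift 1 s' comb_fun) \<le> e)"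
  proof (intro exI[of _ "r ` F"] conjI allI)
    fix s :: 'a
    have "(s, 0) \<in> {l + k | l k. l \<in> L \<and> k \<in> K}" unfolding K(2) by simp
    then obtain l k where lk: "l \<in> L" "k \<in> K" "(s, 0) = l + k" by blast
    then obtain p where p: "p \<in> F" "k \<in> N p" using F(3) by blast
    have "(s, 0) - l = k" using lk(3) by (simp add: diff_eq_eq add.commute)
    then have "P p s" unfolding P_def using lk(1) p(2) by (intro bexI[of _ l]) simp_all
    then have "P p (r p)" unfolding r_def by (rule someI)
    then obtain l' where l': "l' \<in> L" "(r p, 0) - l' \<in> N p" by (auto simp: P_def)
    define k' where "k' = (r p, 0) - l'"
    have k': "fst k' + fst l' = r p" "snd k' + snd l' = 0" by (simp_all add: k'_def)
    have k: "fst k + fst l = s" "snd k + snd l = 0" using lk(3) by (simp_all add: prod_eq_iff add.commute)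
    have "norm (fst k - fst k') < \<delta>"
      using p(2) l'(2) dist_triangle[of "fst k" "fst k'" "fst p"]
      by (simp add: N_def mem_Times_iff k'_def[symmetric] dist_norm[symmetric] dist_commute)
    moreover have "snd k - snd k' \<in> V"
      using p(2) l'(2) V'(3)[of "snd k - snd p" "snd k' - snd p"]
      by (simp add: N_def mem_Times_iff k'_def[symmetric])
    ultimately have le: "cmod (comb (x + r p + (fst k - fst k')) (snd k - snd k') - comb (x + r p) 0) \<le> e" for x
      using V(4) by blast
    have "norm (shift 1 s comb_fun - shift 1 (r p) comb_fun) \<le> e"
    proof (rule norm_bound)
      fix x
      \<comment> \<open>The lattice vector \<open>l - l'\<close> exchanges the representatives and
        returns the internal argument to 0.\<close>
      have "comb (x + r p + (fst k - fst k')) (snd k - snd k')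
         = comb (x + r p + (fst k - fst k') + fst (l - l')) (snd k - snd k' + snd (l - l'))"
        by (rule comb_invariant[symmetric]) (intro diff_mem lk l')
      moreover have "x + r p + (fst k - fst k') + fst (l - l') = x + s"
        unfolding k(1)[symmetric] k'(1)[symmetric] by simp
      moreover have "snd k - snd k' + snd (l - l') = 0"
      proof -
        have "snd k - snd k' + snd (l - l') = (snd k + snd l) - (snd k' + snd l')" by (simp add: algebra_simps)
        then show ?thesis unfolding k(2) k'(2) by simp
      qed
      ultimately have "comb (x + r p + (fst k - fst k')) (snd k - snd k') = comb (x + s) 0" by (simp only:)
      then show "cmod (apply_bcontfun (shift 1 s comb_fun - shift 1 (r p) comb_fun) x) \<le> e"
        using le[of x] by (simp add: apply_comb_fun)
    qed
    then show "\<exists>s'\<in>r ` F. norm (shift 1 s comb_fun - shift 1 s' comb_fun) \<le> e" using p by blast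
  qed (use F in auto)
qed

end

section \<open>Density of lattice points in small windows\<close>

text \<open>The neighbourhood at a centre \<open>c\<close> must absorb three displacements, the one
  from \<open>c\<close> to \<open>d\<close> and the two in the conclusion; hence two uses of
  \<open>nhd_zero\<close>.\<close>

lemma compact_enlarge_open:
  fixes D :: "'g::topological_ab_group_add set"
  assumes D: "compact D" and U: "open U" "D \<subseteq> U"
  shows "\<exists>V. open V \<and> 0 \<in> V \<and> (\<forall>d\<in>D. \<forall>v\<in>V. \<forall>w\<in>V. d + v + w \<in> U)"
proof -
  have "\<exists>V. open V \<and> 0 \<in> V \<and> (\<forall>u\<in>V. \<forall>v\<in>V. \<forall>w\<in>V. c + u + v + w \<in> U)" if "c \<in> D" for c
  proof -
    have "open {w. c + w \<in> U}" "0 \<in> {w. c + w \<in> U}" using open_shift_vimage(2)[OF U(1)] U(2) that by auto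
    from nhd_zero[OF this] obtain V1 where V1: "open V1" "0 \<in> V1" "\<forall>v\<in>V1. \<forall>w\<in>V1. v - w \<in> {w. c + w \<in> U} \<and> v + w \<in> {w. c + w \<in> U}"
      by blast
    from nhd_zero[OF V1(1,2)] obtain V2 where V2: "open V2" "0 \<in> V2" "\<forall>v\<in>V2. \<forall>w\<in>V2. v - w \<in> V1 \<and> v + w \<in> V1"
      by blast
    have "c + u + v + w \<in> U" if uvw: "u \<in> V2" "v \<in> V2" "w \<in> V2" for u v w
    proof -
      have "u + 0 \<in> V1" "v + w \<in> V1" using V2 uvw by blast+
      then have "(u + 0) + (v + w) \<in> {w. c + w \<in> U}" using V1(3) by blast
      then show ?thesis by (simp add: add.assoc)
    qed
    then show ?thesis using V2(1,2) by blast
  qed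
  then have "\<forall>c\<in>D. \<exists>V. open V \<and> 0 \<in> V \<and> (\<forall>u\<in>V. \<forall>v\<in>V. \<forall>w\<in>V. c + u + v + w \<in> U)" by blast
  from bchoice[OF this] obtain V where
    V: "\<forall>c\<in>D. open (V c) \<and> 0 \<in> V c \<and> (\<forall>u\<in>V c. \<forall>v\<in>V c. \<forall>w\<in>V c. c + u + v + w \<in> U)" ..
  have op: "\<And>c. c \<in> D \<Longrightarrow> open {x. x - c \<in> V c}" using V by (intro open_shift_vimage) blast
  have cov: "D \<subseteq> (\<Union>c\<in>D. {x. x - c \<in> V c})" using V by auto
  obtain F where F: "F \<subseteq> D" "finite F" "D \<subseteq> (\<Union>c\<in>F. {x. x - c \<in> V c})"
    using compactE_image[OF D op cov] .
  show ?thesis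
  proof (intro exI[of _ "\<Inter>c\<in>F. V c"] conjI ballI)
    show "open (\<Inter>c\<in>F. V c)" using F V by (intro open_INT) auto
    show "0 \<in> (\<Inter>c\<in>F. V c)" using F V by blast
    fix d v w assume d: "d \<in> D" and vw: "v \<in> (\<Inter>c\<in>F. V c)" "w \<in> (\<Inter>c\<in>F. V c)"
    from d obtain c where c: "c \<in> F" "d - c \<in> V c" using F(3) by blast
    then have "c + (d - c) + v + w \<in> U" using V F(1) vw by blast
    then show "d + v + w \<in> U" by simp
  qed
qed

lemma haar_measureD:
  assumes "haar_measure m"
  shows haar_sets: "sets m = sets borel"
    and haar_nonzero: "emeasure m (space m) \<noteq> 0"
    and haar_compact: "\<forall>K. compact K \<longrightarrow> emeasure m K < \<infinity>"
    and haar_invariant: "\<forall>S\<in>sets borel. \<forall>x. emeasure m ((\<lambda>y. x + y) ` S) = emeasure m S"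
    and haar_outer: "\<forall>S\<in>sets borel. emeasure m S = (INF U\<in>{U. open U \<and> S \<subseteq> U}. emeasure m U)"
    and haar_inner: "\<forall>U. open U \<longrightarrow> emeasure m U = (SUP K\<in>{K. compact K \<and> K \<subseteq> U}. emeasure m K)"
  using assms unfolding haar_measure_def by - (elim conjE, assumption)+

lemma haar_translate:
  assumes "haar_measure m" "open S"
  shows "emeasure m {x. a + x \<in> S} = emeasure m S"
proof -
  have "{x. a + x \<in> S} \<in> sets borel" using open_shift_vimage(2)[OF assms(2)] by simp
  then have "emeasure m ((\<lambda>y. a + y) ` {x. a + x \<in> S}) = emeasure m {x. a + x \<in> S}"
    using haar_invariant[OF assms(1)] by blast
  moreover have "(\<lambda>y. a + y) ` {x. a + x \<in> S} = S"
  proof (rule set_eqI)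
    fix x show "x \<in> (\<lambda>y. a + y) ` {x. a + x \<in> S} \<longleftrightarrow> x \<in> S"
      by (auto intro!: image_eqI[of _ _ "x - a"])
  qed
  ultimately show ?thesis by simp
qed

text \<open>If \<open>V\<close> were null, finitely many translates would make every compact set
  null, and inner regularity would annihilate the whole measure.\<close>

lemma haar_open_pos:
  fixes m :: "'h::{topological_ab_group_add, t2_space} measure"
  assumes m: "haar_measure m" and V: "open V" "0 \<in> V"
  shows "emeasure m V > 0"
proof (rule ccontr)
  assume "\<not> ?thesis"
  then have z: "emeasure m V = 0" by simp
  have s: "sets m = sets borel" by (rule haar_sets[OF m])
  have "emeasure m K = 0" if K: "compact K" for K
  proof -
    have op: "\<And>c. c \<in> K \<Longrightarrow> open {x. - c + x \<in> V}" using V by (intro open_shift_vimage)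
    have cov: "K \<subseteq> (\<Union>c\<in>K. {x. - c + x \<in> V})" using V by auto
    obtain F where F: "F \<subseteq> K" "finite F" "K \<subseteq> (\<Union>c\<in>F. {x. - c + x \<in> V})"
      using compactE_image[OF K op cov] .
    have o: "open {x. - c + x \<in> V}" for c using V by (intro open_shift_vimage)
    have "emeasure m K \<le> emeasure m (\<Union>c\<in>F. {x. - c + x \<in> V})"
      by (rule emeasure_mono[OF F(3)]) (use o s in \<open>auto intro!: borel_open\<close>)
    also have "\<dots> \<le> (\<Sum>c\<in>F. emeasure m {x. - c + x \<in> V})"
      using F(2) o s by (intro emeasure_subadditive_finite) (auto intro!: borel_open)
    also have "\<dots> = 0" unfolding haar_translate[OF m V(1)] z by simp
    finally show ?thesis by simp
  qed
  moreover have "emeasure m UNIV = (SUP K\<in>{K. compact K \<and> K \<subseteq> UNIV}. emeasure m K)"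
    using haar_inner[OF m] by blast
  moreover have "(SUP K\<in>{K. compact K \<and> K \<subseteq> UNIV}. emeasure m K) \<le> 0"
    by (rule SUP_least) (use calculation(1) in simp)
  ultimately have "emeasure m UNIV = 0" by simp
  moreover have "space m = UNIV" using sets_eq_imp_space_eq[OF s] by simp
  ultimately show False using haar_nonzero[OF m] by simp
qed

text \<open>Upper density estimate without equidistribution: the point counts for windows \<open>E' - h\<close>
  are averaged over \<open>h\<close> in a fixed open set, and finitely many lattice translations bring
  \<open>E\<close> into each \<open>E' - h\<close>.\<close>
lemma window_density:
  fixes L :: "('a::euclidean_space \<times> 'h::{topological_ab_group_add, t2_space}) set"
  assumes L: "cut_and_project_scheme L" and m: "haar_measure m"
    and D: "compact D" "emeasure m D = 0" and e: "e > 0"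
  shows "\<exists>E \<rho>. open E \<and> D \<subseteq> E \<and> (\<forall>A. compact A \<longrightarrow>
    finite {y\<in>L. snd y \<in> E \<and> fst y \<in> A} \<and>
    real (card {y\<in>L. snd y \<in> E \<and> fst y \<in> A}) \<le> e * (vol A + vol (bdry \<rho> A)))"
proof -
  interpret lattice L using L by unfold_locales (simp add: cut_and_project_scheme_def)
  have s: "sets m = sets borel" by (rule haar_sets[OF m])
  have lc: "locally_compact_group TYPE('h)" using L by (simp add: cut_and_project_scheme_def)
  obtain V0 K0 :: "'h set" where V0: "open V0" "compact K0" "0 \<in> V0" "V0 \<subseteq> K0"
    using locally_compact_group_zero[OF lc] by blast
  \<comment> \<open>\<open>C2\<close> contains every \<open>E' - h\<close> with \<open>h\<close> in
    \<open>V0\<close>, where \<open>E'\<close> is the set built below from \<open>D\<close> with two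
    displacements from \<open>V\<close>; it supplies one counting constant \<open>M\<close> for all
    these windows.\<close>
  define C2 where "C2 = (\<lambda>(s,t). s - t) ` ((\<lambda>(s,t). s + t) ` ((\<lambda>(s,t). s + t) ` (D \<times> K0) \<times> K0) \<times> K0)"
  have C2: "compact C2" unfolding C2_def by (intro compact_minus compact_plus D V0)
  obtain M where M: "M > 0" "\<And>B. bounded B \<Longrightarrow> finite {y\<in>L. snd y \<in> C2 \<and> fst y \<in> B}"
    "\<And>B Q. Q \<in> lmeasurable \<Longrightarrow> (\<Union>x\<in>B. ball x 1) \<subseteq> Q \<Longrightarrow> real (card {y\<in>L. snd y \<in> C2 \<and> fst y \<in> B}) \<le> M * vol Q"
    using count_volume[OF C2] by blast
  have "emeasure m K0 < \<infinity>" using haar_compact[OF m] V0(2) by blast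
  then have fin0: "emeasure m V0 < \<infinity>"
    using emeasure_mono[OF V0(4), of m] s V0(2) by (metis borel_compact le_less_trans)
  define v where "v = measure m V0"
  have v: "emeasure m V0 = ennreal v" unfolding v_def using fin0 by (simp add: emeasure_eq_ennreal_measure)
  have v0: "v > 0" using haar_open_pos[OF m V0(1,3)] v by simp
  \<comment> \<open>Makes the final comparison \<open>n * v \<le> card T * \<eta>\<close> produce
    exactly the factor \<open>e\<close>.\<close>
  define \<eta> where "\<eta> = e * v / M"
  have \<eta>: "\<eta> > 0" using e v0 M by (simp add: \<eta>_def)
  obtain U where U: "open U" "D \<subseteq> U" "emeasure m U < ennreal \<eta>"
  proof -
    have "D \<in> sets borel" using D(1) by (rule borel_compact)
    then have "(INF U\<in>{U. open U \<and> D \<subseteq> U}. emeasure m U) = emeasure m D"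
      by (rule haar_outer[OF m, rule_format, symmetric])
    also have "\<dots> < ennreal \<eta>" using D(2) \<eta> by simp
    finally show ?thesis using that unfolding INF_less_iff by auto
  qed
  obtain V1 where V1: "open V1" "0 \<in> V1" "\<forall>d\<in>D. \<forall>v\<in>V1. \<forall>w\<in>V1. d + v + w \<in> U"
    using compact_enlarge_open[OF D(1) U(1,2)] by blast
  define V where "V = V0 \<inter> V1"
  have V: "open V" "0 \<in> V" "V \<subseteq> K0" "\<And>d v w. d \<in> D \<Longrightarrow> v \<in> V \<Longrightarrow> w \<in> V \<Longrightarrow> d + v + w \<in> U"
    unfolding V_def using V0 V1 by auto
  \<comment> \<open>\<open>E\<close> is \<open>D + V\<close> and \<open>E'\<close> is
    \<open>D + V + V\<close>, still inside \<open>U\<close>; the second layer absorbs the defect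
    \<open>h - snd l\<close>.\<close>
  define E where "E = (\<Union>d\<in>D. {x. x - d \<in> V})"
  define E' where "E' = (\<Union>d\<in>E. {x. x - d \<in> V})"
  have E: "open E" unfolding E_def by (intro open_UN ballI open_shift_vimage V)
  have E': "open E'" unfolding E'_def by (intro open_UN ballI open_shift_vimage V)
  have E_cases: "\<exists>d\<in>D. \<exists>v\<in>V. x = d + v" if x: "x \<in> E" for x
  proof -
    obtain d where "d \<in> D" "x - d \<in> V" using x by (auto simp: E_def)
    then show ?thesis by (intro bexI[of _ d] bexI[of _ "x - d"]) auto
  qed
  have E'_cases: "\<exists>d\<in>D. \<exists>v\<in>V. \<exists>w\<in>V. x = d + v + w" if x: "x \<in> E'" for x
  proof -
    obtain y where y: "y \<in> E" "x - y \<in> V" using x by (auto simp: E'_def)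
    obtain d v where "d \<in> D" "v \<in> V" "y = d + v" using E_cases[OF y(1)] by blast
    then show ?thesis using y by (intro bexI[of _ d] bexI[of _ v] bexI[of _ "x - y"]) auto
  qed
  have E'I: "x + w \<in> E'" if "x \<in> E" "w \<in> V" for x w
    unfolding E'_def using that by (intro UN_I[of x]) auto
  have E'U: "E' \<subseteq> U" using E'_cases V(4) by blast
  have mE': "emeasure m E' \<le> ennreal \<eta>"
    using emeasure_mono[OF E'U, of m] s U by (metis borel_open less_imp_le order_trans)
  have C2I: "x - h \<in> C2" if xh: "x \<in> E'" "h \<in> V0" for x h
  proof -
    obtain d v w where dvw: "d \<in> D" "v \<in> V" "w \<in> V" "x = d + v + w" using E'_cases[OF xh(1)] by blast
    have "d + v \<in> (\<lambda>(s,t). s + t) ` (D \<times> K0)"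
      by (rule image_eqI[of _ _ "(d, v)"]) (use dvw V(3) in auto)
    then have "d + v + w \<in> (\<lambda>(s,t). s + t) ` ((\<lambda>(s,t). s + t) ` (D \<times> K0) \<times> K0)"
      using dvw V(3) by (intro image_eqI[of _ _ "(d + v, w)"]) auto
    then show ?thesis unfolding C2_def dvw(4) using xh(2) V0(4)
      by (intro image_eqI[of _ _ "(d + v + w, h)"]) auto
  qed
  \<comment> \<open>Density of the internal projection. By compactness of \<open>K0\<close>,
    finitely many \<open>l\<close> then serve all \<open>h\<close> in \<open>V0\<close>.\<close>
  have "\<exists>l\<in>L. h - snd l \<in> V" for h
  proof -
    have "open {x. h - x \<in> V}" "h \<in> {x. h - x \<in> V}" using V by (auto intro: open_shift_vimage)
    moreover have "h \<in> closure (snd ` L)" using L by (simp add: cut_and_project_scheme_def)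
    ultimately have "{x. h - x \<in> V} \<inter> snd ` L \<noteq> {}" using open_Int_closure_eq_empty by blast
    then show ?thesis by blast
  qed
  then have cov: "K0 \<subseteq> (\<Union>l\<in>L. {h. h - snd l \<in> V})" by blast
  have op: "\<And>l. l \<in> L \<Longrightarrow> open {h. h - snd l \<in> V}" by (intro open_shift_vimage V)
  obtain F where F: "F \<subseteq> L" "finite F" "K0 \<subseteq> (\<Union>l\<in>F. {h. h - snd l \<in> V})"
    using compactE_image[OF V0(2) op cov] .
  define r where "r = (\<Sum>l\<in>F. norm (fst l))"
  have r: "norm (fst l) \<le> r" if "l \<in> F" for l
    unfolding r_def by (rule member_le_sum[OF that _ F(2)]) simp
  have r0: "r \<ge> 0" unfolding r_def by (rule sum_nonneg) simp
  show ?thesis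
  proof (intro exI[of _ E] exI[of _ "r + 1"] conjI allI impI)
    \<comment> \<open>The radius \<open>r + 1\<close> just supplied is made of \<open>r\<close> for
      the lattice translations in \<open>F\<close> and 1 for the unit balls used in
      counting.\<close>
    show "open E" by (rule E)
    show "D \<subseteq> E" unfolding E_def using V(2) by auto
    fix A :: "'a set" assume A: "compact A"
    define B where "B = A \<union> bdry r A"
    have B: "bounded B" unfolding B_def
      using A compact_K_boundary[OF compact_cball A] by (intro bounded_Un[THEN iffD2] conjI compact_imp_bounded) auto
    define T where "T = {y\<in>L. snd y \<in> C2 \<and> fst y \<in> B}"
    have finT: "finite T" unfolding T_def by (rule M(2)[OF B])
    have "(\<Union>x\<in>B. ball x 1) \<subseteq> A \<union> bdry (r + 1) A"
      using thicken_thickened[OF r0, where A = A and r = 1] unfolding B_def by (rule order_trans[rotated]) (intro UN_mono ball_subset_cball order_refl)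
    then have "real (card T) \<le> M * vol (A \<union> bdry (r + 1) A)"
      unfolding T_def by (intro M(3) vol_thickened_le A)
    also have "\<dots> \<le> M * (vol A + vol (bdry (r + 1) A))"
      using M(1) by (intro mult_left_mono vol_thickened_le A) auto
    finally have cT: "real (card T) \<le> M * (vol A + vol (bdry (r + 1) A))" .
    define n where "n = card {y\<in>L. snd y \<in> E \<and> fst y \<in> A}"
    have count: "finite {y\<in>L. snd y \<in> E \<and> fst y \<in> A} \<and> n \<le> card {y\<in>T. snd y + h \<in> E'}" if h: "h \<in> V0" for h
    proof -
      obtain l where l: "l \<in> F" "h - snd l \<in> V" using h V0(4) F(3) by blast
      have lL: "l \<in> L" using l F(1) by blast
      have inj: "inj_on (\<lambda>y. y - l) {y\<in>L. snd y \<in> E \<and> fst y \<in> A}" by (simp add: inj_on_def)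
      have fin: "finite {y\<in>T. snd y + h \<in> E'}" using finT by simp
      have sub: "(\<lambda>y. y - l) ` {y\<in>L. snd y \<in> E \<and> fst y \<in> A} \<subseteq> {y\<in>T. snd y + h \<in> E'}"
      proof (rule image_subsetI)
        fix y assume "y \<in> {y\<in>L. snd y \<in> E \<and> fst y \<in> A}"
        then have y: "y \<in> L" "snd y \<in> E" "fst y \<in> A" by auto
        have "snd y + (h - snd l) \<in> E'" using E'I y l by blast
        then have 1: "snd (y - l) + h \<in> E'" by (simp add: algebra_simps)
        have 2: "snd (y - l) \<in> C2" using C2I[OF 1 h] by simp
        have "fst y - fst l \<in> cball (fst y) r" using r[OF l(1)] by (simp add: dist_norm)
        then have "fst y - fst l \<in> B" using thicken_set[of r A] y(3) unfolding B_def by blast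
        then show "y - l \<in> {y\<in>T. snd y + h \<in> E'}" using 1 2 diff_mem[OF y(1) lL] by (simp add: T_def)
      qed
      show ?thesis unfolding n_def using inj_on_finite[OF inj sub fin] card_inj_on_le[OF inj sub fin] by blast
    qed
    have meas: "{h. snd y + h \<in> E'} \<in> sets m" for y :: "'a \<times> 'h"
      using open_shift_vimage(2)[OF E'] s by auto
    have "ennreal (real n) * emeasure m V0 = (\<integral>\<^sup>+h. ennreal (real n) * indicator V0 h \<partial>m)"
      using V0(1) s by (intro nn_integral_cmult_indicator[symmetric]) auto
    also have "\<dots> \<le> (\<integral>\<^sup>+h. (\<Sum>y\<in>T. indicator {h. snd y + h \<in> E'} h) \<partial>m)"
    proof (rule nn_integral_mono)
      fix h
      have "(\<Sum>y\<in>T. indicator {h. snd y + h \<in> E'} h) = (ennreal (real (card {y\<in>T. snd y + h \<in> E'})))"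
        using finT by (simp add: indicator_def sum.If_cases Int_def ennreal_of_nat_eq_real_of_nat)
      then show "ennreal (real n) * indicator V0 h \<le> (\<Sum>y\<in>T. indicator {h. snd y + h \<in> E'} h)"
        using count[of h] by (auto simp: indicator_def intro!: ennreal_leI)
    qed
    also have "\<dots> = (\<Sum>y\<in>T. \<integral>\<^sup>+h. indicator {h. snd y + h \<in> E'} h \<partial>m)"
      using meas by (intro nn_integral_sum borel_measurable_indicator) auto
    also have "\<dots> = (\<Sum>y\<in>T. emeasure m {h. snd y + h \<in> E'})"
      using meas by (intro sum.cong refl nn_integral_indicator) auto
    \<comment> \<open>For each lattice point the admissible \<open>h\<close> form a translate of
      \<open>E'\<close>, so invariance gives the same bound for all.\<close>
    also have "\<dots> \<le> (\<Sum>y\<in>T. ennreal \<eta>)"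
      by (intro sum_mono) (simp add: haar_translate[OF m E'] mE')
    also have "\<dots> = ennreal (real (card T) * \<eta>)"
      using \<eta> by (simp add: ennreal_mult ennreal_of_nat_eq_real_of_nat)
    finally have "ennreal (real n * v) \<le> ennreal (real (card T) * \<eta>)"
      using v v0 by (simp add: ennreal_mult)
    then have "real n * v \<le> real (card T) * \<eta>" using \<eta> by (subst (asm) ennreal_le_iff) auto
    also have "\<dots> \<le> M * (vol A + vol (bdry (r + 1) A)) * \<eta>" using cT \<eta> by (intro mult_right_mono) auto
    also have "\<dots> = v * (e * (vol A + vol (bdry (r + 1) A)))" using M(1) by (simp add: \<eta>_def)
    finally have "v * real n \<le> v * (e * (vol A + vol (bdry (r + 1) A)))" by (simp add: mult.commute)
    then show "real (card {y\<in>L. snd y \<in> E \<and> fst y \<in> A}) \<le> e * (vol A + vol (bdry (r + 1) A))"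
      using v0 unfolding n_def by (rule mult_left_le_imp_le)
    show "finite {y\<in>L. snd y \<in> E \<and> fst y \<in> A}" using count[OF V0(3)] by blast
  qed
qed

lemma Urysohn_locally_compact_group:
  fixes S T :: "'h::{topological_ab_group_add, t2_space} set"
  assumes lc: "locally_compact_group TYPE('h)" and S: "compact S" and T: "closed T" "S \<inter> T = {}"
  shows "\<exists>f::'h \<Rightarrow> real. continuous_on UNIV f \<and> (\<forall>x. f x \<in> {0..1}) \<and> (\<forall>x\<in>S. f x = 1) \<and> (\<forall>x\<in>T. f x = 0)"
proof -
  have "locally_compact_space (euclidean :: 'h topology)"
    using lc unfolding locally_compact_space_def locally_compact_group_def by simp
  moreover have "Hausdorff_space (euclidean :: 'h topology)" by (simp add: Hausdorff_space_def separation_t2 disjnt_def)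
  ultimately have "completely_regular_space (euclidean :: 'h topology)"
    using locally_compact_regular_imp_completely_regular_space by blast
  note cr = this
  have ST: "compactin euclidean S" "closedin euclidean T" "disjnt S T" using S T by (simp_all add: disjnt_def)
  obtain f :: "'h \<Rightarrow> real" where f: "continuous_map euclidean (top_of_set {0..1}) f" "f ` T \<subseteq> {0}" "f ` S \<subseteq> {1}"
    using Urysohn_completely_regular_compact_closed[OF zero_le_one cr ST] .
  have c: "continuous_on UNIV f" and r: "f x \<in> {0..1}" for x using f(1) by (auto simp: continuous_map_in_subtopology)
  show ?thesis
  proof (intro exI[of _ f] conjI allI ballI)
    show "f x = 1" if "x \<in> S" for x using f(3) that by blast
    show "f x = 0" if "x \<in> T" for x using f(2) that by blast
  qed (fact c r)+
qed

section \<open>The Eberlein convolution with a regular model set\<close>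

lemma cm_set_integrable:
  assumes \<nu>: "radon_cmeasure \<nu> h" and A: "compact A" and f: "f \<in> borel_measurable borel" "\<And>x. cmod (f x) \<le> B"
  shows "set_integrable \<nu> A (\<lambda>x. f x * h x)"
  unfolding set_integrable_def
proof (rule integrableI_bounded_set_indicator[where B=B])
  have s: "sets \<nu> = sets borel" and h: "h \<in> borel_measurable borel" "\<And>x. cmod (h x) = 1"
    using \<nu> by (auto simp: radon_cmeasure_def)
  show "A \<in> sets \<nu>" using A s by (simp add: borel_compact)
  show "(\<lambda>x. f x * h x) \<in> borel_measurable \<nu>"
    unfolding measurable_cong_sets[OF s refl] using f(1) h(1) by (rule borel_measurable_times)
  show "emeasure \<nu> A < \<infinity>" using \<nu> A by (simp add: radon_cmeasure_def)
  show "AE x in \<nu>. x \<in> A \<longrightarrow> cmod (f x * h x) \<le> B" using f(2) h(2) by (simp add: norm_mult)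
qed

text \<open>The carrier \<open>K\<close> is kept apart from \<open>A\<close> so that a translated
  test function is bounded by the mass of one ball, however large \<open>A\<close> is.\<close>

lemma cm_set_integral_bound:
  assumes \<nu>: "radon_cmeasure \<nu> h" and K: "compact K"
    and f: "\<And>x. x \<in> A \<Longrightarrow> x \<notin> K \<Longrightarrow> f x = 0" "\<And>x. cmod (f x) \<le> B"
  shows "cmod (cm_set_integral \<nu> h A f) \<le> B * measure \<nu> K"
proof -
  have s: "sets \<nu> = sets borel" and h: "\<And>x. cmod (h x) = 1" and fin: "emeasure \<nu> K < \<infinity>"
    using \<nu> K by (auto simp: radon_cmeasure_def)
  have B: "B \<ge> 0" by (rule order_trans[OF norm_ge_zero f(2)[of undefined]])
  have K': "K \<in> sets \<nu>" using K s by (simp add: borel_compact)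
  have "cmod (cm_set_integral \<nu> h A f) \<le> (\<integral>x. cmod (indicator A x *\<^sub>R (f x * h x)) \<partial>\<nu>)"
    unfolding cm_set_integral_def set_lebesgue_integral_def by (rule integral_norm_bound)
  also have "\<dots> \<le> (\<integral>x. B * indicator K x \<partial>\<nu>)"
  proof (rule integral_mono')
    show "integrable \<nu> (\<lambda>x. B * indicator K x)" using K' fin by (intro integrable_mult_right) simp
    show "0 \<le> B * indicator K x" for x using B by simp
    show "cmod (indicator A x *\<^sub>R (f x * h x)) \<le> B * indicator K x" for x
      using f(1)[of x] f(2)[of x] B h[of x] by (auto simp: indicator_def norm_mult)
  qed
  also have "\<dots> = B * measure \<nu> K" using K' fin by simp
  finally show ?thesis .
qed

lemma cm_set_integral_sum:
  assumes \<nu>: "radon_cmeasure \<nu> h" and A: "compact A"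
    and f: "\<And>i. i \<in> I \<Longrightarrow> f i \<in> borel_measurable borel" "\<And>i x. i \<in> I \<Longrightarrow> cmod (f i x) \<le> B i"
  shows "cm_set_integral \<nu> h A (\<lambda>x. \<Sum>i\<in>I. f i x) = (\<Sum>i\<in>I. cm_set_integral \<nu> h A (f i))"
proof -
  have "set_integrable \<nu> A (\<lambda>x. f i x * h x)" if "i \<in> I" for i
    by (rule cm_set_integrable[OF \<nu> A f(1)[OF that] f(2)[OF that]])
  then show ?thesis
    unfolding cm_set_integral_def set_lebesgue_integral_def set_integrable_def sum_distrib_right scaleR_sum_right
    by (rule Bochner_Integration.integral_sum)
qed

lemma cm_set_integral_cmult:
  "cm_set_integral \<nu> h A (\<lambda>x. c * f x) = c * cm_set_integral \<nu> h A f"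
  unfolding cm_set_integral_def by (simp add: mult.assoc)

lemma bounded_functional_cm_set_integral:
  fixes A :: "'a::euclidean_space set"
  assumes \<nu>: "radon_cmeasure \<nu> h" and A: "compact A" and C: "measure \<nu> A \<le> C * vol A" "vol A > 0"
  shows "bounded_functional (\<lambda>g::'a \<Rightarrow>\<^sub>C complex. complex_of_real (1 / vol A) * cm_set_integral \<nu> h A g) C"
proof
  fix f g :: "'a \<Rightarrow>\<^sub>C complex" and c :: complex
  have m: "apply_bcontfun f \<in> borel_measurable borel" for f :: "'a \<Rightarrow>\<^sub>C complex"
    by (rule borel_measurable_continuous_onI) simp
  have i: "set_integrable \<nu> A (\<lambda>x. apply_bcontfun f x * h x)" for f
    by (rule cm_set_integrable[OF \<nu> A m norm_bounded])
  have "cm_set_integral \<nu> h A (apply_bcontfun (f + g)) = cm_set_integral \<nu> h A f + cm_set_integral \<nu> h A g"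
    unfolding cm_set_integral_def plus_bcontfun.rep_eq distrib_right by (rule set_integral_add(2)[OF i i])
  then show "complex_of_real (1 / vol A) * cm_set_integral \<nu> h A (apply_bcontfun (f + g)) =
    complex_of_real (1 / vol A) * cm_set_integral \<nu> h A f + complex_of_real (1 / vol A) * cm_set_integral \<nu> h A g"
    by (simp only: distrib_left)
  have "apply_bcontfun (shift c 0 f) = (\<lambda>x. c * f x)" by (simp add: fun_eq_iff)
  then show "complex_of_real (1 / vol A) * cm_set_integral \<nu> h A (apply_bcontfun (shift c 0 f)) =
    c * (complex_of_real (1 / vol A) * cm_set_integral \<nu> h A f)"
    by (simp only: cm_set_integral_cmult mult.left_commute)
  have "cmod (cm_set_integral \<nu> h A f) \<le> norm f * measure \<nu> A"
    by (rule cm_set_integral_bound[OF \<nu> A _ norm_bounded]) simp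
  also have "\<dots> \<le> norm f * (C * vol A)" by (rule mult_left_mono[OF C(1)]) simp
  finally have "cmod (cm_set_integral \<nu> h A f) / vol A \<le> C * norm f"
    using C(2) by (simp add: pos_divide_le_eq mult_ac)
  then show "cmod (complex_of_real (1 / vol A) * cm_set_integral \<nu> h A f) \<le> C * norm f"
    using C(2) by (simp add: norm_mult norm_divide)
qed

lemma van_Hove_bdry: "van_Hove A \<Longrightarrow> (\<lambda>n. vol (bdry R (A n)) / vol (A n)) \<longlonglongrightarrow> 0"
  unfolding van_Hove_def by simp

text \<open>Supplies the common bound for the averaging functionals: mass is controlled by the
  volume of a unit thickening, whose extra layer is eventually smaller than the set.\<close>

lemma translation_bounded_averages:
  fixes A :: "nat \<Rightarrow> 'a::euclidean_space set"
  assumes A: "averaging_sequence A" "van_Hove A" and \<nu>: "radon_cmeasure \<nu> h" "translation_bounded \<nu>"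
  shows "\<exists>C. \<forall>\<^sub>F n in sequentially. measure \<nu> (A n) \<le> C * vol (A n)"
proof -
  have s: "sets \<nu> = sets borel" using \<nu>(1) by (simp add: radon_cmeasure_def)
  have comp: "compact (A n)" for n using A by (simp add: averaging_sequence_def)
  obtain c where c: "c > 0" "\<And>x. emeasure \<nu> (cball x 2) \<le> ennreal c"
    using translation_bounded_ball[OF \<nu>(2) s] by metis
  have c': "emeasure \<nu> (ball x (2 * 1)) \<le> ennreal c" for x
    by (rule order_trans[OF emeasure_mono c(2)[of x]]) (use s in auto)
  let ?v = "measure lebesgue (ball (0::'a) 1)"
  have v: "?v > 0" using content_ball_pos[of 1 "0::'a"] by simp
  have le: "measure \<nu> (A n) * ?v \<le> c * (vol (A n) + vol (bdry 1 (A n)))" for n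
  proof -
    have "(\<Union>x\<in>A n. ball x 1) \<subseteq> A n \<union> bdry 1 (A n)"
      using thicken_set[of 1 "A n"] by (rule order_trans[rotated]) (intro UN_mono ball_subset_cball order_refl)
    from measure_le_volume[OF zero_less_one vol_thickened_le(1)[OF comp] this s less_imp_le[OF c(1)] c']
    have "measure \<nu> (A n) * ?v \<le> c * vol (A n \<union> bdry 1 (A n))" by (simp add: vol_def)
    also have "\<dots> \<le> c * (vol (A n) + vol (bdry 1 (A n)))"
      using c by (intro mult_left_mono vol_thickened_le comp) auto
    finally show ?thesis .
  qed
  have "\<forall>\<^sub>F n in sequentially. vol (bdry 1 (A n)) / vol (A n) < 1"
    using order_tendstoD(2)[OF van_Hove_bdry[OF A(2)], of 1] by simp
  then have "\<forall>\<^sub>F n in sequentially. measure \<nu> (A n) \<le> 2 * c / ?v * vol (A n)"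
    using averaging_sequence_vol_pos[OF A(1)]
  proof eventually_elim
    case (elim n)
    then have "vol (bdry 1 (A n)) \<le> vol (A n)" by (simp add: field_simps)
    then have "c * (vol (A n) + vol (bdry 1 (A n))) \<le> c * (2 * vol (A n))" using c by (intro mult_left_mono) auto
    with le[of n] have "measure \<nu> (A n) * ?v \<le> 2 * c * vol (A n)" by simp
    then show ?case using v by (simp add: pos_le_divide_eq)
  qed
  then show ?thesis by blast
qed

lemma null_FB_almost_periodic:
  fixes A :: "nat \<Rightarrow> 'a::euclidean_space set"
  assumes A: "averaging_sequence A" "van_Hove A" and \<nu>: "radon_cmeasure \<nu> h" "translation_bounded \<nu>"
    and FB: "null_FB_spectrum A \<nu> h" and g: "almost_periodic g"
  shows "(\<lambda>n. complex_of_real (1 / vol (A n)) * cm_set_integral \<nu> h (A n) g) \<longlonglongrightarrow> 0"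
proof -
  obtain C where "\<forall>\<^sub>F n in sequentially. measure \<nu> (A n) \<le> C * vol (A n)"
    using translation_bounded_averages[OF A \<nu>] by blast
  with averaging_sequence_vol_pos[OF A(1)]
  have "\<forall>\<^sub>F n in sequentially. vol (A n) > 0 \<and> measure \<nu> (A n) \<le> C * vol (A n)"
    by (rule eventually_conj)
  then obtain N where N: "\<And>n. n \<ge> N \<Longrightarrow> vol (A n) > 0 \<and> measure \<nu> (A n) \<le> C * vol (A n)"
    unfolding eventually_sequentially by blast
  have comp: "compact (A n)" for n using A by (simp add: averaging_sequence_def)
  define \<Phi> where "\<Phi> n g = complex_of_real (1 / vol (A n)) * cm_set_integral \<nu> h (A n) (apply_bcontfun g)" for n g
  \<comment> \<open>Positive volume and the bound \<open>C\<close> hold only from \<open>N\<close>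
    on, so the limit theorem is applied to the shifted sequence.\<close>
  have "(\<lambda>n. \<Phi> (n + N) g) \<longlonglongrightarrow> 0"
  proof (rule bounded_functional_limit[OF _ _ g])
    show "bounded_functional (\<Phi> (n + N)) C" for n
      unfolding \<Phi>_def using N[of "n + N"] by (intro bounded_functional_cm_set_integral \<nu> comp) auto
    fix k :: 'a
    have eq: "apply_bcontfun (Bcontfun (echar k)) = (\<lambda>t. exp (- 2 * pi * \<i> * complex_of_real (k \<bullet> t)))"
      using Bcontfun_inverse[OF trig_poly_bcontfun[OF trig_char[of k]]] by (simp add: fun_eq_iff echar_def)
    have "(\<lambda>n. \<Phi> n (Bcontfun (echar k))) \<longlonglongrightarrow> 0"
      unfolding \<Phi>_def eq using FB unfolding null_FB_spectrum_def by blast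
    then show "(\<lambda>n. \<Phi> (n + N) (Bcontfun (echar k))) \<longlonglongrightarrow> 0" by (rule LIMSEQ_ignore_initial_segment)
  qed
  then have "(\<lambda>n. \<Phi> n g) \<longlonglongrightarrow> 0" by (rule LIMSEQ_offset)
  then show ?thesis by (simp add: \<Phi>_def)
qed

text \<open>Injectivity of the projection makes the star map single-valued and lets lattice points
  index the model set.\<close>

lemma model_set_sum:
  assumes "inj_on fst L"
  shows "(\<Sum>x\<in>model_set L W \<inter> A. f x) = (\<Sum>y\<in>{y\<in>L. snd y \<in> W \<and> fst y \<in> A}. f (fst y))"
proof -
  have star: "star_map L (fst y) = snd y" if "y \<in> L" for y
  proof -
    have "(THE z. z \<in> L \<and> fst z = fst y) = y"
      using that assms by (intro the_equality) (auto dest: inj_onD)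
    then show ?thesis by (simp add: star_map_def)
  qed
  have "model_set L W \<inter> A = fst ` {y\<in>L. snd y \<in> W \<and> fst y \<in> A}"
  proof (rule set_eqI)
    fix x
    show "x \<in> model_set L W \<inter> A \<longleftrightarrow> x \<in> fst ` {y\<in>L. snd y \<in> W \<and> fst y \<in> A}"
    proof
      assume "x \<in> model_set L W \<inter> A"
      then obtain y where "y \<in> L" "x = fst y" "star_map L x \<in> W" "x \<in> A" by (auto simp: model_set_def)
      then show "x \<in> fst ` {y\<in>L. snd y \<in> W \<and> fst y \<in> A}" using star[of y] by (intro image_eqI[of _ _ y]) simp_all
    next
      assume "x \<in> fst ` {y\<in>L. snd y \<in> W \<and> fst y \<in> A}"
      then obtain y where "y \<in> L" "x = fst y" "snd y \<in> W" "x \<in> A" by blast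
      then show "x \<in> model_set L W \<inter> A" using star[of y] by (simp add: model_set_def)
    qed
  qed
  moreover have "inj_on fst {y\<in>L. snd y \<in> W \<and> fst y \<in> A}"
    using assms by (rule inj_on_subset) blast
  ultimately show ?thesis by (simp add: sum.reindex)
qed

theorem theorem4p5:
  fixes A :: "nat \<Rightarrow> 'a::euclidean_space set"
    and \<nu> :: "'a measure" and h :: "'a \<Rightarrow> complex"
    and m :: "'h::{topological_ab_group_add, t2_space} measure"
    and \<Lambda> :: "'a set"
  assumes "averaging_sequence A" and "symmetric_sequence A" and "van_Hove A"
    and "radon_cmeasure \<nu> h" and "translation_bounded \<nu>"
    and "null_FB_spectrum A \<nu> h"
    and "haar_measure m"
    and "regular_model_set m \<Lambda>"
  shows "eberlein_conv_dirac_is_zero A \<nu> h \<Lambda>"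
  unfolding eberlein_conv_dirac_is_zero_def
proof
  note \<nu> = assms(4)
  obtain L :: "('a \<times> 'h) set" and W where L: "cut_and_project_scheme L"
    and W: "compact W" "emeasure m (frontier W) = 0" and \<Lambda>: "\<Lambda> = model_set L W"
    using assms(8) unfolding regular_model_set_def by blast
  have inj: "inj_on fst L" and lat: "is_lattice L" and lc: "locally_compact_group TYPE('h)"
    using L by (simp_all add: cut_and_project_scheme_def)
  interpret lattice L by unfold_locales (rule lat)
  have s: "sets \<nu> = sets borel" using \<nu> by (simp add: radon_cmeasure_def)
  have comp: "compact (A n)" for n using assms(1) by (simp add: averaging_sequence_def)
  have sym: "- x \<in> A n" if "x \<in> A n" for x n
  proof -
    have "- x \<in> uminus ` A n" using that by (rule imageI)
    then show ?thesis using assms(2) by (simp add: symmetric_sequence_def)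
  qed
  have frontier: "frontier W = W - interior W"
    using compact_imp_closed[OF W(1)] by (simp add: frontier_def)
  have frW: "compact (frontier W)" unfolding frontier by (intro compact_diff W open_interior)
  fix \<phi> :: "'a \<Rightarrow> complex" assume "\<phi> \<in> Cc"
  then have \<phi>: "continuous_on UNIV \<phi>" "compact (closure {x. \<phi> x \<noteq> 0})" by (auto simp: Cc_def)
  obtain R where R: "R > 0" "\<And>x. x \<in> closure {x. \<phi> x \<noteq> 0} \<Longrightarrow> norm x \<le> R"
    using compact_imp_bounded[OF \<phi>(2)] unfolding bounded_pos by blast
  have \<phi>0: "\<forall>x. x \<notin> cball 0 R \<longrightarrow> \<phi> x = 0"
  proof (intro allI impI, rule ccontr)
    fix x assume x: "x \<notin> cball 0 R" "\<phi> x \<noteq> 0"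
    then have "x \<in> closure {x. \<phi> x \<noteq> 0}" by (intro subsetD[OF closure_subset]) simp
    then show False using R(2) x by simp
  qed
  obtain B where B: "B > 0" "\<And>x. cmod (\<phi> x) \<le> B"
    using compact_support_bounded[OF \<phi>(1) compact_cball[of 0 R] \<phi>0] by blast
  obtain c where c: "c > 0" "\<And>x. emeasure \<nu> (cball x R) \<le> ennreal c"
    using translation_bounded_ball[OF assms(5) s] by metis
  obtain M where M: "M > 0" "\<And>B. bounded B \<Longrightarrow> finite {y\<in>L. snd y \<in> W \<and> fst y \<in> B}"
    "\<And>B Q. Q \<in> lmeasurable \<Longrightarrow> (\<Union>x\<in>B. ball x 1) \<subseteq> Q \<Longrightarrow> real (card {y\<in>L. snd y \<in> W \<and> fst y \<in> B}) \<le> M * vol Q"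
    using count_volume[OF W(1)] by blast
  define T where "T D = {y\<in>L. snd y \<in> W \<and> fst y \<in> D}" for D :: "'a set"
  define I where "I n y = cm_set_integral \<nu> h (A n) (\<lambda>x. \<phi> (x + fst y))" for n and y :: "'a \<times> 'h"
  \<comment> \<open>A translate of \<open>\<phi>\<close> lives on a ball of radius \<open>R\<close>,
    of mass at most \<open>c\<close>; thus \<open>b\<close> bounds the contribution of one lattice
    point, uniformly in \<open>n\<close>.\<close>
  define b where "b = B * c"
  have b: "b > 0" using B c by (simp add: b_def)
  have Ib: "cmod (I n y) \<le> b" for n y
  proof -
    have "cmod (I n y) \<le> B * measure \<nu> (cball (- fst y) R)"
      unfolding I_def
    proof (rule cm_set_integral_bound[OF \<nu> compact_cball _ B(2)])
      fix x assume "x \<notin> cball (- fst y) R"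
      moreover have "dist (- fst y) x = norm (x + fst y)" by (metis diff_minus_eq_add dist_commute dist_norm)
      ultimately show "\<phi> (x + fst y) = 0" using \<phi>0 by simp
    qed
    also have "measure \<nu> (cball (- fst y) R) \<le> c"
      using c by (simp add: measure_def enn2real_leI)
    finally show ?thesis using B(1) by (simp add: b_def mult_left_mono)
  qed
  have bdd_bdry: "bounded (bdry r (A n))" for r n
    by (intro compact_imp_bounded compact_K_boundary comp compact_cball)
  have finT: "finite (T (A n))" "finite (T (bdry R (A n)))" for n
    unfolding T_def by (intro M(2) compact_imp_bounded[OF comp] bdd_bdry)+
  have X: "restr_conv_dirac \<nu> h \<Lambda> (A n) \<phi> = (\<Sum>y\<in>T (A n). I n y)" for n
    unfolding restr_conv_dirac_def \<Lambda> model_set_sum[OF inj] T_def I_def ..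
  show "(\<lambda>n. restr_conv_dirac \<nu> h \<Lambda> (A n) \<phi> / complex_of_real (vol (A n))) \<longlonglongrightarrow> 0"
  proof (rule tendstoI)
    fix \<epsilon> :: real assume \<epsilon>: "\<epsilon> > 0"
    \<comment> \<open>The change of window will cost \<open>b * e\<close> times at most twice the
      volume, that is half of \<open>\<epsilon>\<close>; the two other errors get a quarter
      each.\<close>
    define e where "e = \<epsilon> / (4 * b)"
    have e: "e > 0" using \<epsilon> b by (simp add: e_def)
    obtain E r where E: "open E" "frontier W \<subseteq> E"
      and EA: "\<forall>D. compact D \<longrightarrow> finite {y\<in>L. snd y \<in> E \<and> fst y \<in> D} \<and>
         real (card {y\<in>L. snd y \<in> E \<and> fst y \<in> D}) \<le> e * (vol D + vol (bdry r D))"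
      using window_density[OF L assms(7) frW W(2) e] by (elim exE conjE) (rule that)
    \<comment> \<open>As \<open>E\<close> contains the frontier, \<open>W - E\<close> lies in the
      interior of \<open>W\<close>, so \<open>\<omega>\<close> can be 1 on it and 0 off the
      interior. It then differs from the indicator of \<open>W\<close> only at points of
      \<open>W\<close> in \<open>E\<close>.\<close>
    have WE: "compact (W - E)" by (intro compact_diff W E)
    have cl: "closed (- interior W)" by (simp add: closed_Compl)
    have dj: "(W - E) \<inter> - interior W = {}" using E(2) unfolding frontier by blast
    obtain \<omega> :: "'h \<Rightarrow> real" where om: "continuous_on UNIV \<omega>" "\<forall>x. \<omega> x \<in> {0..1}"
      "\<forall>x\<in>W - E. \<omega> x = 1" "\<forall>x\<in>- interior W. \<omega> x = 0"
      using Urysohn_locally_compact_group[OF lc WE cl dj] by (elim exE conjE) (rule that)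
    interpret weighted_comb L \<phi> R \<omega> W
    proof
      show "\<forall>x. x \<notin> W \<longrightarrow> \<omega> x = 0" using om(4) subsetD[OF interior_subset, of _ W] by auto
    qed (use lc \<phi>(1) \<phi>0 om(1) W(1) in auto)
    \<comment> \<open>\<open>Y\<close> still sums over the points in \<open>A n\<close> but with
      weight \<open>\<omega>\<close>; \<open>Z\<close> uses the whole comb. The passage to
      \<open>Y\<close> costs the change of window, that to \<open>Z\<close> the truncation.\<close>
    define Y where "Y n = (\<Sum>y\<in>T (A n). complex_of_real (\<omega> (snd y)) * I n y)" for n
    define Z where "Z n = cm_set_integral \<nu> h (A n) (apply_bcontfun comb_fun)" for n
    have XY: "cmod ((\<Sum>y\<in>T (A n). I n y) - Y n) \<le> b * (e * (vol (A n) + vol (bdry r (A n))))" for n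
    proof -
      let ?S = "{y\<in>T (A n). snd y \<in> E}"
      have "(\<Sum>y\<in>T (A n). I n y) - Y n = (\<Sum>y\<in>T (A n). complex_of_real (1 - \<omega> (snd y)) * I n y)"
        by (simp add: Y_def sum_subtractf left_diff_distrib)
      also have "\<dots> = (\<Sum>y\<in>?S. complex_of_real (1 - \<omega> (snd y)) * I n y)"
        by (rule sum.mono_neutral_right) (use finT(1) om(3) in \<open>auto simp: T_def\<close>)
      also have "cmod \<dots> \<le> real (card ?S) * b"
      proof (rule sum_norm_bound)
        fix y :: "'a \<times> 'h"
        have "\<bar>1 - \<omega> (snd y)\<bar> \<le> 1" using om(2)[rule_format, of "snd y"] by auto
        then have "\<bar>1 - \<omega> (snd y)\<bar> * cmod (I n y) \<le> 1 * b" by (intro mult_mono Ib) auto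
        then show "cmod (complex_of_real (1 - \<omega> (snd y)) * I n y) \<le> b" unfolding norm_mult norm_of_real by simp
      qed
      also have "real (card ?S) \<le> e * (vol (A n) + vol (bdry r (A n)))"
      proof -
        have "card ?S \<le> card {y\<in>L. snd y \<in> E \<and> fst y \<in> A n}"
          by (rule card_mono) (use EA[rule_format, OF comp[of n]] in \<open>auto simp: T_def\<close>)
        then show ?thesis using EA[rule_format, OF comp[of n]] by linarith
      qed
      finally show ?thesis using b by (simp add: mult.commute mult_left_mono)
    qed
    have YZ: "cmod (Y n - Z n) \<le> b * (M * vol (bdry (R + 1) (A n)))" for n
    proof -
      let ?T = "T (A n \<union> bdry R (A n))"
      have T_un: "?T = T (A n) \<union> T (bdry R (A n))" by (auto simp: T_def)
      have fin: "finite ?T" unfolding T_un using finT by simp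
      have comb: "apply_bcontfun comb_fun x = (\<Sum>y\<in>?T. summand x 0 y)" if x: "x \<in> A n" for x
        unfolding apply_comb_fun
      proof (rule comb_eq[OF fin])
        show "?T \<subseteq> L" by (auto simp: T_def)
        fix y assume y: "y \<in> L" "summand x 0 y \<noteq> 0"
        \<comment> \<open>A summand at \<open>x\<close> is nonzero only for points within
          \<open>R\<close> of \<open>- x\<close>, and symmetry puts \<open>- x\<close> back into
          \<open>A n\<close>.\<close>
        have "fst y \<in> A n \<union> bdry R (A n)"
          using summand_nonzero(1)[OF y(2)] sym[OF x] thicken_set[of R "A n"] by blast
        then show "y \<in> ?T" using y(1) summand_nonzero(2)[OF y(2)] by (simp add: T_def)
      qed
      have "Z n = cm_set_integral \<nu> h (A n) (\<lambda>x. \<Sum>y\<in>?T. summand x 0 y)"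
        unfolding Z_def cm_set_integral_def
        by (rule set_lebesgue_integral_cong) (use comp s comb in \<open>auto intro!: borel_compact\<close>)
      also have "\<dots> = (\<Sum>y\<in>?T. cm_set_integral \<nu> h (A n) (\<lambda>x. summand x 0 y))"
      proof (rule cm_set_integral_sum[OF \<nu> comp])
        fix y :: "'a \<times> 'h"
        show "(\<lambda>x. summand x 0 y) \<in> borel_measurable borel"
          unfolding summand_def
          by (intro borel_measurable_continuous_onI continuous_intros continuous_on_compose2[OF \<phi>(1)]) auto
        show "cmod (summand x 0 y) \<le> B * \<bar>\<omega> (0 + snd y)\<bar>" for x
          unfolding summand_def norm_mult norm_of_real by (intro mult_right_mono B) simp
      qed
      also have "\<dots> = (\<Sum>y\<in>?T. complex_of_real (\<omega> (snd y)) * I n y)"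
        unfolding I_def cm_set_integral_cmult[symmetric] by (simp add: summand_def mult.commute)
      finally have Z: "Z n = (\<Sum>y\<in>?T. complex_of_real (\<omega> (snd y)) * I n y)" .
      \<comment> \<open>Surplus points lie in the layer of radius \<open>R\<close>; counting them by
        unit balls enlarges it to \<open>R + 1\<close>.\<close>
      have "Z n - Y n = (\<Sum>y\<in>?T - T (A n). complex_of_real (\<omega> (snd y)) * I n y)"
        unfolding Z Y_def by (rule sum_diff[symmetric]) (use fin T_un in auto)
      also have "cmod \<dots> \<le> real (card (?T - T (A n))) * b"
      proof (rule sum_norm_bound)
        fix y :: "'a \<times> 'h"
        have "\<bar>\<omega> (snd y)\<bar> \<le> 1" using om(2)[rule_format, of "snd y"] by auto
        then have "\<bar>\<omega> (snd y)\<bar> * cmod (I n y) \<le> 1 * b" by (intro mult_mono Ib) auto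
        then show "cmod (complex_of_real (\<omega> (snd y)) * I n y) \<le> b" unfolding norm_mult norm_of_real by simp
      qed
      also have "real (card (?T - T (A n))) \<le> M * vol (bdry (R + 1) (A n))"
      proof -
        have "card (?T - T (A n)) \<le> card (T (bdry R (A n)))"
          by (rule card_mono) (use finT T_un in auto)
        moreover have "(\<Union>x\<in>bdry R (A n). ball x 1) \<subseteq> bdry (R + 1) (A n)"
          using thicken_bdry[of 1 R "A n"] by (rule order_trans[rotated]) (intro UN_mono ball_subset_cball order_refl)
        then have "real (card (T (bdry R (A n)))) \<le> M * vol (bdry (R + 1) (A n))"
          unfolding T_def by (intro M(3) lmeasurable_bdry comp)
        ultimately show ?thesis by linarith
      qed
      finally show ?thesis using b by (simp add: norm_minus_commute mult.commute mult_left_mono)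
    qed
    have Z_lim: "(\<lambda>n. complex_of_real (1 / vol (A n)) * Z n) \<longlonglongrightarrow> 0"
      unfolding Z_def by (rule null_FB_almost_periodic[OF assms(1,3) \<nu> assms(5,6) almost_periodic_comb_fun])
    have 1: "\<forall>\<^sub>F n in sequentially. cmod (complex_of_real (1 / vol (A n)) * Z n) < \<epsilon> / 4"
      using tendstoD[OF Z_lim, of "\<epsilon> / 4"] \<epsilon> by (simp add: dist_norm)
    have 2: "\<forall>\<^sub>F n in sequentially. vol (bdry (R + 1) (A n)) / vol (A n) < \<epsilon> / (4 * b * M)"
      using \<epsilon> b M(1) by (intro order_tendstoD(2)[OF van_Hove_bdry[OF assms(3)]]) simp
    have 3: "\<forall>\<^sub>F n in sequentially. vol (bdry r (A n)) / vol (A n) < 1"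
      by (intro order_tendstoD(2)[OF van_Hove_bdry[OF assms(3)]]) simp
    show "\<forall>\<^sub>F n in sequentially. dist (restr_conv_dirac \<nu> h \<Lambda> (A n) \<phi> / complex_of_real (vol (A n))) 0 < \<epsilon>"
      using 1 2 3 averaging_sequence_vol_pos[OF assms(1)]
    proof eventually_elim
      case (elim n)
      let ?v = "vol (A n)" and ?X = "\<Sum>y\<in>T (A n). I n y"
      have v: "?v > 0" by (rule elim)
      have z: "cmod (Z n) < \<epsilon> / 4 * ?v"
        using elim(1) v by (simp add: norm_mult norm_divide field_simps)
      have "b * (M * vol (bdry (R + 1) (A n))) < \<epsilon> / 4 * ?v"
        using elim(2) v b M(1) by (simp add: field_simps)
      moreover have "b * (e * (?v + vol (bdry r (A n)))) < b * (e * (2 * ?v))"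
        using elim(3) v b e by (intro mult_strict_left_mono) (simp_all add: field_simps)
      moreover have "b * (e * (2 * ?v)) = \<epsilon> / 2 * ?v" using b by (simp add: e_def)
      moreover have "cmod ?X \<le> cmod (?X - Y n) + cmod (Y n - Z n) + cmod (Z n)"
        using norm_triangle_ineq[of "?X - Y n" "Y n"] norm_triangle_ineq[of "Y n - Z n" "Z n"] by simp
      ultimately have "cmod ?X < \<epsilon> / 4 * ?v + \<epsilon> / 4 * ?v + \<epsilon> / 2 * ?v"
        using z XY[of n] YZ[of n] by linarith
      then have "cmod ?X < \<epsilon> * ?v" by simp
      then show ?case unfolding X using v by (simp add: norm_divide pos_divide_less_eq)
    qed
  qed
qed

end
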